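(* Let $\mathcal{S}$ be the family of biquadratic fields $K=\mathbb{Q}(\sqrt{a},\sqrt{b})$ with $a,b$ odd squarefree integers, and for $X>0$ let $\mathcal{S}(X)=\#\{K\in\mathcal{S}: |\Delta_K|\le X\}$, where $\Delta_K$ is the discriminant of $K$. Then, as $X\to\infty$, \[ \mathcal{S}(X)=\frac{7}{1920}\sqrt{X}\,\log^2 X\prod_{p}\Big(1-\frac1p\Big)^3\Big(1+\frac3p\Big)+O(\sqrt{X}\log X), \] the product running over all primes $p$.
   Formalization: The odd squarefree integers a, b are required to be positive (real biquadratic fields): with negative a, b also allowed the leading constant would be 7/480, so the claim with constant 7/1920 is false as literally stated. *)

theory Defs
  imports
    "HOL-Analysis.Infinite_Products"
    "HOL-Library.FuncSet"
    "HOL-Library.Landau_Symbols"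
    "HOL-Computational_Algebra.Computational_Algebra"
    "Jordan_Normal_Form.Determinant"
begin

text \<open>
  Number fields are taken as subfields of the complex numbers.  A biquadratic field is Galois over
  the rationals, so counting such subfields is the same as counting isomorphism classes.
\<close>

definition complex_subfield :: "complex set \<Rightarrow> bool" where
  "complex_subfield F \<longleftrightarrow> 1 \<in> F \<and> (\<forall>x\<in>F. \<forall>y\<in>F. x - y \<in> F \<and> x * y \<in> F) \<and> (\<forall>x\<in>F. inverse x \<in> F)"

definition rat_adjoin :: "complex set \<Rightarrow> complex set" where
  "rat_adjoin A = \<Inter>{F. complex_subfield F \<and> A \<subseteq> F}"

definition field_degree :: "complex set \<Rightarrow> nat" where
  "field_degree K = vector_space.dim (\<lambda>(q::rat) (x::complex). of_rat q * x) K"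

definition ring_of_integers :: "complex set \<Rightarrow> complex set" where
  "ring_of_integers K = {x \<in> K. algebraic_int x}"

definition integral_basis :: "complex set \<Rightarrow> complex list \<Rightarrow> bool" where
  "integral_basis K ws \<longleftrightarrow> set ws \<subseteq> ring_of_integers K \<and>
     (\<forall>x \<in> ring_of_integers K. \<exists>!cs :: int list.
        length cs = length ws \<and> x = (\<Sum>i<length ws. of_int (cs ! i) * ws ! i))"

text \<open>
  Extensionality makes the embeddings of \<open>K\<close> pairwise different as HOL functions exactly when they
  differ on \<open>K\<close>, so that the trace sums each embedding once.
\<close>

definition embeddings :: "complex set \<Rightarrow> (complex \<Rightarrow> complex) set" where
  "embeddings K = {\<sigma> \<in> extensional K. \<sigma> 1 = 1 \<and>
     (\<forall>x\<in>K. \<forall>y\<in>K. \<sigma> (x + y) = \<sigma> x + \<sigma> y \<and> \<sigma> (x * y) = \<sigma> x * \<sigma> y)}"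

definition field_trace :: "complex set \<Rightarrow> complex \<Rightarrow> complex" where
  "field_trace K x = (\<Sum>\<sigma>\<in>embeddings K. \<sigma> x)"

definition discriminant :: "complex set \<Rightarrow> int" where
  "discriminant K = (THE d :: int. \<exists>ws. integral_basis K ws \<and>
     of_int d = Determinant.det (Matrix.mat (length ws) (length ws)
                  (\<lambda>(i, j). field_trace K (ws ! i * ws ! j))))"

text \<open>
  The squarefree integers \<open>a\<close> and \<open>b\<close> are positive, that is, the fields are real.  This is the reading
  under which the asymptotic constant is \<open>7/1920\<close>; with negative \<open>a\<close> and \<open>b\<close> admitted as well, the same
  count has leading constant \<open>7/480\<close>.  The degree condition excludes the degenerate
  pairs, for instance \<open>a = b\<close> or \<open>a = 1\<close>.
\<close>

definition biquadratic_family :: "complex set set" where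
  "biquadratic_family = {K. \<exists>a b :: int. 0 < a \<and> 0 < b \<and> odd a \<and> odd b \<and> squarefree a \<and> squarefree b \<and>
     K = rat_adjoin {csqrt (of_int a), csqrt (of_int b)} \<and> field_degree K = 4}"

definition biquadratic_count :: "real \<Rightarrow> nat" where
  "biquadratic_count X = card {K \<in> biquadratic_family. real_of_int \<bar>discriminant K\<bar> \<le> X}"

end

theory Submission
  imports Defs "HOL-Analysis.Analysis" "Jordan_Normal_Form.Char_Poly"
begin

text \<open>
  A real biquadratic field is determined by the unordered triple \<open>{g, u, v}\<close> of pairwise coprime positive
  integers for which its quadratic subfields are generated by the square roots of \<open>gu\<close>, \<open>gv\<close>, \<open>uv\<close>.
  Its discriminant is \<open>(guv)\<^sup>2\<close> or \<open>16 (guv)\<^sup>2\<close>, the former exactly if \<open>g \<equiv> u \<equiv> v\<close> modulo 4.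
  The congruence condition is detected by the character modulo 4, so that the count reduces to
  the summatory functions of triple Dirichlet convolutions of characters over odd squarefree integers.
  These are convolutions of an unrestricted triple convolution with a multiplicative function \<open>h\<close> for which
  the sum of \<open>\<bar>h n\<bar> n powr (- 3 / 4)\<close> converges. The nontrivial characters contribute only to the error
  term, and the leading constant is the Euler product of the sum of \<open>h n / n\<close>.
\<close>

section \<open>Multiplicative functions\<close>

text \<open>Origin of the constant. Write \<open>P\<close> for the Euler product. The ordered odd
  triples with \<open>g * u * v <= x\<close> number \<open>(P/5) x ln^2 x + O(x ln x)\<close>: a
  factor 1/2 comes from the threefold divisor function, a factor 2/5 from the prime 2, whose local
  factor loses \<open>1 + 3/2\<close>. Asymptotically a quarter of the triples is congruent, with
  cutoff \<open>sqrt X\<close>, and three quarters are not, with cutoff \<open>sqrt X / 4\<close>.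
  As \<open>ln (sqrt X) = ln X / 2\<close>, the total is \<open>P/20 * (1/4 + 3/16) = 7P/320\<close>
  times \<open>sqrt X ln^2 X\<close>. Each field is counted for 6 orderings, whence 7/1920. The
  exponent 3/4: away from 2 the linear coefficient in the local factor of \<open>h\<close> vanishes,
  so every exponent above 1/2 gives convergence, and one below 1 leaves room for the factor
  \<open>ln d\<close> that arises when \<open>ln^2 (x/d)\<close> is replaced by
  \<open>ln^2 x\<close>. The algebraic obstacle is that the full ring of integers must be known.
  Traces to the three quadratic subfields bound the denominators by 4, and the norm to one of them
  supplies the remaining parity condition.\<close>

text \<open>A multiplicative function given by its Bell series: \<open>c p\<close> is the power
  series of the values at the powers of \<open>p\<close>. With power series as data, Dirichlet
  convolution becomes multiplication at every prime. At 0 the empty product gives 1.\<close>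

definition euler_fun :: "(nat \<Rightarrow> real fps) \<Rightarrow> nat \<Rightarrow> real" where
  "euler_fun c n = (\<Prod>p\<in>prime_factors n. fps_nth (c p) (multiplicity p n))"

definition dirichlet_conv :: "(nat \<Rightarrow> real) \<Rightarrow> (nat \<Rightarrow> real) \<Rightarrow> nat \<Rightarrow> real" where
  "dirichlet_conv f g n = (\<Sum>d | d dvd n. f d * g (n div d))"

definition multiplicative :: "(nat \<Rightarrow> real) \<Rightarrow> bool" where
  "multiplicative f \<longleftrightarrow> f 1 = 1 \<and> (\<forall>a b. a > 0 \<longrightarrow> b > 0 \<longrightarrow> coprime a b \<longrightarrow> f (a * b) = f a * f b)"

text \<open>Strong induction: the full power of one prime divisor is split off, which leaves a
  smaller coprime cofactor.\<close>

lemma multiplicative_eqI: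
  assumes "multiplicative f" "multiplicative g"
    and pp: "\<And>p k. prime p \<Longrightarrow> f (p ^ k) = g (p ^ k)" and "n > 0"
  shows "f n = g n"
  using \<open>n > 0\<close>
proof (induction n rule: less_induct)
  case (less n)
  show ?case
  proof (cases "n = 1")
    case True then show ?thesis using assms by (simp add: multiplicative_def)
  next
    case False
    then obtain p where p: "prime p" "p dvd n" using prime_factor_nat by blast
    define k where "k = multiplicity p n"
    have np: "n \<noteq> 0" "\<not> is_unit p" using less p by auto
    obtain m where m: "n = p ^ k * m" "\<not> p dvd m"
      using multiplicity_decompose'[of n p] np unfolding k_def by blast
    have k0: "k > 0" using m p by (metis One_nat_def gr0I mult_1 power_0)
    have m0: "m > 0" using m less by (metis gr0I mult_0_right less_irrefl)
    have "m < n" using m m0 k0 p prime_gt_1_nat[of p] one_less_power[of p k] by simp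
    have cop: "coprime (p ^ k) m" using m p by (simp add: prime_imp_coprime)
    have "p ^ k > 0" using p prime_gt_0_nat by simp
    then have "f n = f (p ^ k) * f m" "g n = g (p ^ k) * g m"
      using assms(1,2) cop m0 m(1) unfolding multiplicative_def by blast+
    then show ?thesis using less.IH[OF \<open>m < n\<close> m0] pp p by simp
  qed
qed

text \<open>Primes outside the factorization have exponent 0 and contribute the constant coefficient
  1; hence \<open>a\<close>, \<open>b\<close> and \<open>a * b\<close> can be compared over one
  common set of primes.\<close>

lemma euler_fun_superset:
  assumes "finite P" "\<And>p. p \<in> P \<Longrightarrow> prime p" "prime_factors n \<subseteq> P"
    and "\<And>p. fps_nth (c p) 0 = 1"
  shows "euler_fun c n = (\<Prod>p\<in>P. fps_nth (c p) (multiplicity p n))"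
  unfolding euler_fun_def
proof (rule prod.mono_neutral_left)
  show "\<forall>p\<in>P - prime_factors n. fps_nth (c p) (multiplicity p n) = 1"
    using assms by (metis DiffE dvd_0_right not_dvd_imp_multiplicity_0 prime_factorsI multiplicity_zero)
qed (use assms in auto)

lemma euler_fun_prime_power:
  assumes "prime p" "fps_nth (c p) 0 = 1"
  shows "euler_fun c (p ^ k) = fps_nth (c p) k"
proof (cases "k = 0")
  case True then show ?thesis using assms by (simp add: euler_fun_def)
next
  case False
  have "prime_factors (p ^ k) = {p}"
    using assms False by (simp add: prime_factorization_prime_power)
  moreover have "multiplicity p (p ^ k) = k"
    using assms by (simp add: not_prime_0)
  ultimately show ?thesis by (simp add: euler_fun_def)
qed

lemma multiplicative_euler_fun:
  assumes "\<And>p. fps_nth (c p) 0 = 1"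
  shows "multiplicative (euler_fun c)"
  unfolding multiplicative_def
proof safe
  show "euler_fun c 1 = 1" by (simp add: euler_fun_def)
next
  fix a b :: nat assume ab: "a > 0" "b > 0" "coprime a b"
  have un: "prime_factors (a * b) = prime_factors a \<union> prime_factors b"
    using ab by (simp add: prime_factors_product)
  let ?P = "prime_factors a \<union> prime_factors b"
  have "euler_fun c (a * b) = (\<Prod>p\<in>?P. fps_nth (c p) (multiplicity p (a * b)))"
    by (rule euler_fun_superset) (use un assms in auto)
  also have "\<dots> = (\<Prod>p\<in>?P. fps_nth (c p) (multiplicity p a) * fps_nth (c p) (multiplicity p b))"
  proof (rule prod.cong)
    fix p assume "p \<in> ?P"
    then have p: "prime p" by auto
    then have mm: "multiplicity p (a * b) = multiplicity p a + multiplicity p b"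
      using ab by (simp add: prime_elem_multiplicity_mult_distrib)
    have "\<not> p dvd a \<or> \<not> p dvd b" using ab p by (metis coprime_common_divisor_nat not_prime_1)
    then show "fps_nth (c p) (multiplicity p (a * b)) = fps_nth (c p) (multiplicity p a) * fps_nth (c p) (multiplicity p b)"
      using assms mm by (auto simp: not_dvd_imp_multiplicity_0)
  qed simp
  also have "\<dots> = euler_fun c a * euler_fun c b"
    unfolding prod.distrib
    by (subst (1 2) euler_fun_superset[where P = ?P]) (use assms in auto)
  finally show "euler_fun c (a * b) = euler_fun c a * euler_fun c b" .
qed

lemma bij_betw_divisors_mult:
  assumes "a > 0" "b > 0" "coprime a (b::nat)"
  shows "bij_betw (\<lambda>(d, e). d * e) ({d. d dvd a} \<times> {e. e dvd b}) {n. n dvd a * b}"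
  unfolding bij_betw_def
proof
  \<comment> \<open>The first factor is recovered as a gcd, because \<open>e\<close> divides
    \<open>b\<close> and so is coprime to \<open>a\<close>.\<close>
  have key: "gcd (d * e) a = d" if "d dvd a" "e dvd b" for d e
  proof -
    have "coprime a e" using that assms(3) by (metis coprime_divisors dvd_refl)
    then have "gcd (d * e) a = gcd d a"
      using gcd_mult_right_right_cancel[of a e d] by (simp add: gcd.commute)
    then show ?thesis using that by (simp add: gcd_nat.absorb1)
  qed
  show "inj_on (\<lambda>(d, e). d * e) ({d. d dvd a} \<times> {e. e dvd b})"
  proof (rule inj_onI, clarsimp)
    fix d e d' e' assume h: "d dvd a" "e dvd b" "d' dvd a" "e' dvd b" "d * e = d' * e'"
    have "d = d'" using key[OF h(1,2)] key[OF h(3,4)] h(5) by simp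
    moreover have "d > 0" using h(1) assms(1) dvd_pos_nat by blast
    ultimately show "d = d' \<and> e = e'" using h(5) by auto
  qed
  show "(\<lambda>(d, e). d * e) ` ({d. d dvd a} \<times> {e. e dvd b}) = {n. n dvd a * b}"
  proof safe
    fix n assume "n dvd a * b"
    then obtain d e where "n = d * e" "d dvd a" "e dvd b" using division_decomp by blast
    then show "n \<in> (\<lambda>(d, e). d * e) ` ({d. d dvd a} \<times> {e. e dvd b})" by force
  qed (auto intro: mult_dvd_mono)
qed

lemma multiplicative_dirichlet_conv:
  assumes "multiplicative f" "multiplicative g"
  shows "multiplicative (dirichlet_conv f g)"
  unfolding multiplicative_def
proof safe
  show "dirichlet_conv f g 1 = 1"
    using assms by (simp add: dirichlet_conv_def multiplicative_def)
next
  fix a b :: nat assume ab: "a > 0" "b > 0" "coprime a b"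
  have "dirichlet_conv f g (a * b) =
      (\<Sum>(d, e)\<in>{d. d dvd a} \<times> {e. e dvd b}. f (d * e) * g ((a * b) div (d * e)))"
    unfolding dirichlet_conv_def
    by (subst sum.reindex_bij_betw[OF bij_betw_divisors_mult[OF ab], symmetric]) (simp add: case_prod_unfold)
  also have "\<dots> = (\<Sum>(d, e)\<in>{d. d dvd a} \<times> {e. e dvd b}. (f d * g (a div d)) * (f e * g (b div e)))"
  proof (rule sum.cong, simp, clarsimp)
    fix d e assume h: "d dvd a" "e dvd b"
    have pos: "d > 0" "e > 0" "a div d > 0" "b div e > 0"
      using h ab by (auto simp: dvd_div_eq_0_iff intro!: Nat.gr0I)
    have "coprime d e" using h ab(3) coprime_divisors by blast
    moreover have "coprime (a div d) (b div e)"
      using h ab(3) by (metis coprime_divisors dvd_div_mult_self dvd_triv_left)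
    moreover have "(a * b) div (d * e) = (a div d) * (b div e)"
      using h by (simp add: div_mult_div_if_dvd)
    ultimately show "f (d * e) * g (a * b div (d * e)) = f d * g (a div d) * (f e * g (b div e))"
      using assms pos unfolding multiplicative_def by simp
  qed
  also have "\<dots> = dirichlet_conv f g a * dirichlet_conv f g b"
    unfolding dirichlet_conv_def by (simp add: sum_product sum.cartesian_product)
  finally show "dirichlet_conv f g (a * b) = dirichlet_conv f g a * dirichlet_conv f g b" .
qed

lemma dirichlet_conv_prime_power:
  assumes "prime p"
  shows "dirichlet_conv f g (p ^ k) = (\<Sum>j=0..k. f (p ^ j) * g (p ^ (k - j)))"
proof -
  have eq: "{d. d dvd p ^ k} = (\<lambda>j. p ^ j) ` {0..k}"
    using assms by (auto simp: divides_primepow_nat)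
  have inj: "inj_on (\<lambda>j. p ^ j) {0..k}"
    using assms prime_gt_1_nat by (intro inj_onI) (meson power_inject_exp)
  have "dirichlet_conv f g (p ^ k) = (\<Sum>j=0..k. f (p ^ j) * g (p ^ k div p ^ j))"
    unfolding dirichlet_conv_def eq by (subst sum.reindex[OF inj]) simp
  also have "\<dots> = (\<Sum>j=0..k. f (p ^ j) * g (p ^ (k - j)))"
    using assms prime_gt_0_nat[of p] by (intro sum.cong) (auto simp: power_diff)
  finally show ?thesis .
qed

text \<open>Both sides are multiplicative, and at \<open>p ^ k\<close> the convolution is the Cauchy
  product of the coefficients.\<close>

lemma dirichlet_conv_euler_fun:
  assumes "\<And>p. fps_nth (c p) 0 = 1" "\<And>p. fps_nth (d p) 0 = 1" "n > 0"
  shows "dirichlet_conv (euler_fun c) (euler_fun d) n = euler_fun (\<lambda>p. c p * d p) n"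
proof (rule multiplicative_eqI[OF _ _ _ \<open>n > 0\<close>])
  have cd: "fps_nth (c p * d p) 0 = 1" for p using assms by simp
  show "multiplicative (dirichlet_conv (euler_fun c) (euler_fun d))"
    by (intro multiplicative_dirichlet_conv multiplicative_euler_fun assms)
  show "multiplicative (euler_fun (\<lambda>p. c p * d p))"
    by (intro multiplicative_euler_fun cd)
  show "dirichlet_conv (euler_fun c) (euler_fun d) (p ^ k) = euler_fun (\<lambda>p. c p * d p) (p ^ k)"
    if p: "prime p" for p k
    using p assms cd by (simp add: dirichlet_conv_prime_power euler_fun_prime_power fps_mult_nth)
qed

text \<open>Values at prime powers are powers of \<open>\<psi> p\<close>, so the local series is
  geometric, that is, \<open>1 / (1 - \<psi> p X)\<close>.\<close>

lemma euler_fun_completely_multiplicative: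
  assumes "\<psi> 1 = 1" "\<And>a b. \<psi> (a * b) = \<psi> a * \<psi> b" "n > 0"
  shows "euler_fun (\<lambda>p. Abs_fps (\<lambda>k. \<psi> p ^ k)) n = \<psi> n"
proof (rule multiplicative_eqI[OF _ _ _ \<open>n > 0\<close>])
  show "multiplicative (euler_fun (\<lambda>p. Abs_fps (\<lambda>k. \<psi> p ^ k)))"
    by (intro multiplicative_euler_fun) simp
  show "multiplicative \<psi>" using assms by (simp add: multiplicative_def)
  have "\<psi> (p ^ k) = \<psi> p ^ k" for p k by (induction k) (use assms in auto)
  then show "euler_fun (\<lambda>p. Abs_fps (\<lambda>k. \<psi> p ^ k)) (p ^ k) = \<psi> (p ^ k)" if "prime p" for p k
    using that by (simp add: euler_fun_prime_power)
qed

text \<open>Local factors that force the value 0 off the odd squarefree integers: any positive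
  exponent of 2, and any exponent above 1 of an odd prime, meets a zero coefficient.\<close>

definition euler_trunc :: "(nat \<Rightarrow> real fps) \<Rightarrow> nat \<Rightarrow> real fps" where
  "euler_trunc c p = (if p = 2 then 1 else 1 + fps_const (fps_nth (c p) 1) * fps_X)"

lemma odd_squarefree_mult_euler_fun:
  assumes "n > 0" "\<And>p. fps_nth (c p) 0 = 1"
  shows "(if odd n \<and> squarefree n then euler_fun c n else 0) = euler_fun (euler_trunc c) n"
proof (cases "odd n \<and> squarefree n")
  case True
  have "fps_nth (c p) (multiplicity p n) = fps_nth (euler_trunc c p) (multiplicity p n)"
    if "p \<in> prime_factors n" for p
  proof -
    have "multiplicity p n = 1" using True that assms(1) by (simp add: squarefree_factorial_semiring')
    moreover have "p \<noteq> 2" using True that by auto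
    ultimately show ?thesis by (simp add: euler_trunc_def)
  qed
  then show ?thesis using True by (simp add: euler_fun_def)
next
  case False
  have "\<exists>p\<in>prime_factors n. fps_nth (euler_trunc c p) (multiplicity p n) = 0"
  proof (cases "odd n")
    case True
    then obtain p where p: "p \<in> prime_factors n" "multiplicity p n \<noteq> 1"
      using False assms(1) by (auto simp: squarefree_factorial_semiring')
    then have "multiplicity p n > 1"
      using assms(1) by (metis gr0I less_one nat_neq_iff prime_factors_multiplicity mem_Collect_eq)
    moreover have "p \<noteq> 2" using True p by auto
    ultimately have "fps_nth (euler_trunc c p) (multiplicity p n) = 0" by (simp add: euler_trunc_def)
    then show ?thesis using p by blast
  next
    case even: False
    then have "2 \<in> prime_factors n" using assms(1) by (simp add: prime_factors_dvd)
    moreover from this have "multiplicity 2 n > 0" by (simp add: prime_factors_multiplicity)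
    ultimately show ?thesis by (intro bexI[of _ 2]) (auto simp: euler_trunc_def)
  qed
  then have "euler_fun (euler_trunc c) n = 0" unfolding euler_fun_def by (intro prod_zero) auto
  then show ?thesis using False by auto
qed

section \<open>Elementary summatory functions\<close>

definition summatory :: "(nat \<Rightarrow> real) \<Rightarrow> real \<Rightarrow> real" where
  "summatory f x = (\<Sum>n | n > 0 \<and> real n \<le> x. f n)"

lemma finite_pos_le_real [simp, intro]: "finite {n. n > 0 \<and> real n \<le> x}"
  by (rule finite_subset[of _ "{..nat \<lceil>x\<rceil>}"]) (auto, linarith)

lemma summatory_altdef: "summatory f x = (\<Sum>n=1..nat \<lfloor>x\<rfloor>. f n)"
proof -
  have "{n. n > 0 \<and> real n \<le> x} = {1..nat \<lfloor>x\<rfloor>}"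
    by (auto simp: le_nat_iff le_floor_iff Suc_le_eq nat_le_iff) (linarith | simp add: le_floor_iff)+
  then show ?thesis by (simp add: summatory_def)
qed

text \<open>Both sides sum over the pairs \<open>(d, m)\<close> of positive integers with
  \<open>d * m <= x\<close>; the bound \<open>d <= x\<close> of the outer sum is implied by
  \<open>m >= 1\<close>.\<close>

lemma summatory_dirichlet_conv:
  "summatory (dirichlet_conv f g) x = summatory (\<lambda>d. f d * summatory g (x / real d)) x"
proof -
  let ?N = "\<lambda>x. {n. n > 0 \<and> real n \<le> x}"
  have fin: "finite {d. d dvd n}" if "n \<in> ?N x" for n using that by simp
  have "summatory (dirichlet_conv f g) x =
      (\<Sum>(n, d)\<in>Sigma (?N x) (\<lambda>n. {d. d dvd n}). f d * g (n div d))"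
    unfolding summatory_def dirichlet_conv_def by (rule sum.Sigma) (use fin in auto)
  also have "\<dots> = (\<Sum>(d, m)\<in>Sigma (?N x) (\<lambda>d. ?N (x / real d)). f d * g m)"
  proof (rule sum.reindex_bij_witness[of _ "\<lambda>(d, m). (d * m, d)" "\<lambda>(n, d). (d, n div d)"], goal_cases)
    case (2 a)
    then obtain n d where a: "a = (n, d)" "n > 0" "real n \<le> x" "d dvd n" by auto
    then obtain m where m: "n = d * m" by auto
    have "d > 0" "m > 0" using a m by (auto intro!: Nat.gr0I)
    then have "real d * 1 \<le> real d * real m" by (intro mult_left_mono) auto
    then have "real d \<le> x" using a(3) unfolding m by simp
    moreover have "real m \<le> x / real d" using a m \<open>d > 0\<close> by (simp add: field_simps)
    ultimately show ?case using a m \<open>d > 0\<close> \<open>m > 0\<close> by simp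
  next
    case (4 b)
    then show ?case by (auto simp: field_simps)
  qed (auto simp: field_simps)
  also have "\<dots> = summatory (\<lambda>d. f d * summatory g (x / real d)) x"
    unfolding summatory_def sum_distrib_left by (rule sum.Sigma[symmetric]) auto
  finally show ?thesis .
qed

lemma summatory_cong:
  "(\<And>n. n > 0 \<Longrightarrow> real n \<le> x \<Longrightarrow> f n = g n) \<Longrightarrow> summatory f x = summatory g x"
  unfolding summatory_def by (rule sum.cong) auto

lemma summatory_mono:
  "(\<And>n. n > 0 \<Longrightarrow> real n \<le> x \<Longrightarrow> f n \<le> g n) \<Longrightarrow> summatory f x \<le> summatory g x"
  unfolding summatory_def by (rule sum_mono) auto

lemma summatory_cmult: "summatory (\<lambda>n. c * f n) x = c * summatory f x"
  by (simp add: summatory_def sum_distrib_left)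

lemma summatory_diff: "summatory (\<lambda>n. f n - g n) x = summatory f x - summatory g x"
  by (simp add: summatory_def sum_subtractf)

lemma abs_summatory_le: "\<bar>summatory f x\<bar> \<le> summatory (\<lambda>n. \<bar>f n\<bar>) x"
  unfolding summatory_def by (rule sum_abs)

text \<open>The inequality \<open>ln t <= t - 1\<close> at \<open>t = (n + 1) / n\<close> and at its
  reciprocal.\<close>

lemma ln_Suc_bounds:
  assumes "n > 0"
  shows "ln (real (Suc n)) - ln (real n) \<le> 1 / real n"
    and "1 / real (Suc n) \<le> ln (real (Suc n)) - ln (real n)"
proof -
  have "ln (real (Suc n) / real n) \<le> real (Suc n) / real n - 1"
    by (rule ln_le_minus_one) (use assms in simp)
  then show "ln (real (Suc n)) - ln (real n) \<le> 1 / real n"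
    using assms by (simp add: ln_div field_simps)
  have "ln (real n / real (Suc n)) \<le> real n / real (Suc n) - 1"
    by (rule ln_le_minus_one) (use assms in simp)
  then show "1 / real (Suc n) \<le> ln (real (Suc n)) - ln (real n)"
    using assms by (simp add: ln_div field_simps)
qed


lemma ln_floor_bounds:
  assumes "x \<ge> 1"
  shows "ln (real (nat \<lfloor>x\<rfloor>)) \<le> ln x" "ln x \<le> ln (real (Suc (nat \<lfloor>x\<rfloor>)))"
    "ln x \<le> ln (real (nat \<lfloor>x\<rfloor>)) + 1" "nat \<lfloor>x\<rfloor> \<ge> 1"
proof -
  define N where "N = nat \<lfloor>x\<rfloor>"
  have N: "N \<ge> 1" using assms unfolding N_def by (simp add: le_nat_iff)
  have le: "real N \<le> x" "x \<le> real (Suc N)" using assms unfolding N_def by (simp, linarith)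
  have "ln (real N) \<le> ln x" using le N by (subst ln_le_cancel_iff) auto
  moreover have le': "ln x \<le> ln (real (Suc N))" using le assms by (subst ln_le_cancel_iff) auto
  moreover have "1 / real N \<le> 1" using N by (simp add: field_simps)
  moreover have "ln (real (Suc N)) \<le> ln (real N) + 1 / real N" using ln_Suc_bounds(1)[of N] N by simp
  ultimately show "ln (real (nat \<lfloor>x\<rfloor>)) \<le> ln x" "ln x \<le> ln (real (Suc (nat \<lfloor>x\<rfloor>)))"
    "ln x \<le> ln (real (nat \<lfloor>x\<rfloor>)) + 1" "nat \<lfloor>x\<rfloor> \<ge> 1"
    using N unfolding N_def by linarith+
qed

lemma harmonic_bounds:
  assumes "x \<ge> 1"
  shows "ln x \<le> summatory (\<lambda>n. 1 / real n) x" "summatory (\<lambda>n. 1 / real n) x \<le> 1 + ln x"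
proof -
  \<comment> \<open>The lower bound uses \<open>ln (N + 1)\<close> with \<open>N = Suc n\<close>, so
    that it still dominates \<open>ln x\<close> for every real \<open>x\<close> with floor
    \<open>N\<close>.\<close>
  have *: "ln (real (Suc (Suc n))) \<le> (\<Sum>k=1..Suc n. 1 / real k) \<and> (\<Sum>k=1..Suc n. 1 / real k) \<le> 1 + ln (real (Suc n))" for n
  proof (induction n)
    case (Suc n)
    have "ln (real (Suc (Suc (Suc n)))) - ln (real (Suc (Suc n))) \<le> 1 / real (Suc (Suc n))"
         "1 / real (Suc (Suc n)) \<le> ln (real (Suc (Suc n))) - ln (real (Suc n))"
      using ln_Suc_bounds(1)[of "Suc (Suc n)"] ln_Suc_bounds(2)[of "Suc n"] by blast+
    moreover have "(\<Sum>k=1..Suc (Suc n). 1 / real k) = (\<Sum>k=1..Suc n. 1 / real k) + 1 / real (Suc (Suc n))" by simp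
    ultimately show ?case using Suc by linarith
  qed (use ln_2_less_1 in simp)
  obtain n where n: "nat \<lfloor>x\<rfloor> = Suc n" using ln_floor_bounds(4)[OF assms] by (cases "nat \<lfloor>x\<rfloor>") auto
  show "ln x \<le> summatory (\<lambda>n. 1 / real n) x" "summatory (\<lambda>n. 1 / real n) x \<le> 1 + ln x"
    using *[of n] ln_floor_bounds[OF assms] unfolding summatory_altdef n by linarith+
qed

text \<open>Discrete comparison with the integral of \<open>ln t / t\<close>: the increments of
  \<open>(ln N)^2 / 2\<close> differ from \<open>ln (N + 1) / (N + 1)\<close> by at most
  \<open>1 / (N + 1)\<close>, so the total error is a harmonic sum. Passing from the floor to
  \<open>x\<close> costs one more \<open>ln x\<close>.\<close>

lemma sum_ln_over_bound:
  assumes "x \<ge> 1"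
  shows "\<bar>summatory (\<lambda>n. ln (real n) / real n) x - (ln x)\<^sup>2 / 2\<bar> \<le> 1 + 2 * ln x"
proof -
  have *: "\<bar>(\<Sum>k=1..Suc n. ln (real k) / real k) - (ln (real (Suc n)))\<^sup>2 / 2\<bar> \<le> (\<Sum>k=1..Suc n. 1 / real k)" for n
  proof (induction n)
    case (Suc n)
    define N where "N = real (Suc n)"
    define A where "A = ln (N + 1)"
    define \<delta> where "\<delta> = A - ln N"
    have N1: "N \<ge> 1" by (simp add: N_def)
    have d: "\<delta> \<le> 1 / N" "1 / (N + 1) \<le> \<delta>"
      using ln_Suc_bounds[of "Suc n"] by (simp_all add: N_def A_def \<delta>_def add_ac)
    have A: "0 \<le> A" "A \<le> N" using N1 ln_add_one_self_le_self[of N] by (simp_all add: A_def add_ac)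
    have d0: "0 \<le> \<delta>" using d N1 by (smt (verit) divide_nonneg_nonneg)
    \<comment> \<open>The gap between \<open>\<delta>\<close> and \<open>1 / (N + 1)\<close> is of
      order \<open>1 / N^2\<close>, so even the crude bound \<open>A <= N\<close> leaves only order
      \<open>1 / N\<close>.\<close>
    have "A * (\<delta> - 1 / (N + 1)) \<le> N * (1 / N - 1 / (N + 1))"
      using A d N1 by (intro mult_mono) auto
    also have "\<dots> = 1 / (N + 1)" using N1 by (simp add: right_diff_distrib) (simp add: field_simps)
    finally have u: "A * (\<delta> - 1 / (N + 1)) \<le> 1 / (N + 1)" .
    have l: "A * (\<delta> - 1 / (N + 1)) \<ge> 0" using A d by simp
    have "\<delta>\<^sup>2 \<le> (1 / N)\<^sup>2" using d d0 by (intro power_mono) auto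
    also have "\<dots> \<le> 2 / (N + 1)"
    proof -
      have "N + 1 \<le> 2 * N" using N1 by simp
      also have "\<dots> \<le> 2 * N\<^sup>2" using N1 by (simp add: power2_eq_square)
      finally show ?thesis using N1 by (simp add: field_simps power2_eq_square)
    qed
    finally have d2: "\<delta>\<^sup>2 / 2 \<le> 1 / (N + 1)" by simp
    have eq: "A\<^sup>2 / 2 - (ln N)\<^sup>2 / 2 - A / (N + 1) = A * (\<delta> - 1 / (N + 1)) - \<delta>\<^sup>2 / 2"
      using N1 by (simp add: \<delta>_def power2_eq_square algebra_simps) (simp add: field_simps)
    have step: "\<bar>A\<^sup>2 / 2 - (ln N)\<^sup>2 / 2 - A / (N + 1)\<bar> \<le> 1 / (N + 1)"
      using u l d2 zero_le_power2[of \<delta>] unfolding eq by linarith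
    have s: "(\<Sum>k=1..Suc (Suc n). ln (real k) / real k) = (\<Sum>k=1..Suc n. ln (real k) / real k) + A / (N + 1)"
      "(\<Sum>k=1..Suc (Suc n). 1 / real k) = (\<Sum>k=1..Suc n. 1 / real k) + 1 / (N + 1)"
      by (simp_all add: A_def N_def add_ac)
    have l: "ln (real (Suc (Suc n))) = A" "ln (real (Suc n)) = ln N" by (simp_all add: A_def N_def add_ac)
    show ?case using Suc step unfolding s l by linarith
  qed simp
  obtain n where n: "nat \<lfloor>x\<rfloor> = Suc n" using ln_floor_bounds(4)[OF assms] by (cases "nat \<lfloor>x\<rfloor>") auto
  define l where "l = ln (real (Suc n))"
  have l: "l \<le> ln x" "ln x \<le> l + 1" using ln_floor_bounds[OF assms] unfolding n l_def by auto
  have l0: "0 \<le> l" "0 \<le> ln x" using assms by (auto simp: l_def)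
  have "(ln x)\<^sup>2 - l\<^sup>2 = (ln x - l) * (ln x + l)" by (simp add: power2_eq_square algebra_simps)
  also have "\<dots> \<le> 1 * (2 * ln x)" using l l0 by (intro mult_mono) auto
  finally have "(ln x)\<^sup>2 / 2 - l\<^sup>2 / 2 \<le> ln x" by simp
  moreover have "l\<^sup>2 \<le> (ln x)\<^sup>2" using l l0 by (intro power_mono) auto
  moreover have "\<bar>summatory (\<lambda>n. ln (real n) / real n) x - l\<^sup>2 / 2\<bar> \<le> 1 + ln x"
    using *[of n] harmonic_bounds(2)[OF assms] unfolding summatory_altdef n l_def by linarith
  ultimately show ?thesis by linarith
qed

lemma summatory_one_bounds:
  assumes "x \<ge> 0"
  shows "summatory (\<lambda>_. 1) x \<le> x" "x - 1 \<le> summatory (\<lambda>_. 1) x"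
  using assms by (simp_all add: summatory_altdef)

text \<open>The left side is the number of pairs with product at most \<open>x\<close>; it serves as
  the error term of both threefold sums below.\<close>

lemma summatory_one_one_le:
  assumes "x \<ge> 1"
  shows "summatory (\<lambda>a. summatory (\<lambda>_. 1) (x / real a)) x \<le> x * (1 + ln x)"
proof -
  have "summatory (\<lambda>a. summatory (\<lambda>_. 1) (x / real a)) x \<le> summatory (\<lambda>a. x * (1 / real a)) x"
    using assms summatory_one_bounds(1) by (intro summatory_mono) simp
  also have "\<dots> = x * summatory (\<lambda>a. 1 / real a) x" by (rule summatory_cmult)
  also have "\<dots> \<le> x * (1 + ln x)" using harmonic_bounds[OF assms] assms by (intro mult_left_mono) auto
  finally show ?thesis .
qed

text \<open>Replacing the inner harmonic sum by \<open>ln (x / a)\<close> costs at most 1 per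
  \<open>a\<close>, weighted by \<open>1 / a\<close>. What remains is \<open>ln x\<close> times a
  harmonic sum minus the sum of \<open>ln a / a\<close>, with main terms \<open>(ln x)^2\<close> and
  \<open>(ln x)^2 / 2\<close>.\<close>

lemma sum_harmonic_over_bound:
  assumes "x \<ge> 1"
  shows "\<bar>summatory (\<lambda>a. 1 / real a * summatory (\<lambda>b. 1 / real b) (x / real a)) x - (ln x)\<^sup>2 / 2\<bar> \<le> 4 * (1 + ln x)"
proof -
  let ?H = "summatory (\<lambda>b. 1 / real b)"
  let ?G = "summatory (\<lambda>a. 1 / real a * ?H (x / real a)) x"
  let ?L = "summatory (\<lambda>a. 1 / real a * ln (x / real a)) x"
  have "?L = summatory (\<lambda>a. ln x * (1 / real a) - ln (real a) / real a) x"
    using assms by (intro summatory_cong) (simp add: ln_div field_simps)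
  also have "\<dots> = ln x * ?H x - summatory (\<lambda>a. ln (real a) / real a) x"
    by (simp only: summatory_diff summatory_cmult)
  finally have L: "?L = ln x * ?H x - summatory (\<lambda>a. ln (real a) / real a) x" .
  have lnx: "ln x \<ge> 0" using assms by simp
  have "ln x * ln x \<le> ln x * ?H x" "ln x * ?H x \<le> ln x * (1 + ln x)"
    using harmonic_bounds[OF assms] lnx by (auto intro!: mult_left_mono)
  then have 1: "\<bar>?L - (ln x)\<^sup>2 / 2\<bar> \<le> 1 + 3 * ln x"
    using sum_ln_over_bound[OF assms] unfolding L power2_eq_square distrib_left by simp
  have b: "?H (x / real a) \<le> 1 + ln (x / real a) \<and> ln (x / real a) \<le> ?H (x / real a)"
    if "a > 0" "real a \<le> x" for a using harmonic_bounds[of "x / real a"] that by simp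
  have "?L \<le> ?G" using b by (intro summatory_mono mult_left_mono) auto
  moreover have "?G - ?L \<le> ?H x"
    unfolding summatory_diff[symmetric]
  proof (intro summatory_mono)
    fix a assume a: "a > 0" "real a \<le> x"
    have "1 / real a * (?H (x / real a) - ln (x / real a)) \<le> 1 / real a * 1"
      using b[OF a] by (intro mult_left_mono) auto
    then show "1 / real a * ?H (x / real a) - 1 / real a * ln (x / real a) \<le> 1 / real a"
      by (simp only: right_diff_distrib mult_1_right)
  qed
  ultimately show ?thesis using 1 harmonic_bounds[OF assms] lnx by argo
qed

text \<open>Removing the floor in the innermost count costs at most 1 for each pair
  \<open>(a, b)\<close> with \<open>a * b <= x\<close>, hence \<open>x (1 + ln x)\<close>; together
  with the 4 of the double harmonic sum this gives the constant 5.\<close>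

lemma summatory_triple_bound:
  assumes "x \<ge> 1"
  shows "\<bar>summatory (dirichlet_conv (\<lambda>_. 1) (dirichlet_conv (\<lambda>_. 1) (\<lambda>_. 1))) x - x * (ln x)\<^sup>2 / 2\<bar>
     \<le> 5 * (x * (1 + ln x))"
proof -
  let ?D = "summatory (\<lambda>a. summatory (\<lambda>b. summatory (\<lambda>_. 1) (x / real a / real b)) (x / real a)) x"
  let ?M = "summatory (\<lambda>a. summatory (\<lambda>b. x / real a / real b) (x / real a)) x"
  have "summatory (dirichlet_conv (\<lambda>_. 1) (dirichlet_conv (\<lambda>_. 1) (\<lambda>_. 1))) x = ?D"
    by (simp add: summatory_dirichlet_conv)
  moreover have "?D \<le> ?M" using assms by (intro summatory_mono summatory_one_bounds) simp
  moreover have "?M - ?D \<le> summatory (\<lambda>a. summatory (\<lambda>_. 1) (x / real a)) x"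
    unfolding summatory_diff[symmetric]
  proof (intro summatory_mono)
    fix a b :: nat
    show "x / real a / real b - summatory (\<lambda>_. 1) (x / real a / real b) \<le> 1"
      using assms summatory_one_bounds(2)[of "x / real a / real b"] by simp
  qed
  moreover have "?M = x * summatory (\<lambda>a. 1 / real a * summatory (\<lambda>b. 1 / real b) (x / real a)) x"
    unfolding summatory_cmult[symmetric] by (intro summatory_cong) simp
  moreover have "\<bar>x * summatory (\<lambda>a. 1 / real a * summatory (\<lambda>b. 1 / real b) (x / real a)) x - x * (ln x)\<^sup>2 / 2\<bar>
      \<le> x * (4 * (1 + ln x))"
  proof -
    have "x * summatory (\<lambda>a. 1 / real a * summatory (\<lambda>b. 1 / real b) (x / real a)) x - x * (ln x)\<^sup>2 / 2 =
      x * (summatory (\<lambda>a. 1 / real a * summatory (\<lambda>b. 1 / real b) (x / real a)) x - (ln x)\<^sup>2 / 2)"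
      by (simp add: algebra_simps)
    then show ?thesis using sum_harmonic_over_bound[OF assms] assms by (simp add: abs_mult)
  qed
  ultimately show ?thesis using summatory_one_one_le[OF assms] by argo
qed

section \<open>The nontrivial character modulo 4\<close>

definition chi4 :: "nat \<Rightarrow> real" where
  "chi4 n = (if even n then 0 else if n mod 4 = 1 then 1 else -1)"

lemma chi4_one [simp]: "chi4 1 = 1" "chi4 (Suc 0) = 1" by (simp_all add: chi4_def)

lemma chi4_mult: "chi4 (a * b) = chi4 a * chi4 b"
proof -
  have "a mod 4 \<in> {0,1,2,3}" "b mod 4 \<in> {0,1,2,3}" by auto
  moreover have "even n \<longleftrightarrow> n mod 4 \<in> {0,2}" for n :: nat by (simp, presburger)
  moreover have "(a * b) mod 4 = ((a mod 4) * (b mod 4)) mod 4" by (simp add: mod_mult_eq)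
  ultimately show ?thesis unfolding chi4_def by (elim insertE) auto
qed

lemma abs_chi4_le: "\<bar>chi4 n\<bar> \<le> 1" by (simp add: chi4_def)

text \<open>The values 1, 0, -1, 0 cancel over a period, so all partial sums are 0 or 1.\<close>

lemma abs_summatory_chi4_le: "\<bar>summatory chi4 x\<bar> \<le> 1"
proof -
  have "(\<Sum>n=1..N. chi4 n) = (if N mod 4 \<in> {1, 2} then 1 else 0)" for N
  proof (induction N)
    case (Suc N)
    have "N mod 4 \<in> {0,1,2,3}" by auto
    moreover have "even (Suc N) \<longleftrightarrow> N mod 4 \<in> {1,3}" by (simp, presburger)
    moreover have "Suc N mod 4 = (if N mod 4 = 3 then 0 else Suc (N mod 4))" by (simp add: mod_Suc)
    ultimately show ?case using Suc unfolding chi4_def by (elim insertE) auto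
  qed simp
  then show ?thesis by (simp add: summatory_altdef)
qed

text \<open>Cancellation in the innermost variable alone suffices: its sum is at most 1 in absolute
  value, and the other two variables are bounded trivially by the number of pairs with product at
  most \<open>x\<close>. This is already the order of the permitted error.\<close>

lemma abs_summatory_triple_chi4_le:
  assumes "x \<ge> 1"
  shows "\<bar>summatory (dirichlet_conv (\<lambda>_. 1) (dirichlet_conv chi4 chi4)) x\<bar> \<le> x * (1 + ln x)"
proof -
  have "\<bar>summatory (dirichlet_conv (\<lambda>_. 1) (dirichlet_conv chi4 chi4)) x\<bar> \<le>
     summatory (\<lambda>a. \<bar>summatory (\<lambda>b. chi4 b * summatory chi4 (x / real a / real b)) (x / real a)\<bar>) x"
    by (simp add: summatory_dirichlet_conv abs_summatory_le)
  also have "\<dots> \<le> summatory (\<lambda>a. summatory (\<lambda>b. \<bar>chi4 b * summatory chi4 (x / real a / real b)\<bar>) (x / real a)) x"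
    by (intro summatory_mono abs_summatory_le)
  also have "\<dots> \<le> summatory (\<lambda>a. summatory (\<lambda>_. 1) (x / real a)) x"
  proof (intro summatory_mono)
    fix a b
    show "\<bar>chi4 b * summatory chi4 (x / real a / real b)\<bar> \<le> 1"
      unfolding abs_mult using abs_chi4_le abs_summatory_chi4_le by (intro mult_le_one) auto
  qed
  finally show ?thesis using summatory_one_one_le[OF assms] by simp
qed

section \<open>Sieving out the odd squarefree integers\<close>

text \<open>The integers produced by a finite Euler product over \<open>P\<close> when every local
  factor stops at exponent 4, the degree bound of \<open>sieve_poly\<close>.\<close>

definition powerfree_smooth :: "nat set \<Rightarrow> nat set" where
  "powerfree_smooth P = {n. n > 0 \<and> prime_factors n \<subseteq> P \<and> (\<forall>p. prime p \<longrightarrow> multiplicity p n \<le> 4)}"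

text \<open>The exponent \<open>k\<close> is recovered as the multiplicity of \<open>p\<close>,
  which does not divide \<open>m\<close> because \<open>p\<close> lies outside
  \<open>P\<close>.\<close>

lemma powerfree_smooth_insert:
  assumes "prime p" "p \<notin> P" "\<And>q. q \<in> P \<Longrightarrow> prime q"
  shows "bij_betw (\<lambda>(m, k). m * p ^ k) (powerfree_smooth P \<times> {..4}) (powerfree_smooth (insert p P))"
  unfolding bij_betw_def
proof
  have p0: "p > 0" using assms prime_gt_0_nat by blast
  have mult: "multiplicity p (m * p ^ k) = k" if "m \<in> powerfree_smooth P" for m k
  proof -
    have "p \<notin> prime_factors m" "m > 0" using that assms by (auto simp: powerfree_smooth_def)
    then have "\<not> p dvd m" using assms by (auto simp: prime_factors_dvd)
    then show ?thesis using \<open>m > 0\<close> assms p0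
      by (simp add: multiplicity_prime_elem_times_other mult.commute prime_imp_prime_elem not_prime_unit)
  qed
  show "inj_on (\<lambda>(m, k). m * p ^ k) (powerfree_smooth P \<times> {..4})"
  proof (rule inj_onI, clarsimp)
    fix m k m' k' assume h: "m \<in> powerfree_smooth P" "m' \<in> powerfree_smooth P" "m * p ^ k = m' * p ^ k'"
    have "k = k'" using mult[OF h(1), of k] mult[OF h(2), of k'] h(3) by simp
    then show "m = m' \<and> k = k'" using h(3) p0 by simp
  qed
  show "(\<lambda>(m, k). m * p ^ k) ` (powerfree_smooth P \<times> {..4}) = powerfree_smooth (insert p P)"
  proof (intro equalityI subsetI)
    fix n assume "n \<in> (\<lambda>(m, k). m * p ^ k) ` (powerfree_smooth P \<times> {..4})"
    then obtain m k where n: "n = m * p ^ k" "m \<in> powerfree_smooth P" "k \<le> 4" by auto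
    have m: "m > 0" "prime_factors m \<subseteq> P" using n by (auto simp: powerfree_smooth_def)
    have "prime_factors n = prime_factors m \<union> prime_factors (p ^ k)"
      using m n p0 by (simp add: prime_factors_product)
    also have "\<dots> \<subseteq> insert p P" using m assms by (auto simp: prime_factorization_prime_power)
    finally have "prime_factors n \<subseteq> insert p P" .
    moreover have "multiplicity q n \<le> 4" if "prime q" for q
    proof (cases "q = p")
      case True then show ?thesis using mult[OF n(2)] n by simp
    next
      case False
      then have "\<not> q dvd p ^ k" using assms that prime_dvd_power[of q p k] primes_dvd_imp_eq[of q p] by blast
      then have "multiplicity q n = multiplicity q m"
        using multiplicity_prime_elem_times_other[of q "p ^ k" m] n(1) that by (simp add: mult.commute)
      then show ?thesis using n that by (simp add: powerfree_smooth_def)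
    qed
    ultimately show "n \<in> powerfree_smooth (insert p P)" using m n p0 by (simp add: powerfree_smooth_def)
  next
    fix n assume n: "n \<in> powerfree_smooth (insert p P)"
    then have n0: "n \<noteq> 0" by (simp add: powerfree_smooth_def)
    have "\<not> is_unit p" using assms(1) by auto
    define k where "k = multiplicity p n"
    obtain m where m: "n = p ^ k * m" "\<not> p dvd m"
      using multiplicity_decompose'[of n p] n0 \<open>\<not> is_unit p\<close> unfolding k_def by blast
    have m0: "m > 0" using m(1) n0 by (intro Nat.gr0I) auto
    have mn: "m dvd n" using m(1) by simp
    have "prime_factors m \<subseteq> prime_factors n" using mn n0 by (intro dvd_prime_factors) auto
    moreover have "p \<notin> prime_factors m" using m(2) by auto
    ultimately have "prime_factors m \<subseteq> P" using n by (auto simp: powerfree_smooth_def)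
    moreover have "multiplicity q m \<le> 4" if "prime q" for q
    proof -
      have "multiplicity q m \<le> multiplicity q n"
        using mn n0 by (intro dvd_imp_multiplicity_le) auto
      also have "\<dots> \<le> 4" using n that by (simp add: powerfree_smooth_def)
      finally show ?thesis .
    qed
    ultimately have "m \<in> powerfree_smooth P" using m0 by (simp add: powerfree_smooth_def)
    moreover have "k \<le> 4" using n assms(1) by (simp add: powerfree_smooth_def k_def)
    ultimately show "n \<in> (\<lambda>(m, k). m * p ^ k) ` (powerfree_smooth P \<times> {..4})"
      by (intro image_eqI[of _ _ "(m, k)"]) (simp_all add: m(1) mult.commute)
  qed
qed

text \<open>An exact finite Euler product: with exponents capped at 4 the expansion, prime by prime,
  involves no convergence.\<close>

lemma sum_powerfree_smooth:
  assumes "multiplicative G" "finite P" "\<And>q. q \<in> P \<Longrightarrow> prime q"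
  shows "finite (powerfree_smooth P) \<and> sum G (powerfree_smooth P) = (\<Prod>p\<in>P. \<Sum>k\<le>4. G (p ^ k))"
  using assms(2,3)
proof (induction P rule: finite_induct)
  case empty
  have "n \<in> powerfree_smooth {} \<longleftrightarrow> n = 1" for n
  proof
    assume "n \<in> powerfree_smooth {}"
    then have "n > 0" "prime_factors n = {}" by (simp_all add: powerfree_smooth_def)
    then show "n = 1" by (simp add: prime_factorization_empty_iff)
  next
    assume "n = 1"
    then show "n \<in> powerfree_smooth {}" by (simp add: powerfree_smooth_def)
  qed
  then have "powerfree_smooth {} = {1}" by blast
  then show ?case using assms(1) by (simp add: multiplicative_def)
next
  case (insert p P)
  have IH: "finite (powerfree_smooth P)" "sum G (powerfree_smooth P) = (\<Prod>p\<in>P. \<Sum>k\<le>4. G (p ^ k))"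
    using insert.IH insert.prems by blast+
  have bij: "bij_betw (\<lambda>(m, k). m * p ^ k) (powerfree_smooth P \<times> {..4}) (powerfree_smooth (insert p P))"
    using insert.hyps insert.prems by (intro powerfree_smooth_insert) auto
  have p: "prime p" "p > 0" using insert.prems prime_gt_0_nat by auto
  have "sum G (powerfree_smooth (insert p P)) = (\<Sum>(m, k)\<in>powerfree_smooth P \<times> {..4}. G (m * p ^ k))"
    by (subst sum.reindex_bij_betw[OF bij, symmetric]) (simp add: case_prod_unfold)
  also have "\<dots> = (\<Sum>(m, k)\<in>powerfree_smooth P \<times> {..4}. G m * G (p ^ k))"
  proof (rule sum.cong[OF refl])
    fix x assume x: "x \<in> powerfree_smooth P \<times> {..4::nat}"
    obtain m k where mk: "x = (m, k)" "m \<in> powerfree_smooth P" using x by blast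
    then have m: "\<not> p dvd m" "m > 0" using insert.hyps p by (auto simp: powerfree_smooth_def prime_factors_dvd)
    then have "coprime m (p ^ k)" using prime_imp_coprime[OF p(1), of m] by (simp add: coprime_commute)
    moreover have "p ^ k > 0" using p by simp
    ultimately have "G (m * p ^ k) = G m * G (p ^ k)"
      using assms(1) m(2) unfolding multiplicative_def by blast
    then show "(case x of (m, k) \<Rightarrow> G (m * p ^ k)) = (case x of (m, k) \<Rightarrow> G m * G (p ^ k))"
      using mk by simp
  qed
  also have "\<dots> = sum G (powerfree_smooth P) * (\<Sum>k\<le>4. G (p ^ k))"
    unfolding sum_product sum.cartesian_product ..
  also have "\<dots> = (\<Prod>q\<in>insert p P. \<Sum>k\<le>4. G (q ^ k))"
    unfolding IH(2) prod.insert[OF insert.hyps] by (rule mult.commute)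
  finally have "sum G (powerfree_smooth (insert p P)) = (\<Prod>q\<in>insert p P. \<Sum>k\<le>4. G (q ^ k))" .
  moreover have "finite (powerfree_smooth (insert p P))"
    by (rule iffD1[OF bij_betw_finite[OF bij]]) (simp add: IH(1))
  ultimately show ?case by blast
qed

section \<open>Local factors of the sieve\<close>

text \<open>The quotient of the truncated local factor, \<open>1 + (a p + b p + c p) X\<close> or 1
  at \<open>p = 2\<close>, by the product of the geometric series of \<open>a p\<close>,
  \<open>b p\<close>, \<open>c p\<close>. It is a polynomial because those series have linear
  inverses.\<close>

definition sieve_poly :: "(nat \<Rightarrow> real) \<Rightarrow> (nat \<Rightarrow> real) \<Rightarrow> (nat \<Rightarrow> real) \<Rightarrow> nat \<Rightarrow> real poly" where
  "sieve_poly a b c p = (if p = 2 then 1 else [:1, a p + b p + c p:]) * ([:1, - a p:] * ([:1, - b p:] * [:1, - c p:]))"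

definition sieve_fun :: "(nat \<Rightarrow> real) \<Rightarrow> (nat \<Rightarrow> real) \<Rightarrow> (nat \<Rightarrow> real) \<Rightarrow> nat \<Rightarrow> real" where
  "sieve_fun a b c = euler_fun (\<lambda>p. fps_of_poly (sieve_poly a b c p))"

lemma coeff_sieve_poly:
  assumes "\<bar>a p\<bar> \<le> 1" "\<bar>b p\<bar> \<le> 1" "\<bar>c p\<bar> \<le> 1"
  shows "coeff (sieve_poly a b c p) 0 = 1"
    and "p \<noteq> 2 \<Longrightarrow> coeff (sieve_poly a b c p) 1 = 0"
    and "k > 4 \<Longrightarrow> coeff (sieve_poly a b c p) k = 0"
    and "\<bar>coeff (sieve_poly a b c p) k\<bar> \<le> 12"
    and "degree (sieve_poly a b c p) \<le> 4"
proof -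
  define e1 e2 e3 where "e1 = a p + b p + c p" and "e2 = a p * b p + a p * c p + b p * c p"
    and "e3 = a p * b p * c p"
  have ab: "\<bar>a p * b p\<bar> \<le> 1" "\<bar>a p * c p\<bar> \<le> 1" "\<bar>b p * c p\<bar> \<le> 1"
    unfolding abs_mult by (rule mult_le_one; simp add: assms)+
  have b1: "\<bar>e1\<bar> \<le> 3" "\<bar>e2\<bar> \<le> 3"
    using assms ab unfolding e1_def e2_def abs_le_iff by linarith+
  have b3: "\<bar>e3\<bar> \<le> 1" using ab(1) assms(3) unfolding e3_def abs_mult[of "a p * b p"] by (rule mult_le_one[OF _ abs_ge_zero])
  \<comment> \<open>For \<open>p\<close> other than 2 the product is
    \<open>(1 + e1 X) (1 - e1 X + e2 X^2 - e3 X^3)\<close> in the elementary symmetric functions.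
    The linear terms cancel, which is the source of all later convergence. The bound 12 arises from
    \<open>|e2| + e1^2 <= 3 + 9\<close>.\<close>
  have eq: "sieve_poly a b c p = (if p = 2 then [:1, - e1, e2, - e3:]
      else [:1, 0, e2 - e1\<^sup>2, e1 * e2 - e3, - (e1 * e3):])"
    by (rule poly_eq_poly_eq_iff[THEN iffD1], rule ext)
       (simp add: sieve_poly_def e1_def e2_def e3_def power2_eq_square algebra_simps)
  have "\<bar>e1\<bar>\<^sup>2 \<le> 3\<^sup>2" by (rule power_mono[OF b1(1)]) simp
  then have "e1\<^sup>2 \<le> 9" by (simp only: power2_abs) simp
  then have b2: "\<bar>e2 - e1\<^sup>2\<bar> \<le> 12" using b1(2) zero_le_power2[of e1] by linarith
  have b4: "\<bar>e1 * e2\<bar> \<le> 3 * 3" "\<bar>e1 * e3\<bar> \<le> 3 * 1"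
    unfolding abs_mult by (rule mult_mono[OF b1(1) b1(2)], simp, simp) (rule mult_mono[OF b1(1) b3], simp, simp)
  show deg: "degree (sieve_poly a b c p) \<le> 4"
  proof (rule degree_le, intro allI impI)
    fix i :: nat assume "i > 4"
    then obtain j where j: "i = Suc (Suc (Suc (Suc (Suc j))))" by (intro that[of "i - 5"]) simp
    show "coeff (sieve_poly a b c p) i = 0" unfolding eq j by (cases "p = 2") simp_all
  qed
  show zero: "coeff (sieve_poly a b c p) k = 0" if "k > 4" using that deg by (intro coeff_eq_0) simp
  show "coeff (sieve_poly a b c p) 0 = 1" unfolding eq by simp
  show "coeff (sieve_poly a b c p) 1 = 0" if "p \<noteq> 2" unfolding eq using that by simp
  show "\<bar>coeff (sieve_poly a b c p) k\<bar> \<le> 12"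
  proof (cases "k > 4")
    case True then show ?thesis using zero by simp
  next
    case False
    then have k: "k = 0 \<or> k = Suc 0 \<or> k = Suc (Suc 0) \<or> k = Suc (Suc (Suc 0)) \<or> k = Suc (Suc (Suc (Suc 0)))"
      by linarith
    define small where "small = (\<lambda>y :: real. \<bar>y\<bar> \<le> 12)"
    have small01: "small 0" "small 1" by (simp_all add: small_def)
    have small1: "small (- e1)" unfolding small_def using b1(1) by linarith
    have small2: "small e2" unfolding small_def using b1(2) by linarith
    have small3: "small (- e3)" unfolding small_def using b3 by linarith
    have small4: "small (e2 - e1\<^sup>2)" unfolding small_def by (rule b2)
    have small5: "small (e1 * e2 - e3)" unfolding small_def using b4(1) b3 by linarith
    have small6: "small (- (e1 * e3))" unfolding small_def using b4(2) by linarith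
    note small = small01 small1 small2 small3 small4 small5 small6
    have "small (coeff (sieve_poly a b c p) k)"
      unfolding eq using k by (elim disjE) (simp_all add: small)
    then show ?thesis by (simp add: small_def)
  qed
qed

text \<open>Only the constant function 1 and \<open>chi4\<close> will be inserted; the bound by 1
  controls the coefficients of \<open>sieve_poly\<close> uniformly in \<open>p\<close>.\<close>

locale character_triple =
  fixes a b c :: "nat \<Rightarrow> real"
  assumes one: "a 1 = 1" "b 1 = 1" "c 1 = 1"
    and mult: "\<And>m n. a (m * n) = a m * a n" "\<And>m n. b (m * n) = b m * b n" "\<And>m n. c (m * n) = c m * c n"
    and bd: "\<And>n. \<bar>a n\<bar> \<le> 1" "\<And>n. \<bar>b n\<bar> \<le> 1" "\<And>n. \<bar>c n\<bar> \<le> 1"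
begin

lemma sieve_coeffs:
  "fps_nth (fps_of_poly (sieve_poly a b c p)) 0 = 1"
  using coeff_sieve_poly(1)[of a p b c] bd by simp

text \<open>At each prime the truncated factor is \<open>sieve_poly\<close> times three geometric
  series, and products of local factors correspond to Dirichlet convolutions.\<close>

lemma sieve_convolution:
  assumes "n > 0"
  shows "(if odd n \<and> squarefree n then dirichlet_conv a (dirichlet_conv b c) n else 0) =
     dirichlet_conv (sieve_fun a b c) (dirichlet_conv a (dirichlet_conv b c)) n"
proof -
  define g where "g = (\<lambda>\<psi> :: nat \<Rightarrow> real. \<lambda>p. Abs_fps (\<lambda>k. \<psi> p ^ k))"
  have g0: "fps_nth (g \<psi> p) 0 = 1" for \<psi> p by (simp add: g_def)
  have gi: "fps_of_poly [:1, - \<psi> p:] * g \<psi> p = 1" for \<psi> p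
  proof (rule fps_ext)
    fix k show "fps_nth (fps_of_poly [:1, - \<psi> p:] * g \<psi> p) k = fps_nth 1 k"
      by (cases k) (simp_all add: g_def fps_of_poly_pCons algebra_simps)
  qed
  \<comment> \<open>The Euler representations of \<open>a\<close>, \<open>b\<close>,
    \<open>c\<close> are known only at positive arguments, so a replacement inside a convolution has
    to check that the divisors and their cofactors are positive.\<close>
  have dcong: "dirichlet_conv f1 f2 m = dirichlet_conv f1 f3 m"
    if "\<And>n. n > 0 \<Longrightarrow> f2 n = f3 n" "m > 0" for f1 f2 f3 m
    unfolding dirichlet_conv_def
  proof (intro sum.cong refl)
    fix d assume "d \<in> {d. d dvd m}"
    then have "m div d > 0" using that(2) by (auto simp: dvd_div_eq_0_iff intro!: Nat.gr0I)
    then show "f1 d * f2 (m div d) = f1 d * f3 (m div d)" using that(1) by simp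
  qed
  have dcong': "dirichlet_conv f1 f2 m = dirichlet_conv f3 f2 m"
    if "\<And>n. n > 0 \<Longrightarrow> f1 n = f3 n" "m > 0" for f1 f2 f3 m
    unfolding dirichlet_conv_def
  proof (intro sum.cong refl)
    fix d assume "d \<in> {d. d dvd m}"
    then have "d > 0" using that(2) by (auto dest: dvd_pos_nat)
    then show "f1 d * f2 (m div d) = f3 d * f2 (m div d)" using that(1) by simp
  qed
  have abc: "euler_fun (g a) m = a m" "euler_fun (g b) m = b m" "euler_fun (g c) m = c m" if "m > 0" for m
    unfolding g_def using one mult that by (auto intro!: euler_fun_completely_multiplicative)
  have k: "dirichlet_conv a (dirichlet_conv b c) m = euler_fun (\<lambda>p. g a p * (g b p * g c p)) m"
    if m: "m > 0" for m
  proof -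
    have "dirichlet_conv b c n = euler_fun (\<lambda>p. g b p * g c p) n" if "n > 0" for n
    proof -
      have "dirichlet_conv b c n = dirichlet_conv (euler_fun (g b)) (euler_fun (g c)) n"
        using dcong[of c "euler_fun (g c)" n b] dcong'[of b "euler_fun (g b)" n] abc that by simp
      then show ?thesis using that by (simp add: dirichlet_conv_euler_fun g0)
    qed
    then have "dirichlet_conv a (dirichlet_conv b c) m = dirichlet_conv a (euler_fun (\<lambda>p. g b p * g c p)) m"
      using m by (intro dcong) auto
    also have "\<dots> = dirichlet_conv (euler_fun (g a)) (euler_fun (\<lambda>p. g b p * g c p)) m"
      using m abc by (intro dcong') auto
    finally show ?thesis using m by (simp add: dirichlet_conv_euler_fun g0)
  qed
  have tr: "euler_trunc (\<lambda>p. g a p * (g b p * g c p)) p =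
      fps_of_poly (sieve_poly a b c p) * (g a p * (g b p * g c p))" for p
  proof -
    define t where "t = (if p = 2 then 1 else [:1, a p + b p + c p:])"
    \<comment> \<open>The factors are regrouped so that each linear polynomial meets its own
      geometric series and cancels.\<close>
    have "fps_of_poly (sieve_poly a b c p) * (g a p * (g b p * g c p)) =
       fps_of_poly t * ((fps_of_poly [:1, - a p:] * g a p) * ((fps_of_poly [:1, - b p:] * g b p) * (fps_of_poly [:1, - c p:] * g c p)))"
      unfolding sieve_poly_def t_def[symmetric] fps_of_poly_mult by (simp only: mult_ac)
    also have "\<dots> = fps_of_poly t" by (simp only: gi mult_1_right)
    also have "\<dots> = euler_trunc (\<lambda>p. g a p * (g b p * g c p)) p"
      by (simp add: t_def euler_trunc_def fps_of_poly_pCons g_def fps_mult_nth algebra_simps)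
    finally show ?thesis by simp
  qed
  have "(if odd n \<and> squarefree n then dirichlet_conv a (dirichlet_conv b c) n else 0) =
      euler_fun (\<lambda>p. fps_of_poly (sieve_poly a b c p) * (g a p * (g b p * g c p))) n"
    unfolding k[OF assms] using odd_squarefree_mult_euler_fun[OF assms, of "\<lambda>p. g a p * (g b p * g c p)"]
    by (simp add: g0 tr cong: if_cong) (simp add: tr[abs_def])
  also have "\<dots> = dirichlet_conv (sieve_fun a b c) (euler_fun (\<lambda>p. g a p * (g b p * g c p))) n"
    unfolding sieve_fun_def using assms sieve_coeffs by (subst dirichlet_conv_euler_fun) (auto simp: g0)
  also have "\<dots> = dirichlet_conv (sieve_fun a b c) (dirichlet_conv a (dirichlet_conv b c)) n"
    using k assms by (intro dcong) auto
  finally show ?thesis .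
qed

lemma multiplicative_sieve_fun: "multiplicative (sieve_fun a b c)"
  unfolding sieve_fun_def using sieve_coeffs by (intro multiplicative_euler_fun) auto

lemma sieve_fun_prime_power: "prime p \<Longrightarrow> sieve_fun a b c (p ^ k) = coeff (sieve_poly a b c p) k"
  unfolding sieve_fun_def using sieve_coeffs by (subst euler_fun_prime_power) auto

text \<open>All prime factors of \<open>n\<close> are at most \<open>n\<close>, so non-membership
  can only be due to an exponent above 4, where the coefficient vanishes.\<close>

lemma sieve_fun_eq_0:
  assumes "n > 0" "n \<notin> powerfree_smooth {p. prime p \<and> p \<le> n}"
  shows "sieve_fun a b c n = 0"
proof -
  have "prime_factors n \<subseteq> {p. prime p \<and> p \<le> n}" using assms by (auto simp: prime_factors_dvd dvd_imp_le)
  then obtain p where p: "prime p" "multiplicity p n > 4"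
    using assms by (auto simp: powerfree_smooth_def not_le)
  then have "p \<in> prime_factors n" by (auto simp: prime_factors_multiplicity)
  moreover have "fps_nth (fps_of_poly (sieve_poly a b c p)) (multiplicity p n) = 0"
    using coeff_sieve_poly(3)[of a p b c] bd p by simp
  ultimately show ?thesis unfolding sieve_fun_def euler_fun_def by (intro prod_zero) auto
qed

lemma powerfree_smooth_mono: "P \<subseteq> Q \<Longrightarrow> powerfree_smooth P \<subseteq> powerfree_smooth Q"
  by (auto simp: powerfree_smooth_def)

text \<open>Partial sums are dominated by finite Euler products, and \<open>1 + y <= exp y\<close>
  turns these into sums over primes. As the linear coefficient vanishes away from 2, each other
  factor is \<open>1 + O(p powr (-3/2))\<close>, and these deviations are summable.\<close>

lemma summable_sieve_fun_powr: "summable (\<lambda>n. \<bar>sieve_fun a b c n\<bar> * real n powr (-3/4))"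
proof -
  define G where "G = (\<lambda>n. \<bar>sieve_fun a b c n\<bar> * real n powr (-3/4))"
  have mG: "multiplicative G"
    using multiplicative_sieve_fun by (auto simp: multiplicative_def G_def abs_mult powr_mult)
  have G0: "G n \<ge> 0" for n by (simp add: G_def)
  have s32: "summable (\<lambda>n. real n powr (-3/2))" by (simp add: summable_real_powr_iff)
  \<comment> \<open>48 allows for the linear term at 2, whose coefficient is at most 12 in absolute
    value; 36 is three times the coefficient bound 12, for the exponents 2, 3 and 4.\<close>
  define B where "B = exp (48 + 36 * (\<Sum>n. real n powr (-3/2)))"
  have "(\<Sum>n<N. G n) \<le> B" for N
  proof -
    define P where "P = {p. prime p \<and> p \<le> N}"
    have fP: "finite P" unfolding P_def by (rule finite_subset[of _ "{..N}"]) auto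
    have sP: "finite (powerfree_smooth P)" "sum G (powerfree_smooth P) = (\<Prod>p\<in>P. \<Sum>k\<le>4. G (p ^ k))"
      using sum_powerfree_smooth[OF mG fP] by (auto simp: P_def)
    have "(\<Sum>n<N. G n) \<le> sum G (powerfree_smooth P)"
    proof -
      have "G n = 0" if "n < N" "n \<notin> powerfree_smooth P" for n
      proof (cases "n = 0")
        case False
        have "{p. prime p \<and> p \<le> n} \<subseteq> P" using that by (auto simp: P_def)
        then have "n \<notin> powerfree_smooth {p. prime p \<and> p \<le> n}"
          using that(2) powerfree_smooth_mono by blast
        then show ?thesis using sieve_fun_eq_0[of n] False by (simp add: G_def)
      qed (simp add: G_def)
      then have "(\<Sum>n<N. G n) = sum G ({..<N} \<inter> powerfree_smooth P)"
        by (intro sum.mono_neutral_right) auto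
      also have "\<dots> \<le> sum G (powerfree_smooth P)" using sP(1) G0 by (intro sum_mono2) auto
      finally show ?thesis .
    qed
    also have "\<dots> = (\<Prod>p\<in>P. \<Sum>k\<le>4. G (p ^ k))" by (rule sP)
    also have "\<dots> \<le> (\<Prod>p\<in>P. exp ((if p = 2 then 48 else 0) + 36 * real p powr (-3/2)))"
    proof (rule prod_mono, intro conjI)
      fix p assume "p \<in> P"
      then have p: "prime p" "real p \<ge> 1" using prime_ge_1_nat by (auto simp: P_def)
      show "0 \<le> (\<Sum>k\<le>4. G (p ^ k))" using G0 by (intro sum_nonneg) auto
      have c12: "\<bar>coeff (sieve_poly a b c p) k\<bar> \<le> 12" for k using coeff_sieve_poly(4)[of a p b c] bd by simp
      have Gp: "G (p ^ k) = \<bar>coeff (sieve_poly a b c p) k\<bar> * real p powr (-3/4 * real k)" for k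
        using p by (simp add: G_def sieve_fun_prime_power powr_realpow[symmetric] powr_powr mult.commute)
      have e4: "{..4::nat} = {0,1,2,3,4}" by auto
      have le1: "real p powr (-3/4 * real k) \<le> 1" for k
        using p powr_mono[of "-3/4 * real k" 0 "real p"] by simp
      have G1: "G (p ^ 0) = 1" unfolding Gp using coeff_sieve_poly(1)[of a p b c] bd p by simp
      have Gk: "G (p ^ k) \<le> 12 * real p powr (-3/2)" if "k \<ge> 2" for k
        unfolding Gp using p c12 that by (intro mult_mono powr_mono) auto
      have G2: "G (p ^ 1) \<le> (if p = 2 then 48 else 0)"
      proof (cases "p = 2")
        case True
        have "G (p ^ 1) \<le> 12 * 1" unfolding Gp using c12 le1[of 1] by (intro mult_mono) auto
        then show ?thesis using True by simp
      next
        case False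
        then show ?thesis using coeff_sieve_poly(2)[of a p b c] bd p by (simp only: Gp) simp
      qed
      have "(\<Sum>k\<le>4. G (p ^ k)) \<le> 1 + ((if p = 2 then 48 else 0) + 36 * real p powr (-3/2))"
        unfolding e4 using G1 G2 Gk[of 2] Gk[of 3] Gk[of 4] by simp
      also have "\<dots> \<le> exp ((if p = 2 then 48 else 0) + 36 * real p powr (-3/2))" by (rule exp_ge_add_one_self)
      finally show "(\<Sum>k\<le>4. G (p ^ k)) \<le> exp ((if p = 2 then 48 else 0) + 36 * real p powr (-3/2))" .
    qed
    also have "\<dots> = exp ((\<Sum>p\<in>P. (if p = 2 then 48 else 0)) + 36 * (\<Sum>p\<in>P. real p powr (-3/2)))"
      using fP by (simp add: exp_sum[symmetric] sum.distrib sum_distrib_left)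
    also have "\<dots> \<le> B"
    proof -
      have "(\<Sum>p\<in>P. (if p = 2 then 48 else 0)) \<le> (48 :: real)" using fP by (simp add: sum.delta)
      moreover have "(\<Sum>p\<in>P. real p powr (-3/2)) \<le> (\<Sum>n. real n powr (-3/2))"
        using fP s32 by (intro sum_le_suminf) auto
      ultimately show ?thesis unfolding B_def by (subst exp_le_cancel_iff) linarith
    qed
    finally show ?thesis .
  qed
  then have "summable G" using G0 by (intro summableI_nonneg_bounded[of G B]) auto
  then show ?thesis by (simp add: G_def)
qed

lemma summable_sieve_fun_div: "summable (\<lambda>n. \<bar>sieve_fun a b c n / real n\<bar>)"
proof (rule summable_comparison_test[OF _ summable_sieve_fun_powr], intro exI[of _ 1] allI impI)
  fix n :: nat assume n: "n \<ge> 1"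
  have "1 / real n = real n powr (-1)" using n by (simp add: powr_minus_divide)
  also have "\<dots> \<le> real n powr (-3/4)" using n by (intro powr_mono) auto
  finally have "\<bar>sieve_fun a b c n\<bar> * (1 / real n) \<le> \<bar>sieve_fun a b c n\<bar> * real n powr (-3/4)"
    by (intro mult_left_mono) auto
  then show "norm \<bar>sieve_fun a b c n / real n\<bar> \<le> \<bar>sieve_fun a b c n\<bar> * real n powr (-3/4)"
    by (simp add: abs_divide)
qed

text \<open>The bound \<open>ln n <= 4 n powr (1/4)\<close> fills exactly the gap between the
  exponents -1 and -3/4.\<close>

lemma summable_sieve_fun_div_ln: "summable (\<lambda>n. \<bar>sieve_fun a b c n / real n\<bar> * ln (real n))"
proof (rule summable_comparison_test[OF _ summable_mult[OF summable_sieve_fun_powr, of 4]], intro exI[of _ 1] allI impI)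
  fix n :: nat assume n: "n \<ge> 1"
  have "ln (real n) \<le> real n powr (1/4) / (1/4)" using n by (intro ln_powr_bound) auto
  then have "1 / real n * ln (real n) \<le> real n powr (-1) * (4 * real n powr (1/4))"
    using n by (intro mult_mono) (auto simp: powr_minus_divide)
  also have "\<dots> = 4 * real n powr (-1 + 1/4)" unfolding powr_add by simp
  also have "-1 + 1/4 = (-3/4 :: real)" by simp
  finally have "\<bar>sieve_fun a b c n\<bar> * (1 / real n * ln (real n)) \<le> \<bar>sieve_fun a b c n\<bar> * (4 * real n powr (-3/4))"
    by (intro mult_left_mono) auto
  then show "norm (\<bar>sieve_fun a b c n / real n\<bar> * ln (real n)) \<le> 4 * (\<bar>sieve_fun a b c n\<bar> * real n powr (-3/4))"
    using n by (simp add: abs_divide)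
qed

end

context character_triple
begin

text \<open>Absolute convergence makes the series an unordered sum, which may be evaluated along any
  exhausting family of finite sets; along smooth numbers the partial sums are finite Euler
  products.\<close>

lemma sieve_fun_euler_product:
  "(\<lambda>N. \<Prod>p | prime p \<and> p \<le> N. poly (sieve_poly a b c p) (1 / real p)) \<longlonglongrightarrow> (\<Sum>n. sieve_fun a b c n / real n)"
proof -
  define F where "F = (\<lambda>n. sieve_fun a b c n / real n)"
  have mF: "multiplicative F"
    using multiplicative_sieve_fun by (auto simp: multiplicative_def F_def)
  have sm: "summable (\<lambda>n. norm (F n))" using summable_sieve_fun_div by (simp add: F_def)
  have hs: "(F has_sum (\<Sum>n. F n)) UNIV"
    by (rule norm_summable_imp_has_sum[OF sm summable_sums[OF summable_norm_cancel[OF sm]]])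
  define P where "P = (\<lambda>N::nat. {p. prime p \<and> p \<le> N})"
  have fP: "finite (P N)" for N unfolding P_def by (rule finite_subset[of _ "{..N}"]) auto
  have sP: "finite (powerfree_smooth (P N))" "sum F (powerfree_smooth (P N)) = (\<Prod>p\<in>P N. \<Sum>k\<le>4. F (p ^ k))" for N
    using sum_powerfree_smooth[OF mF fP] by (auto simp: P_def)
  \<comment> \<open>The initial segment \<open>{..N}\<close> is added so that every finite set is
    eventually covered. Its elements outside the smooth numbers contribute 0, the index 0 because of
    division by 0.\<close>
  define S where "S = (\<lambda>N. powerfree_smooth (P N) \<union> {..N})"
  have "filterlim S (finite_subsets_at_top UNIV) sequentially"
    unfolding filterlim_finite_subsets_at_top
  proof (intro allI impI)
    fix X :: "nat set" assume X: "finite X \<and> X \<subseteq> UNIV"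
    show "eventually (\<lambda>N. finite (S N) \<and> X \<subseteq> S N \<and> S N \<subseteq> UNIV) sequentially"
    proof (rule eventually_sequentiallyI[of "Max (insert 0 X)"])
      fix N assume "Max (insert 0 X) \<le> N"
      then have "X \<subseteq> {..N}" using X by auto
      then show "finite (S N) \<and> X \<subseteq> S N \<and> S N \<subseteq> UNIV" using sP(1)[of N] by (auto simp: S_def)
    qed
  qed
  from filterlim_compose[OF hs[unfolded has_sum_def] this]
  have lim: "(\<lambda>N. sum F (S N)) \<longlonglongrightarrow> (\<Sum>n. F n)" .
  have "sum F (S N) = (\<Prod>p\<in>P N. poly (sieve_poly a b c p) (1 / real p))" for N
  proof -
    have "sum F (S N) = sum F (powerfree_smooth (P N))"
    proof (rule sum.mono_neutral_right)
      show "finite (S N)" "powerfree_smooth (P N) \<subseteq> S N" using sP(1)[of N] by (simp_all add: S_def)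
      show "\<forall>n\<in>S N - powerfree_smooth (P N). F n = 0"
      proof
        fix n assume n: "n \<in> S N - powerfree_smooth (P N)"
        show "F n = 0"
        proof (cases "n = 0")
          case False
          have "n \<le> N" using n by (auto simp: S_def)
          then have "P n \<subseteq> P N" by (auto simp: P_def)
          then have "n \<notin> powerfree_smooth (P n)" using n powerfree_smooth_mono[of "P n" "P N"] by blast
          then have "sieve_fun a b c n = 0" using sieve_fun_eq_0[of n] False unfolding P_def by blast
          then show ?thesis by (simp add: F_def)
        qed (simp add: F_def)
      qed
    qed
    also have "\<dots> = (\<Prod>p\<in>P N. \<Sum>k\<le>4. F (p ^ k))" by (rule sP)
    also have "\<dots> = (\<Prod>p\<in>P N. poly (sieve_poly a b c p) (1 / real p))"
    proof (rule prod.cong, rule refl)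
      fix p assume "p \<in> P N"
      then have p: "prime p" by (simp add: P_def)
      have "poly (sieve_poly a b c p) (1 / real p) = (\<Sum>k\<le>4. coeff (sieve_poly a b c p) k * (1 / real p) ^ k)"
        unfolding poly_altdef using coeff_sieve_poly(5)[of a p b c] bd
        by (intro sum.mono_neutral_left) (auto intro: coeff_eq_0)
      then show "(\<Sum>k\<le>4. F (p ^ k)) = poly (sieve_poly a b c p) (1 / real p)"
        using p by (simp add: F_def sieve_fun_prime_power power_one_over)
    qed
    finally show ?thesis .
  qed
  then show ?thesis using lim by (simp add: P_def F_def)
qed

end

context character_triple
begin

text \<open>By \<open>sieve_convolution\<close> the sum runs over \<open>h d\<close> times the
  summatory function of the full convolution at \<open>x / d\<close>. Inserting the hypothesis costs
  the sum of \<open>|h d| / d\<close>; replacing \<open>(ln (x / d))^2\<close> by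
  \<open>(ln x)^2\<close> and completing the series costs \<open>ln x\<close> times the sum of
  \<open>|h d| ln d / d\<close>. The parameter \<open>\<kappa>\<close> will be 1 for trivial
  characters and 0 otherwise.\<close>

lemma summatory_odd_squarefree_bound:
  assumes "\<And>x. x \<ge> 1 \<Longrightarrow>
    \<bar>summatory (dirichlet_conv a (dirichlet_conv b c)) x - \<kappa> * (x * (ln x)\<^sup>2 / 2)\<bar> \<le> C * (x * (1 + ln x))"
  shows "\<exists>K. \<forall>x\<ge>1. \<bar>summatory (\<lambda>n. if odd n \<and> squarefree n then dirichlet_conv a (dirichlet_conv b c) n else 0) x
     - \<kappa> * ((\<Sum>n. sieve_fun a b c n / real n) / 2 * x * (ln x)\<^sup>2)\<bar> \<le> K * (x * (1 + ln x))"
proof -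
  define h where "h = sieve_fun a b c"
  define D where "D = dirichlet_conv a (dirichlet_conv b c)"
  define M where "M = (\<Sum>n. \<bar>h n / real n\<bar>)"
  define L where "L = (\<Sum>n. \<bar>h n / real n\<bar> * ln (real n))"
  define H where "H = (\<Sum>n. h n / real n)"
  have sM: "summable (\<lambda>n. \<bar>h n / real n\<bar>)" unfolding h_def by (rule summable_sieve_fun_div)
  have sL: "summable (\<lambda>n. \<bar>h n / real n\<bar> * ln (real n))" unfolding h_def by (rule summable_sieve_fun_div_ln)
  have sH: "summable (\<lambda>n. h n / real n)" using sM by (rule summable_rabs_cancel)
  have C0: "C \<ge> 0" using assms[of 1] by simp
  have "\<bar>summatory (\<lambda>n. if odd n \<and> squarefree n then D n else 0) x - \<kappa> * (H / 2 * x * (ln x)\<^sup>2)\<bar>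
     \<le> (C * M + \<bar>\<kappa>\<bar> * L) * (x * (1 + ln x))" if x: "x \<ge> 1" for x
  proof -
    have lnx: "ln x \<ge> 0" using x by simp
    define W where "W = summatory (\<lambda>d. h d / real d * (ln (x / real d))\<^sup>2) x"
    have "summatory (\<lambda>n. if odd n \<and> squarefree n then D n else 0) x = summatory (dirichlet_conv h D) x"
      unfolding h_def D_def by (rule summatory_cong) (rule sieve_convolution)
    also have "\<dots> = summatory (\<lambda>d. h d * summatory D (x / real d)) x" by (rule summatory_dirichlet_conv)
    finally have 1: "summatory (\<lambda>n. if odd n \<and> squarefree n then D n else 0) x =
      summatory (\<lambda>d. h d * summatory D (x / real d)) x" .
    have 2: "\<kappa> * (x / 2 * W) = summatory (\<lambda>d. h d * (\<kappa> * (x / real d * (ln (x / real d))\<^sup>2 / 2))) x"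
      unfolding W_def summatory_cmult[symmetric] by (rule summatory_cong) (simp add: mult_ac)
    have "\<bar>summatory (\<lambda>d. h d * summatory D (x / real d)) x - \<kappa> * (x / 2 * W)\<bar> \<le>
       summatory (\<lambda>d. \<bar>h d * summatory D (x / real d) - h d * (\<kappa> * (x / real d * (ln (x / real d))\<^sup>2 / 2))\<bar>) x"
      unfolding 2 summatory_diff[symmetric] by (rule abs_summatory_le)
    also have "\<dots> \<le> summatory (\<lambda>d. C * (x * (1 + ln x)) * \<bar>h d / real d\<bar>) x"
    proof (rule summatory_mono)
      fix d assume d: "d > 0" "real d \<le> x"
      then have xd: "x / real d \<ge> 1" by simp
      have "\<bar>h d * summatory D (x / real d) - h d * (\<kappa> * (x / real d * (ln (x / real d))\<^sup>2 / 2))\<bar> =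
         \<bar>h d\<bar> * \<bar>summatory D (x / real d) - \<kappa> * (x / real d * (ln (x / real d))\<^sup>2 / 2)\<bar>"
        by (simp add: abs_mult[symmetric] right_diff_distrib)
      also have "\<dots> \<le> \<bar>h d\<bar> * (C * (x / real d * (1 + ln (x / real d))))"
        using assms[OF xd] unfolding D_def by (intro mult_left_mono) auto
      also have "\<dots> \<le> \<bar>h d\<bar> * (C * (x / real d * (1 + ln x)))"
        using d x C0 by (intro mult_left_mono add_left_mono) (auto simp: ln_div)
      also have "\<dots> = C * (x * (1 + ln x)) * \<bar>h d / real d\<bar>" by (simp add: abs_divide)
      finally show "\<bar>h d * summatory D (x / real d) - h d * (\<kappa> * (x / real d * (ln (x / real d))\<^sup>2 / 2))\<bar>
        \<le> C * (x * (1 + ln x)) * \<bar>h d / real d\<bar>" .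
    qed
    also have "\<dots> = C * (x * (1 + ln x)) * summatory (\<lambda>d. \<bar>h d / real d\<bar>) x" by (rule summatory_cmult)
    also have "\<dots> \<le> C * (x * (1 + ln x)) * M"
      unfolding summatory_def M_def using sM C0 x lnx by (intro mult_left_mono sum_le_suminf) auto
    finally have E1: "\<bar>summatory (\<lambda>d. h d * summatory D (x / real d)) x - \<kappa> * (x / 2 * W)\<bar> \<le> C * M * (x * (1 + ln x))"
      by (simp add: mult_ac)
    \<comment> \<open>Extension by 0 beyond \<open>x\<close> turns the finite sum into a series, so
      that truncation and change of logarithm are estimated in one termwise comparison.\<close>
    define w where "w = (\<lambda>d. if d > 0 \<and> real d \<le> x then h d / real d * (ln (x / real d))\<^sup>2 else 0)"
    have w: "w sums W"
    proof -
      have "w sums (\<Sum>d | d > 0 \<and> real d \<le> x. w d)" by (rule sums_finite) (auto simp: w_def)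
      also have "(\<Sum>d | d > 0 \<and> real d \<le> x. w d) = W" unfolding W_def summatory_def by (rule sum.cong) (auto simp: w_def)
      finally show ?thesis .
    qed
    have "(\<lambda>d. h d / real d * (ln x)\<^sup>2) sums (H * (ln x)\<^sup>2)"
      unfolding H_def using sH by (intro sums_mult2 summable_sums)
    with w have d: "(\<lambda>d. w d - h d / real d * (ln x)\<^sup>2) sums (W - H * (ln x)\<^sup>2)" by (rule sums_diff)
    \<comment> \<open>For \<open>d <= x\<close> this is a difference of squares with
      \<open>ln (x / d) = ln x - ln d\<close>; for \<open>d > x\<close> the term \<open>w d\<close>
      is 0 and \<open>(ln x)^2 <= ln x * ln d\<close>.\<close>
    have wb: "\<bar>w d - h d / real d * (ln x)\<^sup>2\<bar> \<le> 2 * ln x * (\<bar>h d / real d\<bar> * ln (real d))" for d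
    proof -
      consider "d = 0" | "d > 0" "real d \<le> x" | "d > 0" "real d > x" by linarith
      then show ?thesis
      proof cases
        case 1 then show ?thesis by (simp add: w_def)
      next
        case 2
        have l: "0 \<le> ln (real d)" "ln (real d) \<le> ln x" using 2 by auto
        have "w d - h d / real d * (ln x)\<^sup>2 = - (h d / real d * (ln (real d) * (2 * ln x - ln (real d))))"
          using 2 x by (simp add: w_def ln_div power2_eq_square field_simps)
        then have "\<bar>w d - h d / real d * (ln x)\<^sup>2\<bar> = \<bar>h d / real d\<bar> * (ln (real d) * (2 * ln x - ln (real d)))"
          using l by (simp add: abs_mult)
        also have "\<dots> \<le> \<bar>h d / real d\<bar> * (ln (real d) * (2 * ln x))" using l by (intro mult_left_mono) auto
        finally show ?thesis by (simp add: mult_ac)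
      next
        case 3
        have l: "ln x \<le> ln (real d)" using 3 x by simp
        have "\<bar>w d - h d / real d * (ln x)\<^sup>2\<bar> = \<bar>h d / real d\<bar> * (ln x * ln x)"
          using 3 by (simp add: w_def abs_mult power2_eq_square)
        also have "\<dots> \<le> \<bar>h d / real d\<bar> * ((2 * ln x) * ln (real d))"
          using l lnx by (intro mult_left_mono mult_mono) auto
        finally show ?thesis by (simp add: mult_ac)
      qed
    qed
    have sumb: "summable (\<lambda>d. 2 * ln x * (\<bar>h d / real d\<bar> * ln (real d)))" using sL by (rule summable_mult)
    have sa: "summable (\<lambda>d. \<bar>w d - h d / real d * (ln x)\<^sup>2\<bar>)"
      by (rule summable_comparison_test'[OF sumb, of 0]) (use wb in simp)
    have "\<bar>W - H * (ln x)\<^sup>2\<bar> = \<bar>\<Sum>d. w d - h d / real d * (ln x)\<^sup>2\<bar>" using sums_unique[OF d] by simp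
    also have "\<dots> \<le> (\<Sum>d. \<bar>w d - h d / real d * (ln x)\<^sup>2\<bar>)" by (rule summable_rabs[OF sa])
    also have "\<dots> \<le> (\<Sum>d. 2 * ln x * (\<bar>h d / real d\<bar> * ln (real d)))" by (rule suminf_le[OF wb sa sumb])
    also have "\<dots> = 2 * ln x * L" unfolding L_def by (rule suminf_mult[OF sL])
    finally have E2: "\<bar>W - H * (ln x)\<^sup>2\<bar> \<le> 2 * ln x * L" .
    have L0: "L \<ge> 0"
    proof -
      have "0 \<le> \<bar>h n / real n\<bar> * ln (real n)" for n by (cases "n = 0") auto
      then show ?thesis unfolding L_def using sL by (intro suminf_nonneg)
    qed
    have "\<bar>\<kappa> * (x / 2 * W) - \<kappa> * (H / 2 * x * (ln x)\<^sup>2)\<bar> = \<bar>\<kappa>\<bar> * (x / 2) * \<bar>W - H * (ln x)\<^sup>2\<bar>"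
    proof -
      have "\<kappa> * (x / 2 * W) - \<kappa> * (H / 2 * x * (ln x)\<^sup>2) = \<kappa> * (x / 2) * (W - H * (ln x)\<^sup>2)"
        by (simp add: algebra_simps)
      then have "\<bar>\<kappa> * (x / 2 * W) - \<kappa> * (H / 2 * x * (ln x)\<^sup>2)\<bar> = \<bar>\<kappa> * (x / 2) * (W - H * (ln x)\<^sup>2)\<bar>"
        by (rule arg_cong)
      also have "\<dots> = \<bar>\<kappa>\<bar> * (x / 2) * \<bar>W - H * (ln x)\<^sup>2\<bar>" using x by (simp only: abs_mult)
      finally show ?thesis .
    qed
    also have "\<dots> \<le> \<bar>\<kappa>\<bar> * (x / 2) * (2 * ln x * L)" using E2 x by (intro mult_left_mono) auto
    also have "\<dots> = \<bar>\<kappa>\<bar> * L * (x * ln x)" by simp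
    also have "\<dots> \<le> \<bar>\<kappa>\<bar> * L * (x * (1 + ln x))" using x lnx L0 by (intro mult_left_mono) auto
    finally have E3: "\<bar>\<kappa> * (x / 2 * W) - \<kappa> * (H / 2 * x * (ln x)\<^sup>2)\<bar> \<le> \<bar>\<kappa>\<bar> * L * (x * (1 + ln x))" .
    show ?thesis unfolding 1 distrib_right using E1 E3 by linarith
  qed
  then show ?thesis unfolding D_def h_def H_def by blast
qed

end

section \<open>The leading constant as an Euler product\<close>

lemma character_triple_one: "character_triple (\<lambda>_. 1) (\<lambda>_. 1) (\<lambda>_. 1)"
  by unfold_locales auto

lemma character_triple_chi4: "character_triple (\<lambda>_. 1) chi4 chi4"
  by unfold_locales (auto simp: chi4_mult abs_chi4_le)

definition biquadratic_product :: real where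
  "biquadratic_product = (\<Prod>p::nat. if prime p then (1 - 1 / real p) ^ 3 * (1 + 3 / real p) else 1)"

lemma convergent_biquadratic_product:
  "convergent_prod (\<lambda>p::nat. if prime p then (1 - 1 / real p) ^ 3 * (1 + 3 / real p) else 1)"
proof (rule abs_convergent_prod_imp_convergent_prod, rule summable_imp_abs_convergent_prod)
  have "summable (\<lambda>p. 1 / real p ^ 2)"
    using inverse_power_summable[of 2, where 'a = real] by (simp add: inverse_eq_divide)
  then have sm: "summable (\<lambda>p. 17 * (1 / real p ^ 2))" by (rule summable_mult)
  have bound: "\<bar>(if prime p then (1 - 1 / real p) ^ 3 * (1 + 3 / real p) else 1) - 1\<bar> \<le> 17 * (1 / real p ^ 2)" for p :: nat
  proof (cases "prime p")
    case True
    define y where "y = 1 / real p"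
    have y: "0 \<le> y" "y \<le> 1" using True prime_gt_0_nat[of p] by (auto simp: y_def)
    have y3: "0 \<le> y ^ 3" "y ^ 3 \<le> y ^ 2" "0 \<le> y ^ 4" "y ^ 4 \<le> y ^ 2" using y by (auto intro: power_decreasing)
    \<comment> \<open>No linear term survives, and \<open>6 + 8 + 3 = 17\<close> gives the constant
      of the bound.\<close>
    have eq: "(1 - y) ^ 3 * (1 + 3 * y) - 1 = - 6 * y ^ 2 + 8 * y ^ 3 - 3 * y ^ 4"
      by (simp add: eval_nat_numeral algebra_simps)
    have "\<bar>(1 - y) ^ 3 * (1 + 3 * y) - 1\<bar> \<le> 17 * y ^ 2"
      unfolding eq abs_le_iff using y3 by linarith
    then show ?thesis using True by (simp add: y_def power_one_over)
  qed simp
  show "summable (\<lambda>p::nat. norm ((if prime p then (1 - 1 / real p) ^ 3 * (1 + 3 / real p) else 1) - 1))"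
    by (rule summable_comparison_test'[OF sm, of 0]) (use bound in simp)
qed

text \<open>At 2 the local factor of the sieve is \<open>(1 - 1/2)^3\<close> without the factor
  \<open>1 + 3/2 = 5/2\<close>; at all other primes it agrees with that of the product. This is the
  origin of \<open>2 / 5\<close>.\<close>

lemma sieve_fun_sum_eq_biquadratic_product:
  "(\<Sum>n. sieve_fun (\<lambda>_. 1) (\<lambda>_. 1) (\<lambda>_. 1) n / real n) = 2 / 5 * biquadratic_product"
proof -
  define f where "f = (\<lambda>p::nat. if prime p then (1 - 1 / real p) ^ 3 * (1 + 3 / real p) else 1 :: real)"
  define q where "q = (\<lambda>p. poly (sieve_poly (\<lambda>_. 1) (\<lambda>_. 1) (\<lambda>_. 1) p) (1 / real p))"
  have q: "q p = (if p = 2 then 2 / 5 else 1) * f p" if "prime p" for p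
    using that by (simp add: q_def f_def sieve_poly_def power3_eq_cube field_simps)
  have "(\<Prod>p | prime p \<and> p \<le> N. q p) = 2 / 5 * (\<Prod>p\<le>N. f p)" if "N \<ge> 2" for N
  proof -
    have fin: "finite {p. prime p \<and> p \<le> N}" by (rule finite_subset[of _ "{..N}"]) auto
    have "(\<Prod>p | prime p \<and> p \<le> N. q p) = (\<Prod>p | prime p \<and> p \<le> N. if p = 2 then 2 / 5 else 1) * (\<Prod>p | prime p \<and> p \<le> N. f p)"
      unfolding prod.distrib[symmetric] by (rule prod.cong) (use q in auto)
    also have "(\<Prod>p | prime p \<and> p \<le> N. if p = 2 then 2 / 5 else (1::real)) = 2 / 5"
      using that fin by (subst prod.delta) auto
    also have "(\<Prod>p | prime p \<and> p \<le> N. f p) = (\<Prod>p\<le>N. f p)"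
      by (rule prod.mono_neutral_left) (auto simp: f_def)
    finally show ?thesis .
  qed
  then have "eventually (\<lambda>N. 2 / 5 * (\<Prod>p\<le>N. f p) = (\<Prod>p | prime p \<and> p \<le> N. q p)) sequentially"
    by (intro eventually_sequentiallyI[of 2]) simp
  moreover have "(\<lambda>N. 2 / 5 * (\<Prod>p\<le>N. f p)) \<longlonglongrightarrow> 2 / 5 * biquadratic_product"
    unfolding biquadratic_product_def f_def
    by (intro tendsto_mult tendsto_const convergent_prod_LIMSEQ convergent_biquadratic_product)
  ultimately have "(\<lambda>N. \<Prod>p | prime p \<and> p \<le> N. q p) \<longlonglongrightarrow> 2 / 5 * biquadratic_product"
    by (rule Lim_transform_eventually[rotated])
  then show ?thesis
    using LIMSEQ_unique character_triple.sieve_fun_euler_product[OF character_triple_one] unfolding q_def by blast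
qed

section \<open>From threefold convolutions to ordered triples\<close>

definition odd_squarefree_triples :: "real \<Rightarrow> (nat \<times> nat \<times> nat) set" where
  "odd_squarefree_triples x = {(g, u, v). odd (g * u * v) \<and> squarefree (g * u * v) \<and> real (g * u * v) \<le> x}"

text \<open>A factorization \<open>n = g * u * v\<close> amounts to a divisor \<open>g\<close> of
  \<open>n\<close> and a divisor \<open>u\<close> of \<open>n div g\<close>, with \<open>v\<close>
  the remaining quotient.\<close>

lemma summatory_eq_sum_triples:
  "summatory (\<lambda>n. if odd n \<and> squarefree n then dirichlet_conv a (dirichlet_conv b c) n else 0) x =
     (\<Sum>(g, u, v)\<in>odd_squarefree_triples x. a g * b u * c v)"
proof -
  let ?N = "{n. odd n \<and> squarefree n \<and> real n \<le> x}"
  have fin: "finite ?N" by (rule finite_subset[OF _ finite_pos_le_real[of x]]) (auto intro!: Nat.gr0I)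
  have "summatory (\<lambda>n. if odd n \<and> squarefree n then dirichlet_conv a (dirichlet_conv b c) n else 0) x =
     (\<Sum>n\<in>?N. dirichlet_conv a (dirichlet_conv b c) n)"
    unfolding summatory_def by (rule sum.mono_neutral_cong_right) (auto intro!: Nat.gr0I)
  also have "\<dots> = (\<Sum>n\<in>?N. \<Sum>(g, u)\<in>Sigma {g. g dvd n} (\<lambda>g. {u. u dvd n div g}). a g * b u * c (n div g div u))"
  proof (rule sum.cong[OF refl])
    fix n assume n: "n \<in> ?N"
    then have n0: "n > 0" by (auto intro!: Nat.gr0I)
    have f: "finite {u. u dvd n div g}" if "g dvd n" for g
    proof -
      have "n div g > 0" using that n0 by (auto simp: dvd_div_eq_0_iff intro!: Nat.gr0I)
      then show ?thesis by simp
    qed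
    have "dirichlet_conv a (dirichlet_conv b c) n = (\<Sum>g | g dvd n. \<Sum>u | u dvd n div g. a g * b u * c (n div g div u))"
      by (simp add: dirichlet_conv_def sum_distrib_left mult.assoc)
    also have "\<dots> = (\<Sum>(g, u)\<in>Sigma {g. g dvd n} (\<lambda>g. {u. u dvd n div g}). a g * b u * c (n div g div u))"
      using f n0 by (intro sum.Sigma) auto
    finally show "dirichlet_conv a (dirichlet_conv b c) n =
      (\<Sum>(g, u)\<in>Sigma {g. g dvd n} (\<lambda>g. {u. u dvd n div g}). a g * b u * c (n div g div u))" .
  qed
  also have "\<dots> = (\<Sum>(n, g, u)\<in>Sigma ?N (\<lambda>n. Sigma {g. g dvd n} (\<lambda>g. {u. u dvd n div g})). a g * b u * c (n div g div u))"
  proof (subst sum.Sigma[OF fin], intro ballI)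
    fix n assume n: "n \<in> ?N"
    then have n0: "n > 0" by (auto intro!: Nat.gr0I)
    have "finite {u. u dvd n div g}" if "g dvd n" for g
    proof -
      have "n div g > 0" using that n0 by (auto simp: dvd_div_eq_0_iff intro!: Nat.gr0I)
      then show ?thesis by simp
    qed
    then show "finite (Sigma {g. g dvd n} (\<lambda>g. {u. u dvd n div g}))" using n0 by (intro finite_SigmaI) auto
  qed (simp add: case_prod_unfold)
  also have "\<dots> = (\<Sum>(g, u, v)\<in>odd_squarefree_triples x. a g * b u * c v)"
  proof (rule sum.reindex_bij_witness[of _ "\<lambda>(g, u, v). (g * u * v, g, u)" "\<lambda>(n, g, u). (g, u, n div g div u)"], goal_cases)
    case (1 t)
    then obtain n g u where t: "t = (n, g, u)" "odd n" "g dvd n" "u dvd n div g" by auto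
    then have "n = g * u * (n div g div u)" by (metis dvd_mult_div_cancel mult.assoc)
    then show ?case using t by simp
  next
    case (2 t)
    then obtain n g u where t: "t = (n, g, u)" "n \<in> ?N" "g dvd n" "u dvd n div g" by auto
    then have n: "g * u * (n div g div u) = n" by (simp add: mult.assoc)
    have "odd (g * u * (n div g div u))" "squarefree (g * u * (n div g div u))" "real (g * u * (n div g div u)) \<le> x"
      using t(2) unfolding n by simp_all
    then show ?case unfolding odd_squarefree_triples_def t(1) by simp
  next
    case (3 t)
    obtain g u v where t: "t = (g, u, v)" by (cases t) auto
    have "odd (g * u * v)" using 3 t by (simp add: odd_squarefree_triples_def)
    then have "g > 0" "u > 0" by (auto intro!: Nat.gr0I)
    then show ?case using t by (simp add: mult.assoc)
  next
    case (4 t)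
    obtain g u v where t: "t = (g, u, v)" by (cases t) auto
    have o: "odd (g * u * v)" "squarefree (g * u * v)" "real (g * u * v) \<le> x"
      using 4 t by (simp_all add: odd_squarefree_triples_def)
    then have "g > 0" "u > 0" by (auto intro!: Nat.gr0I)
    then have "u dvd g * u * v div g" by (simp add: mult.assoc)
    then show ?case using t o by (simp del: of_nat_mult)
  qed auto
  finally show ?thesis .
qed

section \<open>Algebraic integers and subfields\<close>

text \<open>\<open>x\<close> is an eigenvalue of the integer matrix \<open>A\<close> with the
  nonzero eigenvector \<open>w\<close>, hence a root of its characteristic polynomial, which is
  monic with integer coefficients.\<close>

lemma algebraic_intI_int_matrix:
  fixes x :: complex and w :: "'i \<Rightarrow> complex" and A :: "'i \<Rightarrow> 'i \<Rightarrow> int"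
  assumes "finite I" and nz: "i0 \<in> I" "w i0 \<noteq> 0"
    and act: "\<And>i. i \<in> I \<Longrightarrow> x * w i = (\<Sum>j\<in>I. of_int (A i j) * w j)"
  shows "algebraic_int x"
proof -
  define n where "n = card I"
  obtain h where h: "bij_betw h {0..<n} I" using ex_bij_betw_nat_finite[OF \<open>finite I\<close>] unfolding n_def by blast
  define M where "M = Matrix.mat n n (\<lambda>(i, j). A (h i) (h j))"
  define M' where "M' = map_mat (of_int :: int \<Rightarrow> complex) M"
  define v where "v = Matrix.vec n (\<lambda>i. w (h i))"
  have M: "M \<in> carrier_mat n n" "M' \<in> carrier_mat n n" by (simp_all add: M_def M'_def)
  obtain k where k: "k < n" "h k = i0" using h nz(1) by (auto simp: bij_betw_def)
  have "M' *\<^sub>v v = x \<cdot>\<^sub>v v"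
  proof (rule eq_vecI)
    fix i assume "i < dim_vec (x \<cdot>\<^sub>v v)"
    then have i: "i < n" by (simp add: v_def)
    have "vec_index (M' *\<^sub>v v) i = (\<Sum>j\<in>{0..<n}. of_int (A (h i) (h j)) * w (h j))"
      using i by (simp add: M'_def M_def v_def scalar_prod_def)
    also have "\<dots> = (\<Sum>j\<in>I. of_int (A (h i) j) * w j)"
      by (rule sum.reindex_bij_betw[OF h])
    also have "\<dots> = x * w (h i)" using act[of "h i"] h i by (auto simp: bij_betw_def)
    finally show "vec_index (M' *\<^sub>v v) i = vec_index (x \<cdot>\<^sub>v v) i" using i by (simp add: v_def)
  qed (simp add: M'_def M_def v_def)
  moreover have "v \<noteq> 0\<^sub>v n"
  proof
    assume "v = 0\<^sub>v n"
    then have "vec_index v k = vec_index (0\<^sub>v n) k" by simp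
    then show False using k nz(2) by (simp add: v_def)
  qed
  ultimately have "eigenvalue M' x"
    unfolding eigenvalue_def eigenvector_def using M by (intro exI[of _ v]) (simp add: v_def M'_def M_def)
  then have "poly (char_poly M') x = 0" using eigenvalue_root_char_poly[OF M(2)] by blast
  moreover have "char_poly M' = map_poly of_int (char_poly M)"
    unfolding M'_def by (rule of_int_hom.char_poly_hom[OF M(1)])
  moreover have "lead_coeff (char_poly M) = 1" using degree_monic_char_poly[OF M(1)] by simp
  ultimately show ?thesis unfolding algebraic_int_altdef_ipoly by auto
qed

text \<open>Multiplication by \<open>x\<close> on the powers below the degree acts by the companion
  matrix: a shift, with the last row read off the monic equation.\<close>

lemma algebraic_int_power_reduction:
  fixes x :: complex
  assumes "algebraic_int x"
  obtains m c where "m > 0"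
    "\<And>i. i < m \<Longrightarrow> x * x ^ i = (\<Sum>k<m. of_int (c i k) * x ^ k)"
proof -
  obtain p where p: "poly (map_poly of_int p) x = 0" "lead_coeff p = 1"
    using assms unfolding algebraic_int_altdef_ipoly by blast
  define m where "m = degree p"
  have "m \<noteq> 0"
  proof
    assume "m = 0"
    then obtain a where "p = [:a:]" by (auto simp: m_def elim: degree_eq_zeroE)
    then show False using p by simp
  qed
  define c where "c = (\<lambda>i k. if Suc i < m then (if k = Suc i then 1 else 0) else - coeff p k)"
  have "0 = (\<Sum>i\<le>m. of_int (coeff p i) * x ^ i)"
    using p(1) by (simp add: poly_altdef m_def degree_map_poly coeff_map_poly)
  also have "\<dots> = (\<Sum>i<m. of_int (coeff p i) * x ^ i) + x ^ m"
    using p(2) by (simp add: m_def lessThan_Suc_atMost[symmetric])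
  finally have xm: "x ^ m = (\<Sum>i<m. - (of_int (coeff p i) * x ^ i))"
    by (simp add: sum_negf add_eq_0_iff)
  show ?thesis
  proof (rule that[of m c])
    show "m > 0" using \<open>m \<noteq> 0\<close> by simp
    fix i assume i: "i < m"
    show "x * x ^ i = (\<Sum>k<m. of_int (c i k) * x ^ k)"
    proof (cases "Suc i < m")
      case True
      have "(\<Sum>k<m. of_int (c i k) * x ^ k) = (\<Sum>k<m. if k = Suc i then x ^ k else 0)"
        using True by (intro sum.cong) (auto simp: c_def)
      then show ?thesis using True by simp
    next
      case False
      then have "Suc i = m" using i by simp
      then have "x * x ^ i = x ^ m" by (metis power_Suc)
      then show ?thesis using False xm by (simp add: c_def)
    qed
  qed
qed

text \<open>The products \<open>x ^ i * y ^ j\<close> span a module stable under multiplication by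
  \<open>x\<close> and by \<open>y\<close>; sums and products act on it by the sums and products of
  the two integer matrices.\<close>

lemma
  fixes x y :: complex
  assumes "algebraic_int x" "algebraic_int y"
  shows algebraic_int_add: "algebraic_int (x + y)"
    and algebraic_int_mult: "algebraic_int (x * y)"
proof -
  obtain m c where c: "m > 0" "\<And>i. i < m \<Longrightarrow> x * x ^ i = (\<Sum>k<m. of_int (c i k) * x ^ k)"
    using algebraic_int_power_reduction[OF assms(1)] by blast
  obtain n d where d: "n > 0" "\<And>i. i < n \<Longrightarrow> y * y ^ i = (\<Sum>k<n. of_int (d i k) * y ^ k)"
    using algebraic_int_power_reduction[OF assms(2)] by blast
  define I where "I = {..<m} \<times> {..<n}"
  define w where "w = (\<lambda>(i, j). x ^ i * y ^ j)"
  define A where "A = (\<lambda>(i :: nat, j :: nat) (k :: nat, l :: nat). if l = j then c i k else 0 :: int)"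
  define B where "B = (\<lambda>(i :: nat, j :: nat) (k :: nat, l :: nat). if k = i then d j l else 0 :: int)"
  have I: "finite I" "(0, 0) \<in> I" "w (0, 0) \<noteq> 0" using c d by (auto simp: I_def w_def)
  have A: "x * w t = (\<Sum>s\<in>I. of_int (A t s) * w s)" if tI: "t \<in> I" for t
  proof -
    obtain i j where t: "t = (i, j)" "i < m" "j < n" using tI by (auto simp: I_def)
    have "(\<Sum>s\<in>I. of_int (A t s) * w s) = (\<Sum>k<m. \<Sum>l<n. if l = j then of_int (c i k) * (x ^ k * y ^ l) else 0)"
      unfolding I_def sum.cartesian_product by (rule sum.cong) (auto simp: t A_def w_def)
    also have "\<dots> = (\<Sum>k<m. of_int (c i k) * x ^ k) * y ^ j"
      using t by (simp add: sum_distrib_right mult.assoc)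
    also have "\<dots> = x * w t" using c(2)[OF t(2)] by (simp add: t w_def mult.assoc)
    finally show ?thesis by simp
  qed
  have B: "y * w t = (\<Sum>s\<in>I. of_int (B t s) * w s)" if tI: "t \<in> I" for t
  proof -
    obtain i j where t: "t = (i, j)" "i < m" "j < n" using tI by (auto simp: I_def)
    have "(\<Sum>s\<in>I. of_int (B t s) * w s) = (\<Sum>k<m. \<Sum>l<n. if k = i then of_int (d j l) * (x ^ k * y ^ l) else 0)"
      unfolding I_def sum.cartesian_product by (rule sum.cong) (auto simp: t B_def w_def)
    also have "\<dots> = (\<Sum>k<m. if k = i then (\<Sum>l<n. of_int (d j l) * (x ^ k * y ^ l)) else 0)"
      by (rule sum.cong) auto
    also have "\<dots> = x ^ i * (\<Sum>l<n. of_int (d j l) * y ^ l)"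
      using t by (simp add: sum_distrib_left mult_ac)
    also have "\<dots> = y * w t" using d(2)[OF t(3), symmetric] by (simp add: t w_def mult_ac)
    finally show ?thesis by simp
  qed
  show "algebraic_int (x + y)"
  proof (rule algebraic_intI_int_matrix[of I "(0, 0)" w _ "\<lambda>t s. A t s + B t s", OF I])
    fix t assume "t \<in> I"
    then show "(x + y) * w t = (\<Sum>s\<in>I. of_int (A t s + B t s) * w s)"
      using A B by (simp add: distrib_right sum.distrib)
  qed
  show "algebraic_int (x * y)"
  proof (rule algebraic_intI_int_matrix[of I "(0, 0)" w _ "\<lambda>t r. \<Sum>s\<in>I. B t s * A s r", OF I])
    fix t assume t: "t \<in> I"
    have "x * y * w t = (\<Sum>s\<in>I. of_int (B t s) * (x * w s))"
      using B[OF t] by (simp add: mult.assoc sum_distrib_left mult.left_commute)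
    also have "\<dots> = (\<Sum>s\<in>I. \<Sum>r\<in>I. of_int (B t s * A s r) * w r)"
      using A by (intro sum.cong refl) (simp add: sum_distrib_left mult.assoc)
    also have "\<dots> = (\<Sum>r\<in>I. \<Sum>s\<in>I. of_int (B t s * A s r) * w r)" by (rule sum.swap)
    also have "\<dots> = (\<Sum>r\<in>I. of_int (\<Sum>s\<in>I. B t s * A s r) * w r)"
      by (simp add: sum_distrib_right)
    finally show "x * y * w t = (\<Sum>r\<in>I. of_int (\<Sum>s\<in>I. B t s * A s r) * w r)" .
  qed
qed

lemma algebraic_int_diff: "algebraic_int x \<Longrightarrow> algebraic_int y \<Longrightarrow> algebraic_int (x - y)" for x y :: complex
  using algebraic_int_add[of x "- y"] by simp

lemma rational_algebraic_int_complex: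
  assumes "algebraic_int (of_rat q :: complex)"
  shows "q \<in> \<int>"
proof -
  have "(of_rat q :: complex) \<in> \<int>" using assms by (intro rational_algebraic_int_is_int) auto
  then obtain k where "(of_rat q :: complex) = of_int k" by (auto elim: Ints_cases)
  then have "(of_rat q :: complex) = of_rat (of_int k)" by simp
  then have "q = of_int k" by (simp only: of_rat_eq_iff)
  then show ?thesis by simp
qed

lemma
  assumes "complex_subfield F"
  shows subfield_0: "0 \<in> F" and subfield_1: "1 \<in> F"
    and subfield_diff: "\<And>x y. x \<in> F \<Longrightarrow> y \<in> F \<Longrightarrow> x - y \<in> F"
    and subfield_uminus: "\<And>x. x \<in> F \<Longrightarrow> - x \<in> F"
    and subfield_add: "\<And>x y. x \<in> F \<Longrightarrow> y \<in> F \<Longrightarrow> x + y \<in> F"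
    and subfield_mult: "\<And>x y. x \<in> F \<Longrightarrow> y \<in> F \<Longrightarrow> x * y \<in> F"
    and subfield_inverse: "\<And>x. x \<in> F \<Longrightarrow> inverse x \<in> F"
    and subfield_of_int: "\<And>k. of_int k \<in> F"
    and subfield_of_rat: "\<And>q. of_rat q \<in> F"
proof -
  have d: "x - y \<in> F" and m: "x * y \<in> F" and i: "inverse x \<in> F" if "x \<in> F" "y \<in> F" for x y
    using assms that by (auto simp: complex_subfield_def)
  have one: "1 \<in> F" using assms by (auto simp: complex_subfield_def)
  show "1 \<in> F" by (rule one)
  show 0: "0 \<in> F" using d[OF one one] by simp
  show u: "- x \<in> F" if "x \<in> F" for x using d[OF 0 that] by simp
  show a: "x + y \<in> F" if "x \<in> F" "y \<in> F" for x y using d[OF that(1) u[OF that(2)]] by simp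
  show "x - y \<in> F" "x * y \<in> F" if "x \<in> F" "y \<in> F" for x y using d m that by auto
  show "inverse x \<in> F" if "x \<in> F" for x using i that by auto
  have nat: "of_nat k \<in> F" for k by (induction k) (auto intro: 0 one a)
  show int: "of_int k \<in> F" for k by (cases k rule: int_cases2) (auto intro: nat u)
  show "of_rat q \<in> F" for q
  proof (cases q)
    case (Fract a b)
    then have "(of_rat q :: complex) = of_int a * inverse (of_int b)" by (simp add: of_rat_rat divide_inverse)
    then show ?thesis using m[OF int[of a] i[OF int[of b] int[of b]]] by simp
  qed
qed

lemma rat_adjoin_subset: "complex_subfield F \<Longrightarrow> A \<subseteq> F \<Longrightarrow> rat_adjoin A \<subseteq> F"
  by (auto simp: rat_adjoin_def)

lemma subset_rat_adjoin: "(\<And>F. complex_subfield F \<Longrightarrow> A \<subseteq> F \<Longrightarrow> S \<subseteq> F) \<Longrightarrow> S \<subseteq> rat_adjoin A"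
  by (auto simp: rat_adjoin_def)

lemma embeddingD:
  assumes "complex_subfield K" "\<sigma> \<in> embeddings K"
  shows "\<And>x y. x \<in> K \<Longrightarrow> y \<in> K \<Longrightarrow> \<sigma> (x + y) = \<sigma> x + \<sigma> y"
    and "\<And>x y. x \<in> K \<Longrightarrow> y \<in> K \<Longrightarrow> \<sigma> (x * y) = \<sigma> x * \<sigma> y"
    and "\<sigma> 1 = 1" and "\<sigma> 0 = 0" and "\<And>q. \<sigma> (of_rat q) = of_rat q" and "\<And>k. \<sigma> (of_int k) = of_int k"
proof -
  note K = assms(1)
  show a: "\<sigma> (x + y) = \<sigma> x + \<sigma> y" if "x \<in> K" "y \<in> K" for x y using assms(2) that by (auto simp: embeddings_def)
  show m: "\<sigma> (x * y) = \<sigma> x * \<sigma> y" if "x \<in> K" "y \<in> K" for x y using assms(2) that by (auto simp: embeddings_def)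
  show one: "\<sigma> 1 = 1" using assms(2) by (auto simp: embeddings_def)
  show z: "\<sigma> 0 = 0" using a[OF subfield_0[OF K] subfield_0[OF K]] by simp
  have u: "\<sigma> (- x) = - \<sigma> x" if "x \<in> K" for x
    using a[OF that subfield_uminus[OF K that]] z by (simp add: eq_neg_iff_add_eq_0 add.commute)
  have nat: "\<sigma> (of_nat k) = of_nat k" for k
  proof (induction k)
    case (Suc k)
    have "of_nat k \<in> K" using subfield_of_int[OF K, of "int k"] by simp
    then show ?case using a[OF subfield_1[OF K], of "of_nat k"] Suc one by simp
  qed (simp add: z)
  have natK: "of_nat k \<in> K" for k using subfield_of_int[OF K, of "int k"] by simp
  show int: "\<sigma> (of_int k) = of_int k" for k
    by (cases k rule: int_cases2) (simp_all add: nat u natK)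
  show "\<sigma> (of_rat q) = of_rat q" for q
  proof (cases q)
    case (Fract c b)
    have "of_int b * (of_rat q :: complex) = of_int c" using Fract by (simp add: of_rat_rat)
    then have "of_int b * \<sigma> (of_rat q) = of_int c"
      using m[OF subfield_of_int[OF K] subfield_of_rat[OF K], of b q] int by simp
    then show ?thesis using Fract by (simp add: of_rat_rat field_simps)
  qed
qed

lemma
  assumes "complex_subfield K"
  shows field_trace_add: "x \<in> K \<Longrightarrow> y \<in> K \<Longrightarrow> field_trace K (x + y) = field_trace K x + field_trace K y"
    and field_trace_of_int_mult: "x \<in> K \<Longrightarrow> field_trace K (of_int k * x) = of_int k * field_trace K x"
    and field_trace_of_rat_mult: "x \<in> K \<Longrightarrow> field_trace K (of_rat q * x) = of_rat q * field_trace K x"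
    and field_trace_0: "field_trace K 0 = 0"
proof -
  note e = embeddingD[OF assms]
  show "field_trace K (x + y) = field_trace K x + field_trace K y" if "x \<in> K" "y \<in> K"
    unfolding field_trace_def sum.distrib[symmetric] by (rule sum.cong[OF refl]) (rule e(1)[OF _ that])
  show "field_trace K (of_rat q * x) = of_rat q * field_trace K x" if x: "x \<in> K" for q
    unfolding field_trace_def sum_distrib_left
    by (rule sum.cong[OF refl]) (simp add: e(2)[OF _ subfield_of_rat[OF assms] x] e(5))
  show "field_trace K (of_int k * x) = of_int k * field_trace K x" if x: "x \<in> K"
    unfolding field_trace_def sum_distrib_left
    by (rule sum.cong[OF refl]) (simp add: e(2)[OF _ subfield_of_int[OF assms] x] e(6))
  show "field_trace K 0 = 0"
    unfolding field_trace_def by (rule sum.neutral) (simp add: e(4))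
qed

lemma field_trace_sum:
  assumes "complex_subfield K" "\<And>i. i \<in> I \<Longrightarrow> f i \<in> K"
  shows "(\<Sum>i\<in>I. f i) \<in> K" "field_trace K (\<Sum>i\<in>I. f i) = (\<Sum>i\<in>I. field_trace K (f i))"
proof -
  have "(\<Sum>i\<in>I. f i) \<in> K \<and> field_trace K (\<Sum>i\<in>I. f i) = (\<Sum>i\<in>I. field_trace K (f i))"
    using assms(2)
    by (induction I rule: infinite_finite_induct)
       (auto simp: subfield_0[OF assms(1)] field_trace_0[OF assms(1)] field_trace_add[OF assms(1)] intro: subfield_add[OF assms(1)])
  then show "(\<Sum>i\<in>I. f i) \<in> K" "field_trace K (\<Sum>i\<in>I. f i) = (\<Sum>i\<in>I. field_trace K (f i))" by auto
qed

section \<open>Independence of the discriminant from the integral basis\<close>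

definition trace_gram :: "complex set \<Rightarrow> complex list \<Rightarrow> complex Matrix.mat" where
  "trace_gram K ws = Matrix.mat (length ws) (length ws) (\<lambda>(i, j). field_trace K (ws ! i * ws ! j))"

text \<open>Bilinearity of the trace form turns the Gram matrix \<open>G\<close> into
  \<open>M * G * M^T\<close>. Coefficients are rational, so that the lemma covers both a change of
  integral basis and the passage from \<open>1, r1, r2, r3\<close> to an integral basis.\<close>

lemma det_trace_gram_change_basis:
  assumes K: "complex_subfield K" and ws: "set ws \<subseteq> K" "length ws = n" "length ws' = n"
    and A: "\<And>i. i < n \<Longrightarrow> ws' ! i = (\<Sum>k<n. of_rat (A i k) * ws ! k)"
  shows "Determinant.det (trace_gram K ws') =
    (of_rat (Determinant.det (Matrix.mat n n (\<lambda>(i, k). A i k))))\<^sup>2 * Determinant.det (trace_gram K ws)"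
proof -
  define M where "M = Matrix.mat n n (\<lambda>(i, k). of_rat (A i k) :: complex)"
  have M: "M \<in> carrier_mat n n" by (simp add: M_def)
  define G where "G = trace_gram K ws"
  have G: "G \<in> carrier_mat n n" using ws by (simp add: G_def trace_gram_def)
  have wK: "ws ! k \<in> K" if "k < n" for k using ws that by (metis nth_mem subsetD)
  have "trace_gram K ws' = M * (G * transpose_mat M)"
  proof (rule eq_matI)
    show "dim_row (trace_gram K ws') = dim_row (M * (G * transpose_mat M))"
      "dim_col (trace_gram K ws') = dim_col (M * (G * transpose_mat M))"
      using ws by (simp_all add: trace_gram_def M_def G_def)
    fix i j assume "i < dim_row (M * (G * transpose_mat M))" "j < dim_col (M * (G * transpose_mat M))"
    then have ij: "i < n" "j < n" by (simp_all add: M_def)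
    have m: "of_rat (A i k) * (of_rat (A j l) * (ws ! k * ws ! l)) \<in> K" if "k < n" "l < n" for k l
      using that by (intro subfield_mult[OF K] subfield_of_rat[OF K] wK)
    have "trace_gram K ws' $$ (i, j) = field_trace K (ws' ! i * ws' ! j)" using ij ws by (simp add: trace_gram_def)
    also have "ws' ! i * ws' ! j = (\<Sum>k<n. \<Sum>l<n. of_rat (A i k) * (of_rat (A j l) * (ws ! k * ws ! l)))"
      unfolding A[OF ij(1)] A[OF ij(2)] sum_product by (intro sum.cong refl) (simp add: mult_ac)
    also have "field_trace K \<dots> = (\<Sum>k<n. \<Sum>l<n. field_trace K (of_rat (A i k) * (of_rat (A j l) * (ws ! k * ws ! l))))"
    proof -
      have inner: "(\<Sum>l<n. of_rat (A i k) * (of_rat (A j l) * (ws ! k * ws ! l))) \<in> K" if "k < n" for k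
        by (rule field_trace_sum(1)[OF K]) (use m that in auto)
      have "field_trace K (\<Sum>k<n. \<Sum>l<n. of_rat (A i k) * (of_rat (A j l) * (ws ! k * ws ! l))) =
        (\<Sum>k<n. field_trace K (\<Sum>l<n. of_rat (A i k) * (of_rat (A j l) * (ws ! k * ws ! l))))"
        by (rule field_trace_sum(2)[OF K]) (use inner in auto)
      also have "\<dots> = (\<Sum>k<n. \<Sum>l<n. field_trace K (of_rat (A i k) * (of_rat (A j l) * (ws ! k * ws ! l))))"
        by (rule sum.cong[OF refl], rule field_trace_sum(2)[OF K]) (use m in auto)
      finally show ?thesis .
    qed
    also have "\<dots> = (\<Sum>k<n. \<Sum>l<n. of_rat (A i k) * (of_rat (A j l) * field_trace K (ws ! k * ws ! l)))"
      using wK by (intro sum.cong refl) (simp add: field_trace_of_rat_mult[OF K] subfield_mult[OF K] subfield_of_rat[OF K])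
    also have "\<dots> = (M * (G * transpose_mat M)) $$ (i, j)"
      using ij ws by (simp add: M_def G_def trace_gram_def scalar_prod_def sum_distrib_left mult_ac lessThan_atLeast0)
    finally show "trace_gram K ws' $$ (i, j) = (M * (G * transpose_mat M)) $$ (i, j)" .
  qed
  moreover have "Determinant.det (M * (G * transpose_mat M)) = Determinant.det M * (Determinant.det G * Determinant.det M)"
    using M G by (simp add: det_mult[OF M] det_mult[OF G] Determinant.det_transpose[OF M])
  moreover have "M = of_rat_hom.mat_hom (Matrix.mat n n (\<lambda>(i, k). A i k))"
    by (rule eq_matI) (simp_all add: M_def)
  then have "Determinant.det M = of_rat (Determinant.det (Matrix.mat n n (\<lambda>(i, k). A i k)))"
    by (simp only: of_rat_hom.hom_det)
  ultimately show ?thesis by (simp add: G_def power2_eq_square mult_ac)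
qed

text \<open>\<open>integral_basis\<close> states uniqueness for integer lists; the transition
  matrices below need it for coefficient functions.\<close>

lemma integral_basis_coeffs_unique:
  assumes "integral_basis K ws" "x \<in> ring_of_integers K"
    and "x = (\<Sum>i<length ws. of_int (c i) * ws ! i)" "x = (\<Sum>i<length ws. of_int (d i) * ws ! i)"
    and "i < length ws"
  shows "c i = (d i :: int)"
proof -
  have "\<exists>!cs. length cs = length ws \<and> x = (\<Sum>i<length ws. of_int (cs ! i) * ws ! i)"
    using assms unfolding integral_basis_def by blast
  moreover have "length (map c [0..<length ws]) = length ws \<and> x = (\<Sum>i<length ws. of_int (map c [0..<length ws] ! i) * ws ! i)"
    using assms(3) by simp
  moreover have "length (map d [0..<length ws]) = length ws \<and> x = (\<Sum>i<length ws. of_int (map d [0..<length ws] ! i) * ws ! i)"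
    using assms(4) by simp
  ultimately have "map c [0..<length ws] = map d [0..<length ws]" by blast
  then have "map c [0..<length ws] ! i = map d [0..<length ws] ! i" by (rule arg_cong)
  then show ?thesis using assms(5) by simp
qed

lemma integral_basis_transition:
  assumes "integral_basis K ws" "integral_basis K ws'"
  shows "\<exists>A. \<forall>i<length ws'. ws' ! i = (\<Sum>j<length ws. of_int (A i j) * ws ! j)"
proof -
  have "\<exists>cs :: int list. ws' ! i = (\<Sum>j<length ws. of_int (cs ! j) * ws ! j)" if "i < length ws'" for i
  proof -
    have "ws' ! i \<in> ring_of_integers K" using assms(2) that unfolding integral_basis_def by (meson nth_mem subsetD)
    then show ?thesis using assms(1) unfolding integral_basis_def by blast
  qed
  then obtain f :: "nat \<Rightarrow> int list" where "\<And>i. i < length ws' \<Longrightarrow> ws' ! i = (\<Sum>j<length ws. of_int (f i ! j) * ws ! j)"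
    by metis
  then show ?thesis by (intro exI[of _ "\<lambda>i j. f i ! j"]) simp
qed

lemma integral_basis_transition_inverse:
  assumes "integral_basis K ws'"
    and A: "\<And>i. i < length ws' \<Longrightarrow> ws' ! i = (\<Sum>j<length ws. of_int (A i j) * ws ! j)"
    and B: "\<And>i. i < length ws \<Longrightarrow> ws ! i = (\<Sum>j<length ws'. of_int (B i j) * ws' ! j)"
    and "i < length ws'" "k < length ws'"
  shows "(\<Sum>j<length ws. A i j * B j k) = (if i = k then 1 else 0 :: int)"
proof (rule integral_basis_coeffs_unique[OF assms(1) _ _ _ assms(5), where x = "ws' ! i"])
  show "ws' ! i \<in> ring_of_integers K" using assms(1,4) unfolding integral_basis_def by (meson nth_mem subsetD)
  have "ws' ! i = (\<Sum>j<length ws. of_int (A i j) * (\<Sum>k<length ws'. of_int (B j k) * ws' ! k))"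
    unfolding A[OF assms(4)] by (intro sum.cong refl) (use B in simp)
  also have "\<dots> = (\<Sum>j<length ws. \<Sum>k<length ws'. of_int (A i j * B j k) * ws' ! k)"
    by (simp add: sum_distrib_left mult.assoc)
  also have "\<dots> = (\<Sum>k<length ws'. \<Sum>j<length ws. of_int (A i j * B j k) * ws' ! k)" by (rule sum.swap)
  also have "\<dots> = (\<Sum>k<length ws'. of_int (\<Sum>j<length ws. A i j * B j k) * ws' ! k)"
    by (simp add: sum_distrib_right)
  finally show "ws' ! i = (\<Sum>k<length ws'. of_int (\<Sum>j<length ws. A i j * B j k) * ws' ! k)" .
  have "(\<Sum>k<length ws'. of_int (if i = k then 1 else 0) * ws' ! k) = (\<Sum>k<length ws'. if i = k then ws' ! k else 0)"
    by (intro sum.cong refl) simp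
  then show "ws' ! i = (\<Sum>k<length ws'. of_int (if i = k then 1 else 0) * ws' ! k)" using assms(4) by simp
qed

text \<open>The two transition matrices are inverse to each other over the integers, so their
  determinants are 1 or -1, and only the square enters.\<close>

lemma det_trace_gram_integral_basis:
  assumes K: "complex_subfield K" and ws: "integral_basis K ws" "integral_basis K ws'"
  shows "Determinant.det (trace_gram K ws) = Determinant.det (trace_gram K ws')"
proof -
  obtain A where A: "\<And>i. i < length ws' \<Longrightarrow> ws' ! i = (\<Sum>j<length ws. of_int (A i j) * ws ! j)"
    using integral_basis_transition[OF ws] by blast
  obtain B where B: "\<And>i. i < length ws \<Longrightarrow> ws ! i = (\<Sum>j<length ws'. of_int (B i j) * ws' ! j)"
    using integral_basis_transition[OF ws(2,1)] by blast
  note AB = integral_basis_transition_inverse[OF ws(2) A B]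
  note BA = integral_basis_transition_inverse[OF ws(1) B A]
  \<comment> \<open>Before the matrices are known to be square, equality of the lengths follows by
    comparing the traces of \<open>A B\<close> and \<open>B A\<close>, which are identity matrices
    of the two sizes.\<close>
  have "int (length ws') = (\<Sum>i<length ws'. \<Sum>j<length ws. A i j * B j i)" using AB by simp
  also have "\<dots> = (\<Sum>j<length ws. \<Sum>i<length ws'. A i j * B j i)" by (rule sum.swap)
  also have "\<dots> = (\<Sum>j<length ws. \<Sum>i<length ws'. B j i * A i j)" by (simp add: mult.commute)
  also have "\<dots> = int (length ws)" using BA by simp
  finally have len: "length ws' = length ws" by simp
  define n where "n = length ws"
  define MA where "MA = Matrix.mat n n (\<lambda>(i, j). A i j)"
  define MB where "MB = Matrix.mat n n (\<lambda>(i, j). B i j)"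
  have "MA * MB = 1\<^sub>m n"
    by (rule eq_matI) (use AB len in \<open>simp_all add: MA_def MB_def n_def scalar_prod_def lessThan_atLeast0\<close>)
  then have "Determinant.det MA * Determinant.det MB = 1"
    using det_mult[of MA n MB] by (simp add: MA_def MB_def)
  then have d: "(Determinant.det MA)\<^sup>2 = 1"
    by (metis dvd_triv_left power2_eq_1_iff zdvd1_eq abs_1 abs_eq_iff)
  have dA: "Determinant.det (Matrix.mat n n (\<lambda>(i, k). of_int (A i k))) = (of_int (Determinant.det MA) :: rat)"
  proof -
    have "Matrix.mat n n (\<lambda>(i, k). of_int (A i k)) = (of_int_hom.mat_hom MA :: rat Matrix.mat)"
      by (rule eq_matI) (simp_all add: MA_def)
    then show ?thesis by (simp only: of_int_hom.hom_det)
  qed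
  have "set ws \<subseteq> K" using ws(1) by (auto simp: integral_basis_def ring_of_integers_def)
  from det_trace_gram_change_basis[OF K this n_def[symmetric] len[folded n_def], of "\<lambda>i k. of_int (A i k)"]
  have "Determinant.det (trace_gram K ws') =
    (of_rat (Determinant.det (Matrix.mat n n (\<lambda>(i, k). of_int (A i k)))))\<^sup>2 * Determinant.det (trace_gram K ws)"
    using A len by (simp add: n_def)
  also have "(of_rat (Determinant.det (Matrix.mat n n (\<lambda>(i, k). of_int (A i k)))))\<^sup>2 = (1 :: complex)"
    unfolding dA using d by (metis of_int_1 of_int_power of_rat_of_int_eq)
  finally show ?thesis by simp
qed

text \<open>Independence of the basis makes the definite description in \<open>discriminant\<close>
  well defined.\<close>

lemma discriminant_eqI:
  assumes "complex_subfield K" "integral_basis K ws"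
    and "Determinant.det (trace_gram K ws) = of_int d"
  shows "discriminant K = d"
  unfolding discriminant_def
proof (rule the_equality)
  show "\<exists>ws. integral_basis K ws \<and> of_int d = Determinant.det (Matrix.mat (length ws) (length ws) (\<lambda>(i, j). field_trace K (ws ! i * ws ! j)))"
    using assms(2,3) by (intro exI[of _ ws]) (simp add: trace_gram_def)
  fix d' assume "\<exists>ws. integral_basis K ws \<and> of_int d' = Determinant.det (Matrix.mat (length ws) (length ws) (\<lambda>(i, j). field_trace K (ws ! i * ws ! j)))"
  then obtain ws' where "integral_basis K ws'" "of_int d' = Determinant.det (trace_gram K ws')"
    unfolding trace_gram_def by blast
  then have "of_int d' = (of_int d :: complex)"
    using det_trace_gram_integral_basis[OF assms(1,2)] assms(3) by simp
  then show "d' = d" by simp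
qed

section \<open>Real biquadratic fields\<close>

text \<open>A nonzero solution would make \<open>p / q\<close> a rational square root of
  \<open>k\<close>, hence an algebraic integer, hence an integer \<open>n\<close> with
  \<open>n^2 = k\<close>; squarefreeness then forces \<open>k = 1\<close>.\<close>

lemma rat_square_eq_squarefree_mult_square:
  fixes p q :: rat and k :: int
  assumes "squarefree k" "k > 0" "k \<noteq> 1" "p\<^sup>2 = q\<^sup>2 * of_int k"
  shows "p = 0 \<and> q = 0"
proof (rule ccontr)
  assume "\<not> (p = 0 \<and> q = 0)"
  then have q: "q \<noteq> 0" using assms(4) by auto
  define t where "t = p / q"
  have t2: "t\<^sup>2 = of_int k" using assms(4) q by (simp add: t_def power_divide)
  have "(of_rat t :: complex)\<^sup>2 = of_rat (t\<^sup>2)" by (simp only: of_rat_power)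
  also have "\<dots> = of_int k" unfolding t2 by simp
  finally have tk: "poly (monom 1 2) (of_rat t :: complex) = of_int k" by (simp add: poly_monom)
  have "algebraic_int (of_rat t :: complex)"
    by (rule algebraic_int_root[OF algebraic_int_of_int tk]) (simp_all add: degree_monom_eq)
  then have "t \<in> \<int>" by (rule rational_algebraic_int_complex)
  then obtain n where n: "t = of_int n" by (rule Ints_cases)
  have "of_int (n\<^sup>2) = (of_int k :: rat)" using t2 unfolding n by simp
  then have nk: "n\<^sup>2 = k" by (simp only: of_int_eq_iff)
  then have "n dvd 1" using squarefreeD[OF assms(1), of n] by simp
  then have "\<bar>n\<bar> = 1" by simp
  then have "n\<^sup>2 = 1" by (simp add: abs_square_eq_1)
  then show False using assms(3) nk by simp
qed

text \<open>In lowest terms \<open>a / b\<close> the square of \<open>b\<close> divides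
  \<open>k\<close>, so \<open>b\<close> is a unit.\<close>

lemma rat_in_Ints_of_square_mult_squarefree:
  fixes t :: rat and k :: int
  assumes "squarefree k" "t\<^sup>2 * of_int k \<in> \<int>"
  shows "t \<in> \<int>"
proof -
  obtain a b where ab: "t = Rat.Fract a b" "b > 0" "coprime a b" by (rule Rat_cases)
  have t: "t = of_int a / of_int b" using ab by (simp add: Rat.Fract_of_int_quotient)
  obtain n where n: "t\<^sup>2 * of_int k = of_int n" using assms(2) by (auto elim: Ints_cases)
  have "(of_int (a\<^sup>2 * k) :: rat) = of_int (n * b\<^sup>2)"
    using n ab(2) by (simp add: t field_simps)
  then have "a\<^sup>2 * k = n * b\<^sup>2" by (simp only: of_int_eq_iff)
  then have "b\<^sup>2 dvd a\<^sup>2 * k" by simp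
  moreover have "coprime (b\<^sup>2) (a\<^sup>2)" using ab(3) by (simp add: coprime_commute)
  ultimately have "b\<^sup>2 dvd k" by (simp add: coprime_dvd_mult_right_iff)
  then have "b dvd 1" by (rule squarefreeD[OF assms(1)])
  then have "b = 1" using ab(2) by simp
  then show ?thesis using t by simp
qed

interpretation ratc: vector_space "\<lambda>(q :: rat) (x :: complex). of_rat q * x"
  by unfold_locales (simp_all add: algebra_simps of_rat_add of_rat_mult)

lemma field_degree_eq_dim: "field_degree K = ratc.dim K"
  by (simp add: field_degree_def)

text \<open>The real root as a complex number, so that multiplicativity is inherited from
  \<open>sqrt\<close>; it agrees with \<open>csqrt\<close> on nonnegative integers.\<close>

definition csq :: "int \<Rightarrow> complex" where "csq k = of_real (sqrt (of_int k))"

lemma csqrt_of_int: "k \<ge> 0 \<Longrightarrow> csqrt (of_int k) = csq k"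
  using csqrt_of_real_nonneg[of "of_int k"] by (simp add: csq_def)

lemma csq_mult_self: "k \<ge> 0 \<Longrightarrow> csq k * csq k = of_int k"
  by (simp add: csq_def flip: of_real_mult)

lemma csq_mult:
  assumes "a \<ge> 0" "b \<ge> 0" "c \<ge> 0"
  shows "csq (a * b) * csq (a * c) = of_int a * csq (b * c)"
proof -
  have "sqrt (of_int (a * b)) * sqrt (of_int (a * c)) = sqrt ((of_int a)\<^sup>2 * of_int (b * c))"
    by (simp add: real_sqrt_mult[symmetric] power2_eq_square mult_ac)
  also have "\<dots> = of_int a * sqrt (of_int (b * c))" using assms by (simp add: real_sqrt_mult)
  finally show ?thesis unfolding csq_def by (metis of_real_mult of_real_of_int_eq)
qed

lemma csq_lin_indep:
  assumes "squarefree k" "k > 0" "k \<noteq> 1" "of_rat p + of_rat q * csq k = 0"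
  shows "p = 0" "q = 0"
proof -
  have "of_rat p = - (of_rat q * csq k)" using assms(4) by (simp add: eq_neg_iff_add_eq_0)
  then have "(of_rat p)\<^sup>2 = (of_rat q)\<^sup>2 * (csq k * csq k)" by (simp add: power2_eq_square mult_ac)
  also have "csq k * csq k = of_rat (of_int k)" using assms by (simp add: csq_mult_self)
  finally have "(of_rat (p\<^sup>2) :: complex) = of_rat (q\<^sup>2 * of_int k)" by (simp add: of_rat_power of_rat_mult)
  then have "p\<^sup>2 = q\<^sup>2 * of_int k" by (simp only: of_rat_eq_iff)
  then show "p = 0" "q = 0" using rat_square_eq_squarefree_mult_square assms by blast+
qed

lemma biquadratic_mult_identity:
  fixes r1 r2 r3 G U V :: complex
  assumes "r1 * r1 = G * U" "r2 * r2 = G * V" "r3 * r3 = U * V" "r1 * r2 = G * r3" "r1 * r3 = U * r2" "r2 * r3 = V * r1"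
  shows "(p + q * r1 + r * r2 + s * r3) * (p' + q' * r1 + r' * r2 + s' * r3) =
    (p * p' + q * q' * (G * U) + r * r' * (G * V) + s * s' * (U * V)) + (p * q' + q * p' + (r * s' + s * r') * V) * r1
    + (p * r' + r * p' + (q * s' + s * q') * U) * r2 + (p * s' + s * p' + (q * r' + r * q') * G) * r3"
proof -
  have "(p + q * r1 + r * r2 + s * r3) * (p' + q' * r1 + r' * r2 + s' * r3) =
    p * p' + q * q' * (r1 * r1) + r * r' * (r2 * r2) + s * s' * (r3 * r3)
    + (q * r' + r * q') * (r1 * r2) + (q * s' + s * q') * (r1 * r3) + (r * s' + s * r') * (r2 * r3)
    + (p * q' + q * p') * r1 + (p * r' + r * p') * r2 + (p * s' + s * p') * r3"
    by (simp only: distrib_left distrib_right add_ac mult_ac)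
  then show ?thesis unfolding assms by (simp only: distrib_left distrib_right add_ac mult_ac)
qed

text \<open>Squarefreeness of the product contains pairwise coprimality; the three inequalities keep
  each quadratic subfield from collapsing to the rationals.\<close>

locale biquadratic =
  fixes g u v :: int
  assumes pos: "g > 0" "u > 0" "v > 0"
    and sqf: "squarefree (g * u * v)"
    and nontriv: "g * u \<noteq> 1" "g * v \<noteq> 1" "u * v \<noteq> 1"
begin

abbreviation "r1 \<equiv> csq (g * u)"
abbreviation "r2 \<equiv> csq (g * v)"
abbreviation "r3 \<equiv> csq (u * v)"

definition elt :: "rat \<Rightarrow> rat \<Rightarrow> rat \<Rightarrow> rat \<Rightarrow> complex" where
  "elt p q r s = of_rat p + of_rat q * r1 + of_rat r * r2 + of_rat s * r3"

definition K :: "complex set" where "K = {elt p q r s | p q r s. True}"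

lemma KE: assumes "x \<in> K" obtains p q r s where "x = elt p q r s"
  using assms by (auto simp: K_def)

lemma elt_in_K [simp, intro]: "elt p q r s \<in> K" by (auto simp: K_def)

lemma squarefree_products: "squarefree (g * u)" "squarefree (g * v)" "squarefree (u * v)"
  using sqf by (auto elim!: squarefree_mono[rotated] intro!: dvdI simp: mult_ac)

lemma products_pos: "g * u > 0" "g * v > 0" "u * v > 0" using pos by auto

lemma r_mult:
  "r1 * r1 = of_int g * of_int u" "r2 * r2 = of_int g * of_int v" "r3 * r3 = of_int u * of_int v"
  "r1 * r2 = of_int g * r3" "r1 * r3 = of_int u * r2" "r2 * r3 = of_int v * r1"
  using csq_mult_self[of "g * u"] csq_mult_self[of "g * v"] csq_mult_self[of "u * v"]
    csq_mult[of g u v] csq_mult[of u g v] csq_mult[of v g u] pos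
  by (simp_all add: mult.commute)

lemma elt_mult: "elt p q r s * elt p' q' r' s' =
   elt (p * p' + q * q' * of_int (g * u) + r * r' * of_int (g * v) + s * s' * of_int (u * v))
       (p * q' + q * p' + (r * s' + s * r') * of_int v)
       (p * r' + r * p' + (q * s' + s * q') * of_int u)
       (p * s' + s * p' + (q * r' + r * q') * of_int g)"
  using biquadratic_mult_identity[OF r_mult, of "of_rat p" "of_rat q" "of_rat r" "of_rat s" "of_rat p'" "of_rat q'" "of_rat r'" "of_rat s'"]
  by (simp add: elt_def of_rat_add of_rat_mult)

lemma elt_add: "elt p q r s + elt p' q' r' s' = elt (p + p') (q + q') (r + r') (s + s')"
  by (simp add: elt_def of_rat_add algebra_simps)

lemma elt_diff: "elt p q r s - elt p' q' r' s' = elt (p - p') (q - q') (r - r') (s - s')"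
  by (simp add: elt_def of_rat_diff algebra_simps)

lemma elt_of_rat: "elt q 0 0 0 = of_rat q" by (simp add: elt_def)

lemma elt_rs: "elt 0 1 0 0 = r1" "elt 0 0 1 0 = r2" "elt 0 0 0 1 = r3" "elt 0 0 0 0 = 0" "elt 1 0 0 0 = 1"
  by (simp_all add: elt_def)

lemma elt_cong: "p = p' \<Longrightarrow> q = q' \<Longrightarrow> r = r' \<Longrightarrow> s = s' \<Longrightarrow> elt p q r s = elt p' q' r' s'"
  by simp

text \<open>Each of the three ways of splitting the relation into two pairs is squared: the
  difference lies in a quadratic field, so its rational part vanishes. The three equations together
  give \<open>p^2 = q^2 gu = r^2 gv = s^2 uv\<close>, and none of these products is a
  square.\<close>

lemma elt_eq_0:
  assumes "elt p q r s = 0"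
  shows "p = 0 \<and> q = 0 \<and> r = 0 \<and> s = 0"
proof -
  have e1: "p\<^sup>2 + q\<^sup>2 * of_int (g * u) - r\<^sup>2 * of_int (g * v) - s\<^sup>2 * of_int (u * v) = 0"
  proof -
    have "elt p q 0 0 + elt 0 0 r s = 0" using assms by (simp add: elt_add)
    then have "elt p q 0 0 = - elt 0 0 r s" by (simp only: eq_neg_iff_add_eq_0)
    then have "elt p q 0 0 * elt p q 0 0 - elt 0 0 r s * elt 0 0 r s = 0" by simp
    also have "elt p q 0 0 * elt p q 0 0 - elt 0 0 r s * elt 0 0 r s = elt (p\<^sup>2 + q\<^sup>2 * of_int (g * u) - r\<^sup>2 * of_int (g * v) - s\<^sup>2 * of_int (u * v)) (2 * p * q - 2 * r * s * of_int v) (0) (0)"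
      unfolding elt_mult elt_diff by (rule elt_cong) (simp_all add: power2_eq_square algebra_simps)
    finally have "of_rat (p\<^sup>2 + q\<^sup>2 * of_int (g * u) - r\<^sup>2 * of_int (g * v) - s\<^sup>2 * of_int (u * v)) + of_rat (2 * p * q - 2 * r * s * of_int v) * r1 = 0" by (simp add: elt_def)
    then show ?thesis by (rule csq_lin_indep(1)[OF squarefree_products(1) products_pos(1) nontriv(1)])
  qed
  have e2: "p\<^sup>2 + r\<^sup>2 * of_int (g * v) - q\<^sup>2 * of_int (g * u) - s\<^sup>2 * of_int (u * v) = 0"
  proof -
    have "elt p 0 r 0 + elt 0 q 0 s = 0" using assms by (simp add: elt_add)
    then have "elt p 0 r 0 = - elt 0 q 0 s" by (simp only: eq_neg_iff_add_eq_0)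
    then have "elt p 0 r 0 * elt p 0 r 0 - elt 0 q 0 s * elt 0 q 0 s = 0" by simp
    also have "elt p 0 r 0 * elt p 0 r 0 - elt 0 q 0 s * elt 0 q 0 s = elt (p\<^sup>2 + r\<^sup>2 * of_int (g * v) - q\<^sup>2 * of_int (g * u) - s\<^sup>2 * of_int (u * v)) (0) (2 * p * r - 2 * q * s * of_int u) (0)"
      unfolding elt_mult elt_diff by (rule elt_cong) (simp_all add: power2_eq_square algebra_simps)
    finally have "of_rat (p\<^sup>2 + r\<^sup>2 * of_int (g * v) - q\<^sup>2 * of_int (g * u) - s\<^sup>2 * of_int (u * v)) + of_rat (2 * p * r - 2 * q * s * of_int u) * r2 = 0" by (simp add: elt_def)
    then show ?thesis by (rule csq_lin_indep(1)[OF squarefree_products(2) products_pos(2) nontriv(2)])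
  qed
  have e3: "p\<^sup>2 + s\<^sup>2 * of_int (u * v) - q\<^sup>2 * of_int (g * u) - r\<^sup>2 * of_int (g * v) = 0"
  proof -
    have "elt p 0 0 s + elt 0 q r 0 = 0" using assms by (simp add: elt_add)
    then have "elt p 0 0 s = - elt 0 q r 0" by (simp only: eq_neg_iff_add_eq_0)
    then have "elt p 0 0 s * elt p 0 0 s - elt 0 q r 0 * elt 0 q r 0 = 0" by simp
    also have "elt p 0 0 s * elt p 0 0 s - elt 0 q r 0 * elt 0 q r 0 = elt (p\<^sup>2 + s\<^sup>2 * of_int (u * v) - q\<^sup>2 * of_int (g * u) - r\<^sup>2 * of_int (g * v)) (0) (0) (2 * p * s - 2 * q * r * of_int g)"
      unfolding elt_mult elt_diff by (rule elt_cong) (simp_all add: power2_eq_square algebra_simps)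
    finally have "of_rat (p\<^sup>2 + s\<^sup>2 * of_int (u * v) - q\<^sup>2 * of_int (g * u) - r\<^sup>2 * of_int (g * v)) + of_rat (2 * p * s - 2 * q * r * of_int g) * r3 = 0" by (simp add: elt_def)
    then show ?thesis by (rule csq_lin_indep(1)[OF squarefree_products(3) products_pos(3) nontriv(3)])
  qed
  have e12: "p\<^sup>2 = s\<^sup>2 * of_int (u * v)" using e1 e2 by linarith
  have e13: "p\<^sup>2 = r\<^sup>2 * of_int (g * v)" using e1 e3 by linarith
  have e23: "p\<^sup>2 = q\<^sup>2 * of_int (g * u)" using e2 e3 by linarith
  show ?thesis
    using rat_square_eq_squarefree_mult_square[OF squarefree_products(1) products_pos(1) nontriv(1) e23]
      rat_square_eq_squarefree_mult_square[OF squarefree_products(2) products_pos(2) nontriv(2) e13]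
      rat_square_eq_squarefree_mult_square[OF squarefree_products(3) products_pos(3) nontriv(3) e12] by blast
qed

lemma elt_eq_iff: "elt p q r s = elt p' q' r' s' \<longleftrightarrow> p = p' \<and> q = q' \<and> r = r' \<and> s = s'"
  using elt_eq_0[of "p - p'" "q - q'" "r - r'" "s - s'"] by (auto simp: elt_diff[symmetric])

lemma subfield_K: "complex_subfield K"
  unfolding complex_subfield_def
proof (intro conjI ballI)
  show "1 \<in> K" using elt_in_K[of 1 0 0 0] by (simp add: elt_of_rat)
  show "x - y \<in> K" "x * y \<in> K" if "x \<in> K" "y \<in> K" for x y
    using that by (auto elim!: KE simp: elt_diff elt_mult)
  fix x assume "x \<in> K"
  then obtain p q r s where x: "x = elt p q r s" by (rule KE)
  show "inverse x \<in> K"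
  proof (cases "x = 0")
    case True then show ?thesis using elt_in_K[of 0 0 0 0] by (simp add: elt_of_rat)
  next
    case False
    \<comment> \<open>Inversion by norms in two stages: \<open>x * y = A + B r1\<close> is the norm
      to the field of \<open>r1\<close>, and multiplication by the conjugate \<open>A - B r1\<close>
      gives the rational number \<open>N\<close>.\<close>
    define y where "y = elt p q (- r) (- s)"
    define A where "A = p * p + q * q * of_int (g * u) - r * r * of_int (g * v) - s * s * of_int (u * v)"
    define B where "B = 2 * p * q - 2 * r * s * of_int v"
    have xy: "x * y = elt A B 0 0" unfolding x y_def elt_mult by (simp add: A_def B_def algebra_simps)
    define N where "N = A * A - B * B * of_int (g * u)"
    have AB: "elt A B 0 0 * elt A (- B) 0 0 = of_rat N"
      unfolding elt_mult elt_of_rat[symmetric] by (simp add: N_def algebra_simps)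
    have "\<not> (p = 0 \<and> q = 0 \<and> r = 0 \<and> s = 0)" using False x by (auto simp: elt_rs)
    then have "y \<noteq> 0" using elt_eq_0[of p q "- r" "- s"] by (auto simp: y_def)
    then have "elt A B 0 0 \<noteq> 0" using xy False by (metis mult_eq_0_iff)
    then have "elt A (- B) 0 0 \<noteq> 0" using elt_eq_0[of A "- B" 0 0] by (auto simp: elt_rs)
    with \<open>elt A B 0 0 \<noteq> 0\<close> have "(of_rat N :: complex) \<noteq> 0" using AB by (metis mult_eq_0_iff)
    have "x * (y * elt A (- B) 0 0 * of_rat (inverse N)) = x * y * elt A (- B) 0 0 * of_rat (inverse N)"
      by (simp only: mult.assoc)
    also have "\<dots> = of_rat (N * inverse N)" unfolding xy AB by (simp only: of_rat_mult)
    also have "N * inverse N = 1" using \<open>(of_rat N :: complex) \<noteq> 0\<close> by simp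
    finally have "inverse x = y * elt A (- B) 0 0 * of_rat (inverse N)"
      by (intro inverse_unique) simp
    also have "of_rat (inverse N) = elt (inverse N) 0 0 0" by (simp add: elt_of_rat)
    also have "y * elt A (- B) 0 0 * \<dots> \<in> K" unfolding y_def by (simp add: elt_mult)
    finally show ?thesis .
  qed
qed

lemma rat_adjoin_eq_K: "rat_adjoin {r1, r2} = K"
proof
  show "rat_adjoin {r1, r2} \<subseteq> K"
    by (rule rat_adjoin_subset[OF subfield_K]) (auto simp flip: elt_rs)
  show "K \<subseteq> rat_adjoin {r1, r2}"
  proof (rule subset_rat_adjoin)
    fix F assume F: "complex_subfield F" "{r1, r2} \<subseteq> F"
    have "r1 * r2 * inverse (of_int g) \<in> F"
      using F by (intro subfield_mult[OF F(1)] subfield_inverse[OF F(1)] subfield_of_int[OF F(1)]) auto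
    also have "r1 * r2 * inverse (of_int g) = r3" unfolding r_mult(4) using pos by (simp add: field_simps)
    finally have "r3 \<in> F" .
    then show "K \<subseteq> F"
      using F unfolding K_def elt_def
      by (auto intro!: subfield_add[OF F(1)] subfield_mult[OF F(1)] subfield_of_rat[OF F(1)])
  qed
qed

lemma field_degree_K: "field_degree K = 4"
proof -
  let ?B = "{1, r1, r2, r3}"
  have ne: "1 \<noteq> r1" "1 \<noteq> r2" "1 \<noteq> r3" "r1 \<noteq> r2" "r1 \<noteq> r3" "r2 \<noteq> r3"
    unfolding elt_rs[symmetric] elt_eq_iff by auto
  have sum: "(\<Sum>x\<in>?B. of_rat (f x) * x) = elt (f 1) (f r1) (f r2) (f r3)" for f
    using ne by (simp add: elt_def add.assoc)
  have "ratc.dim K = 4"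
  proof (rule ratc.dim_unique)
    show "?B \<subseteq> K" by (auto simp flip: elt_rs)
    show "K \<subseteq> ratc.span ?B"
    proof
      fix x assume "x \<in> K"
      then obtain p q r s where "x = elt p q r s" by (rule KE)
      then have x: "x = of_rat p * 1 + of_rat q * r1 + of_rat r * r2 + of_rat s * r3" by (simp add: elt_def)
      show "x \<in> ratc.span ?B" unfolding x
        by (intro ratc.span_add ratc.span_scale ratc.span_base) auto
    qed
    show "ratc.independent ?B"
    proof (rule ratc.independent_if_scalars_zero)
      fix f x assume "(\<Sum>x\<in>?B. of_rat (f x) * x) = 0" "x \<in> ?B"
      then show "f x = 0" using elt_eq_0 unfolding sum by auto
    qed simp
    show "card ?B = 4" using ne by simp
  qed
  then show ?thesis by (simp add: field_degree_eq_dim)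
qed

text \<open>For signs \<open>e\<close> and \<open>f\<close>, the automorphism that multiplies
  \<open>r1\<close> by \<open>e\<close> and \<open>r2\<close> by \<open>f\<close>, hence
  \<open>r3\<close> by \<open>e * f\<close>. The value \<open>undefined\<close> off \<open>K\<close>
  is what membership in \<open>extensional K\<close> demands.\<close>

definition conj :: "rat \<Rightarrow> rat \<Rightarrow> complex \<Rightarrow> complex" where
  "conj e f x = (if x \<in> K then (THE y. \<exists>p q r s. x = elt p q r s \<and> y = elt p (e * q) (f * r) (e * f * s)) else undefined)"

lemma conj_elt: "conj e f (elt p q r s) = elt p (e * q) (f * r) (e * f * s)"
  unfolding conj_def by (auto simp: elt_eq_iff)

lemma conj_embedding:
  assumes "e \<in> {1, - 1}" "f \<in> {1, - 1}"
  shows "conj e f \<in> embeddings K"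
proof -
  have "conj e f (elt p q r s * elt p' q' r' s') = conj e f (elt p q r s) * conj e f (elt p' q' r' s')" for p q r s p' q' r' s'
    unfolding elt_mult conj_elt
    by (rule elt_cong; use assms in \<open>elim insertE emptyE; simp add: algebra_simps\<close>)
  moreover have "conj e f (elt p q r s + elt p' q' r' s') = conj e f (elt p q r s) + conj e f (elt p' q' r' s')" for p q r s p' q' r' s'
    unfolding elt_add conj_elt by (simp add: algebra_simps)
  moreover have "conj e f 1 = 1" using conj_elt[of e f 1 0 0 0] by (simp add: elt_rs)
  moreover have "conj e f \<in> extensional K" by (simp add: extensional_def conj_def)
  ultimately show ?thesis unfolding embeddings_def by (auto elim!: KE)
qed

text \<open>The square of each root is rational and hence fixed, so a root goes to itself or to its
  negative; the image of \<open>r3\<close> is then forced by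
  \<open>r1 * r2 = g * r3\<close>.\<close>

lemma embeddings_eq: "embeddings K = (\<lambda>(e, f). conj e f) ` ({1, - 1} \<times> {1, - 1})"
proof
  show "(\<lambda>(e, f). conj e f) ` ({1, - 1} \<times> {1, - 1}) \<subseteq> embeddings K" using conj_embedding by auto
  show "embeddings K \<subseteq> (\<lambda>(e, f). conj e f) ` ({1, - 1} \<times> {1, - 1})"
  proof
    fix \<sigma> assume \<sigma>: "\<sigma> \<in> embeddings K"
    note E = embeddingD[OF subfield_K \<sigma>]
    have rK: "r1 \<in> K" "r2 \<in> K" "r3 \<in> K" by (auto simp flip: elt_rs)
    have sq: "\<exists>e\<in>{1, - 1}. \<sigma> (csq k) = of_rat e * csq k" if k: "csq k \<in> K" "k > 0" for k
    proof -
      have "\<sigma> (csq k) * \<sigma> (csq k) = \<sigma> (of_int k)" using E(2)[OF k(1) k(1)] k(2) by (simp add: csq_mult_self)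
      also have "\<dots> = csq k * csq k" using E(6) k(2) by (simp add: csq_mult_self)
      finally have "\<sigma> (csq k) = csq k \<or> \<sigma> (csq k) = - csq k" by (simp add: square_eq_iff)
      then show ?thesis by auto
    qed
    obtain e where e: "e \<in> {1, - 1}" "\<sigma> r1 = of_rat e * r1" using sq[OF rK(1) products_pos(1)] by blast
    obtain f where f: "f \<in> {1, - 1}" "\<sigma> r2 = of_rat f * r2" using sq[OF rK(2) products_pos(2)] by blast
    have gK: "of_int g \<in> K" by (rule subfield_of_int[OF subfield_K])
    have "of_int g * \<sigma> r3 = \<sigma> (r1 * r2)" unfolding r_mult(4) using E(2)[OF gK rK(3)] E(6) by simp
    also have "\<dots> = of_rat (e * f) * (r1 * r2)" using E(2)[OF rK(1,2)] e f by (simp add: of_rat_mult)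
    also have "\<dots> = of_int g * (of_rat (e * f) * r3)" unfolding r_mult(4) by simp
    finally have s3: "\<sigma> r3 = of_rat (e * f) * r3" using pos by simp
    have "\<sigma> x = conj e f x" for x
    proof (cases "x \<in> K")
      case True
      then obtain p q r s where x: "x = elt p q r s" by (rule KE)
      have qK: "of_rat t \<in> K" for t by (rule subfield_of_rat[OF subfield_K])
      have tr: "of_rat t * z \<in> K \<and> \<sigma> (of_rat t * z) = of_rat t * \<sigma> z" if "z \<in> K" for t z
        using E(2)[OF qK that] E(5) subfield_mult[OF subfield_K qK that] by simp
      note m = tr[OF rK(1), of q, THEN conjunct1] tr[OF rK(2), of r, THEN conjunct1] tr[OF rK(3), of s, THEN conjunct1]
      note m2 = subfield_add[OF subfield_K qK m(1), of p]
      note m3 = subfield_add[OF subfield_K m2 m(2)]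
      have "\<sigma> x = of_rat p + of_rat q * \<sigma> r1 + of_rat r * \<sigma> r2 + of_rat s * \<sigma> r3"
        unfolding x elt_def E(1)[OF m3 m(3)] E(1)[OF m2 m(2)] E(1)[OF qK m(1)] E(5)
        using tr[OF rK(1)] tr[OF rK(2)] tr[OF rK(3)] by simp
      also have "\<dots> = elt p (e * q) (f * r) (e * f * s)"
        unfolding elt_def e(2) f(2) s3 by (simp only: of_rat_mult mult_ac)
      also have "\<dots> = conj e f x" unfolding x by (rule conj_elt[symmetric])
      finally show ?thesis .
    next
      case False
      have "\<sigma> \<in> extensional K" using \<sigma> by (simp add: embeddings_def)
      then show ?thesis using False by (simp add: extensional_def conj_def)
    qed
    then have "\<sigma> = conj e f" by (rule ext)
    then show "\<sigma> \<in> (\<lambda>(e, f). conj e f) ` ({1, - 1} \<times> {1, - 1})" using e f by blast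
  qed
qed

lemma field_trace_elt: "field_trace K (elt p q r s) = of_rat (4 * p)"
proof -
  have inj: "inj_on (\<lambda>(e, f). conj e f) ({1, - 1} \<times> {1, - 1})"
  proof (rule inj_onI, clarify)
    fix e f e' f' assume "conj e f = conj e' f'"
    \<comment> \<open>The coordinates of the image of \<open>r1 + r2\<close> display both
      signs.\<close>
    then have "conj e f (elt 0 1 1 0) = conj e' f' (elt 0 1 1 0)" by simp
    then show "e = e' \<and> f = f'" by (simp add: conj_elt elt_eq_iff)
  qed
  have "field_trace K (elt p q r s) = (\<Sum>(e, f)\<in>{1, - 1} \<times> {1, - 1}. conj e f (elt p q r s))"
    unfolding field_trace_def embeddings_eq by (subst sum.reindex[OF inj]) (simp add: case_prod_unfold)
  also have "\<dots> = conj 1 1 (elt p q r s) + conj 1 (-1) (elt p q r s) + (conj (-1) 1 (elt p q r s) + conj (-1) (-1) (elt p q r s))"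
    unfolding sum.cartesian_product[symmetric] by simp
  also have "\<dots> = of_rat (4 * p)" unfolding conj_elt elt_add elt_of_rat[symmetric] by simp
  finally show ?thesis .
qed

end

section \<open>Conditions on integers of a biquadratic field\<close>

text \<open>An embedding commutes with integer polynomials, so the image satisfies the same monic
  equation.\<close>

lemma algebraic_int_embedding:
  assumes "complex_subfield K" "\<sigma> \<in> embeddings K" "x \<in> K" "algebraic_int x"
  shows "algebraic_int (\<sigma> x)"
proof -
  note E = embeddingD[OF assms(1,2)]
  note K = assms(1)
  obtain p where p: "poly (map_poly of_int p) x = 0" "lead_coeff p = 1"
    using assms(4) unfolding algebraic_int_altdef_ipoly by blast
  have "poly (map_poly of_int q) x \<in> K \<and> \<sigma> (poly (map_poly of_int q) x) = poly (map_poly of_int q) (\<sigma> x)" for q :: "int poly"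
  proof (induction q)
    case 0 then show ?case using E(4) subfield_0[OF K] by simp
  next
    case (pCons a q)
    then have q: "poly (map_poly of_int q) x \<in> K" "\<sigma> (poly (map_poly of_int q) x) = poly (map_poly of_int q) (\<sigma> x)" by auto
    have m: "x * poly (map_poly of_int q) x \<in> K" by (rule subfield_mult[OF K assms(3) q(1)])
    have "\<sigma> (of_int a + x * poly (map_poly of_int q) x) = of_int a + \<sigma> x * poly (map_poly of_int q) (\<sigma> x)"
      using E(1)[OF subfield_of_int[OF K] m] E(2)[OF assms(3) q(1)] E(6) q(2) by simp
    moreover have "of_int a + x * poly (map_poly of_int q) x \<in> K" by (rule subfield_add[OF K subfield_of_int[OF K] m])
    ultimately show ?case using pCons.hyps by (simp add: map_poly_pCons)
  qed
  then have "poly (map_poly of_int p) (\<sigma> x) = 0" using p(1) E(4) by metis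
  then show ?thesis using p(2) unfolding algebraic_int_altdef_ipoly by blast
qed

lemma algebraic_int_csq [simp]: "k \<ge> 0 \<Longrightarrow> algebraic_int (csq k)"
  by (subst csqrt_of_int[symmetric]) (auto intro!: algebraic_int_csqrt)

lemma algebraic_int_half_one_plus_csq:
  assumes "k \<ge> 0" "k mod 4 = 1"
  shows "algebraic_int ((1 + csq k) / 2)"
proof -
  define n where "n = k div 4"
  have k: "k = 4 * n + 1" using assms(2) unfolding n_def by presburger
  have "csq k * csq k = 4 * of_int n + 1" using csq_mult_self[OF assms(1)] by (simp add: k)
  then have "poly (map_poly of_int [:- n, - 1, 1:]) ((1 + csq k) / 2) = 0"
    by (simp add: field_simps)
  then show ?thesis unfolding algebraic_int_altdef_ipoly by (intro exI[of _ "[:- n, - 1, 1:]"]) simp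
qed

lemma Ints_ratE: assumes "(x :: rat) \<in> \<int>" obtains n where "x = of_int n"
  using assms by (auto elim: Ints_cases)

text \<open>The trace \<open>2 A\<close> and the norm \<open>A^2 - k B^2\<close> are rational
  algebraic integers. Then \<open>(2 B)^2 k\<close> is an integer too, and squarefreeness of
  \<open>k\<close> makes \<open>2 B\<close> an integer.\<close>

lemma quadratic_integer_conditions:
  assumes k: "squarefree k" "k > 0" and ai: "algebraic_int (of_rat A + of_rat B * csq k)" "algebraic_int (of_rat A - of_rat B * csq k)"
  obtains a b n where "2 * A = of_int a" "2 * B = of_int b" "a\<^sup>2 - k * b\<^sup>2 = 4 * n"
proof -
  have "algebraic_int ((of_rat A + of_rat B * csq k) + (of_rat A - of_rat B * csq k))"
    by (rule algebraic_int_add[OF ai])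
  also have "(of_rat A + of_rat B * csq k) + (of_rat A - of_rat B * csq k) = (of_rat (2 * A) :: complex)"
    by (simp add: of_rat_mult)
  finally have "2 * A \<in> \<int>" by (rule rational_algebraic_int_complex)
  then obtain a where a: "2 * A = of_int a" by (rule Ints_ratE)
  have "algebraic_int ((of_rat A + of_rat B * csq k) * (of_rat A - of_rat B * csq k))"
    by (rule algebraic_int_mult[OF ai])
  also have "(of_rat A + of_rat B * csq k) * (of_rat A - of_rat B * csq k) = of_rat A * of_rat A - of_rat B * csq k * (of_rat B * csq k)"
    by (rule square_diff_square_factored[symmetric])
  also have "of_rat B * csq k * (of_rat B * csq k) = of_rat B * of_rat B * (csq k * csq k)" by (simp only: mult_ac)
  also have "csq k * csq k = of_rat (of_int k)" using k(2) by (simp add: csq_mult_self)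
  also have "of_rat A * of_rat A - of_rat B * of_rat B * of_rat (of_int k) = (of_rat (A * A - B * B * of_int k) :: complex)"
    by (simp only: of_rat_mult of_rat_diff)
  finally have "A * A - B * B * of_int k \<in> \<int>" by (rule rational_algebraic_int_complex)
  then obtain n where n: "A * A - B * B * of_int k = of_int n" by (rule Ints_ratE)
  have "(2 * B)\<^sup>2 * of_int k = (2 * A)\<^sup>2 - 4 * (A * A - B * B * of_int k)"
    by (simp add: power2_eq_square algebra_simps)
  also have "\<dots> = of_int (a\<^sup>2 - 4 * n)" unfolding a n by (simp only: of_int_diff of_int_power of_int_mult of_int_numeral)
  finally have "(2 * B)\<^sup>2 * of_int k \<in> \<int>" by (simp only: Ints_of_int)
  then have "2 * B \<in> \<int>" by (rule rat_in_Ints_of_square_mult_squarefree[OF k(1)])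
  then obtain b where b: "2 * B = of_int b" by (rule Ints_ratE)
  have "of_int (a\<^sup>2 - k * b\<^sup>2) = (2 * A)\<^sup>2 - of_int k * (2 * B)\<^sup>2" unfolding a b by (simp only: of_int_diff of_int_power of_int_mult)
  also have "\<dots> = 4 * (A * A - B * B * of_int k)" by (simp add: power2_eq_square algebra_simps)
  also have "\<dots> = of_int (4 * n)" unfolding n by (simp only: of_int_mult of_int_numeral)
  finally have "a\<^sup>2 - k * b\<^sup>2 = 4 * n" by (simp only: of_int_eq_iff)
  then show ?thesis by (rule that[OF a b])
qed

lemma square_mod_4: "(n :: int)\<^sup>2 mod 4 = (if even n then 0 else 1)"
proof (cases "even n")
  case True
  then obtain m where "n = 2 * m" by blast
  then show ?thesis by (simp add: power2_eq_square)
next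
  case False
  then obtain m where "n = 2 * m + 1" by (auto elim: oddE)
  then have "n\<^sup>2 = 4 * (m\<^sup>2 + m) + 1" by (simp add: power2_eq_square algebra_simps)
  then have "n\<^sup>2 mod 4 = 1" by presburger
  then show ?thesis using False by simp
qed

lemma mult_square_mod_4: "(k * n\<^sup>2) mod 4 = (if even n then 0 else k mod 4 :: int)"
  by (subst mod_mult_right_eq[symmetric], subst square_mod_4) simp

text \<open>Modulo 4 a square is 0 or 1, whereas \<open>k b^2\<close> is 0 or 3, so both must be
  0.\<close>

lemma quadratic_parity_3_mod_4:
  fixes a b n k :: int
  assumes "k mod 4 = 3" "a\<^sup>2 - k * b\<^sup>2 = 4 * n"
  shows "even a \<and> even b"
proof -
  have "a\<^sup>2 mod 4 = (k * b\<^sup>2) mod 4" using assms(2) by presburger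
  then show ?thesis unfolding square_mod_4 mult_square_mod_4 assms(1) by (simp split: if_splits)
qed

lemma quadratic_parity_odd:
  fixes a b n k :: int
  assumes "odd k" "a\<^sup>2 - k * b\<^sup>2 = 4 * n"
  shows "even a \<longleftrightarrow> even b"
proof -
  have "even (a\<^sup>2 - k * b\<^sup>2)" using assms(2) by simp
  then show ?thesis using assms(1) by simp
qed

context biquadratic
begin

lemma conj_algebraic_int:
  assumes "algebraic_int (elt p q r s)" "e \<in> {1, - 1}" "f \<in> {1, - 1}"
  shows "algebraic_int (elt p (e * q) (f * r) (e * f * s))"
  using algebraic_int_embedding[OF subfield_K conj_embedding[OF assms(2,3)] elt_in_K assms(1)] by (simp add: conj_elt)

text \<open>The sum of an integer and its conjugate over a quadratic subfield is an integer of that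
  subfield. Over the three subfields this bounds all denominators by 4 and yields one norm equation
  each.\<close>

lemma integer_traces:
  assumes "algebraic_int (elt p q r s)"
  obtains P Q R S n1 n2 n3 where "4 * p = of_int P" "4 * q = of_int Q" "4 * r = of_int R" "4 * s = of_int S"
    "P\<^sup>2 - (g * u) * Q\<^sup>2 = 4 * n1" "P\<^sup>2 - (g * v) * R\<^sup>2 = 4 * n2" "P\<^sup>2 - (u * v) * S\<^sup>2 = 4 * n3"
proof -
  have c: "algebraic_int (elt p q (- r) (- s))" "algebraic_int (elt p (- q) r (- s))" "algebraic_int (elt p (- q) (- r) s)"
    using conj_algebraic_int[OF assms, of 1 "-1"] conj_algebraic_int[OF assms, of "-1" 1] conj_algebraic_int[OF assms, of "-1" "-1"] by simp_all
  have 1: "algebraic_int (of_rat (2 * p) + of_rat (2 * q) * r1)" "algebraic_int (of_rat (2 * p) - of_rat (2 * q) * r1)"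
    using algebraic_int_add[OF assms c(1)] algebraic_int_add[OF c(2,3)] by (simp_all add: elt_add) (simp_all add: elt_def of_rat_mult of_rat_minus)
  have 2: "algebraic_int (of_rat (2 * p) + of_rat (2 * r) * r2)" "algebraic_int (of_rat (2 * p) - of_rat (2 * r) * r2)"
    using algebraic_int_add[OF assms c(2)] algebraic_int_add[OF c(1,3)] by (simp_all add: elt_add) (simp_all add: elt_def of_rat_mult of_rat_minus)
  have 3: "algebraic_int (of_rat (2 * p) + of_rat (2 * s) * r3)" "algebraic_int (of_rat (2 * p) - of_rat (2 * s) * r3)"
    using algebraic_int_add[OF assms c(3)] algebraic_int_add[OF c(1,2)] by (simp_all add: elt_add) (simp_all add: elt_def of_rat_mult of_rat_minus)
  obtain P1 Q n1 where q1: "2 * (2 * p) = of_int P1" "2 * (2 * q) = of_int Q" "P1\<^sup>2 - (g * u) * Q\<^sup>2 = 4 * n1"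
    by (rule quadratic_integer_conditions[OF squarefree_products(1) products_pos(1) 1])
  obtain P2 R n2 where q2: "2 * (2 * p) = of_int P2" "2 * (2 * r) = of_int R" "P2\<^sup>2 - (g * v) * R\<^sup>2 = 4 * n2"
    by (rule quadratic_integer_conditions[OF squarefree_products(2) products_pos(2) 2])
  obtain P3 S n3 where q3: "2 * (2 * p) = of_int P3" "2 * (2 * s) = of_int S" "P3\<^sup>2 - (u * v) * S\<^sup>2 = 4 * n3"
    by (rule quadratic_integer_conditions[OF squarefree_products(3) products_pos(3) 3])
  \<comment> \<open>All three applications have the same absolute trace \<open>4 p\<close>, so their
    first coordinates agree.\<close>
  have "of_int P1 = (of_int P2 :: rat)" "of_int P1 = (of_int P3 :: rat)" using q1(1) q2(1) q3(1) by simp_all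
  then have "P2 = P1" "P3 = P1" by (simp_all only: of_int_eq_iff)
  then show ?thesis using q1 q2 q3 by (intro that[of P1 Q R S n1 n2 n3]) simp_all
qed

text \<open>Denominators are here already reduced to 2. The norm \<open>a/2 + (b/2) r1\<close> to
  the field of \<open>r1\<close> and its conjugate are algebraic integers, which yields a parity
  condition beyond those given by the traces.\<close>

lemma relative_norm_conditions:
  assumes "algebraic_int (elt (of_int P / 2) (of_int Q / 2) (of_int R / 2) (of_int S / 2))"
  obtains a b n where "2 * a = P\<^sup>2 + (g * u) * Q\<^sup>2 - (g * v) * R\<^sup>2 - (u * v) * S\<^sup>2" "b = P * Q - R * S * v"
    "a\<^sup>2 - (g * u) * b\<^sup>2 = 4 * n"
proof -
  let ?A = "(of_int (P\<^sup>2 + (g * u) * Q\<^sup>2 - (g * v) * R\<^sup>2 - (u * v) * S\<^sup>2) :: rat) / 4"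
  let ?B = "(of_int (P * Q - R * S * v) :: rat) / 2"
  have c: "algebraic_int (elt (of_int P / 2) (e * (of_int Q / 2)) (f * (of_int R / 2)) (e * f * (of_int S / 2)))"
    if "e \<in> {1, - 1}" "f \<in> {1, - 1}" for e f by (rule conj_algebraic_int[OF assms that])
  have "algebraic_int (elt (of_int P / 2) (of_int Q / 2) (of_int R / 2) (of_int S / 2) *
      elt (of_int P / 2) (1 * (of_int Q / 2)) (- 1 * (of_int R / 2)) (1 * - 1 * (of_int S / 2)))"
    by (rule algebraic_int_mult[OF assms c]) auto
  also have "elt (of_int P / 2) (of_int Q / 2) (of_int R / 2) (of_int S / 2) *
      elt (of_int P / 2) (1 * (of_int Q / 2)) (- 1 * (of_int R / 2)) (1 * - 1 * (of_int S / 2)) = elt ?A ?B 0 0"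
    unfolding elt_mult by (rule elt_cong) (simp_all add: power2_eq_square field_simps)
  also have "elt ?A ?B 0 0 = of_rat ?A + of_rat ?B * r1" by (simp add: elt_def)
  finally have 1: "algebraic_int (of_rat ?A + of_rat ?B * r1)" .
  have "algebraic_int (elt (of_int P / 2) (- 1 * (of_int Q / 2)) (1 * (of_int R / 2)) (- 1 * 1 * (of_int S / 2)) *
      elt (of_int P / 2) (- 1 * (of_int Q / 2)) (- 1 * (of_int R / 2)) (- 1 * - 1 * (of_int S / 2)))"
    by (rule algebraic_int_mult[OF c c]) auto
  also have "elt (of_int P / 2) (- 1 * (of_int Q / 2)) (1 * (of_int R / 2)) (- 1 * 1 * (of_int S / 2)) *
      elt (of_int P / 2) (- 1 * (of_int Q / 2)) (- 1 * (of_int R / 2)) (- 1 * - 1 * (of_int S / 2)) = elt ?A (- ?B) 0 0"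
    unfolding elt_mult by (rule elt_cong) (simp_all add: power2_eq_square field_simps)
  also have "elt ?A (- ?B) 0 0 = of_rat ?A - of_rat ?B * r1" by (simp add: elt_def of_rat_minus)
  finally have 2: "algebraic_int (of_rat ?A - of_rat ?B * r1)" .
  obtain a b n where ab: "2 * ?A = of_int a" "2 * ?B = of_int b" "a\<^sup>2 - (g * u) * b\<^sup>2 = 4 * n"
    by (rule quadratic_integer_conditions[OF squarefree_products(1) products_pos(1) 1 2])
  have "(of_int (2 * a) :: rat) = of_int (P\<^sup>2 + (g * u) * Q\<^sup>2 - (g * v) * R\<^sup>2 - (u * v) * S\<^sup>2)"
    using ab(1) by simp
  then have "2 * a = P\<^sup>2 + (g * u) * Q\<^sup>2 - (g * v) * R\<^sup>2 - (u * v) * S\<^sup>2" by (simp only: of_int_eq_iff)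
  moreover have "(of_int b :: rat) = of_int (P * Q - R * S * v)" using ab(2) by simp
  then have "b = P * Q - R * S * v" by (simp only: of_int_eq_iff)
  ultimately show ?thesis using ab(3) by (rule that)
qed

end

section \<open>Integral bases and discriminants\<close>

lemma sum_lessThan_4: "(\<Sum>i<4::nat. f i) = f 0 + f 1 + f 2 + (f 3 :: 'a :: comm_monoid_add)"
  by (simp add: eval_nat_numeral)

lemma less_4_cases: "i < (4::nat) \<Longrightarrow> i = 0 \<or> i = 1 \<or> i = 2 \<or> i = 3"
  by linarith

lemma less_less_4_cases:
  assumes "i < j" "j < (4::nat)"
  shows "i = 0 \<and> j = 1 \<or> i = 0 \<and> j = 2 \<or> i = 0 \<and> j = 3 \<or> i = 1 \<and> j = 2 \<or> i = 1 \<and> j = 3 \<or> i = 2 \<and> j = 3"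
proof -
  have "i = 0 \<or> i = 1 \<or> i = 2" "j = 1 \<or> j = 2 \<or> j = 3" using assms by linarith+
  then show ?thesis using assms(1) by (elim disjE) simp_all
qed

lemma upt_0_4: "[0..<4] = [0, 1, 2, 3::nat]"
  by (simp add: upt_rec)

lemma det_mat_4_lower_triangular:
  fixes f :: "nat \<times> nat \<Rightarrow> 'a :: comm_ring_1"
  assumes "\<And>i j. i < j \<Longrightarrow> j < 4 \<Longrightarrow> f (i, j) = 0"
  shows "Determinant.det (Matrix.mat 4 4 f) = f (0, 0) * (f (1, 1) * (f (2, 2) * f (3, 3)))"
proof -
  have "Determinant.det (Matrix.mat 4 4 f) = prod_list (diag_mat (Matrix.mat 4 4 f))"
    by (rule det_lower_triangular[of 4]) (use assms in auto)
  then show ?thesis by (simp add: diag_mat_def upt_0_4)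
qed

text \<open>The Gram matrix of an orthogonal family is diagonal; it is evaluated as a lower
  triangular one, so each pair occurs in one order only.\<close>

lemma det_trace_gram_orthogonal:
  assumes "field_trace K (x * y) = 0" "field_trace K (x * z) = 0" "field_trace K (x * w) = 0"
    "field_trace K (y * z) = 0" "field_trace K (y * w) = 0" "field_trace K (z * w) = 0"
  shows "Determinant.det (trace_gram K [x, y, z, w]) =
    field_trace K (x * x) * (field_trace K (y * y) * (field_trace K (z * z) * field_trace K (w * w)))"
proof -
  define ws where "ws = [x, y, z, w]"
  have nth: "ws ! 0 = x" "ws ! 1 = y" "ws ! 2 = z" "ws ! 3 = w" by (simp_all add: ws_def)
  have len: "length ws = 4" by (simp add: ws_def)
  have "Determinant.det (Matrix.mat 4 4 (\<lambda>(i, j). field_trace K (ws ! i * ws ! j))) =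
      (\<lambda>(i, j). field_trace K (ws ! i * ws ! j)) (0, 0) * ((\<lambda>(i, j). field_trace K (ws ! i * ws ! j)) (1, 1) *
      ((\<lambda>(i, j). field_trace K (ws ! i * ws ! j)) (2, 2) * (\<lambda>(i, j). field_trace K (ws ! i * ws ! j)) (3, 3)))"
  proof (rule det_mat_4_lower_triangular)
    fix i j :: nat assume "i < j" "j < 4"
    from less_less_4_cases[OF this]
    show "(case (i, j) of (i, j) \<Rightarrow> field_trace K (ws ! i * ws ! j)) = 0"
      by (elim disjE conjE) (simp_all only: prod.case nth assms)
  qed
  then have "Determinant.det (trace_gram K ws) =
    field_trace K (x * x) * (field_trace K (y * y) * (field_trace K (z * z) * field_trace K (w * w)))"
    by (simp only: trace_gram_def len prod.case nth)
  then show ?thesis by (simp only: ws_def)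
qed

context biquadratic
begin

lemma det_trace_gram_standard:
  "Determinant.det (trace_gram K [elt 1 0 0 0, elt 0 1 0 0, elt 0 0 1 0, elt 0 0 0 1]) = of_int (256 * (g * u * v)\<^sup>2)"
proof -
  have "Determinant.det (trace_gram K [elt 1 0 0 0, elt 0 1 0 0, elt 0 0 1 0, elt 0 0 0 1]) =
    of_rat (4 * 1) * (of_rat (4 * (of_int (g * u))) * (of_rat (4 * of_int (g * v)) * of_rat (4 * of_int (u * v))))"
    by (subst det_trace_gram_orthogonal) (simp_all only: elt_mult field_trace_elt, simp_all)
  also have "\<dots> = of_rat (of_int (256 * (g * u * v)\<^sup>2))"
    unfolding of_rat_mult[symmetric] of_rat_eq_iff by (simp add: power2_eq_square)
  also have "\<dots> = of_int (256 * (g * u * v)\<^sup>2)" by (rule of_rat_of_int_eq)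
  finally show ?thesis .
qed

text \<open>Common frame of both discriminant computations, for a basis triangular in
  \<open>1, r1, r2, r3\<close>. Nonzero diagonal entries give uniqueness of coordinates by back
  substitution, and the discriminant is \<open>256 (g u v)^2\<close>, the Gram determinant of
  \<open>1, r1, r2, r3\<close>, times the square of the diagonal product.\<close>

lemma triangular_integral_basis:
  fixes a0 b0 b1 c0 c1 c2 d0 d1 d2 d3 :: rat
  defines "ws \<equiv> [elt a0 0 0 0, elt b0 b1 0 0, elt c0 c1 c2 0, elt d0 d1 d2 d3]"
  assumes int: "algebraic_int (elt a0 0 0 0)" "algebraic_int (elt b0 b1 0 0)"
      "algebraic_int (elt c0 c1 c2 0)" "algebraic_int (elt d0 d1 d2 d3)"
    and nz: "a0 \<noteq> 0" "b1 \<noteq> 0" "c2 \<noteq> 0" "d3 \<noteq> 0"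
    and span: "\<And>p q r s. algebraic_int (elt p q r s) \<Longrightarrow> \<exists>k0 k1 k2 k3 :: int.
      p = of_int k0 * a0 + of_int k1 * b0 + of_int k2 * c0 + of_int k3 * d0 \<and>
      q = of_int k1 * b1 + of_int k2 * c1 + of_int k3 * d1 \<and>
      r = of_int k2 * c2 + of_int k3 * d2 \<and> s = of_int k3 * d3"
    and D: "of_int D = 256 * of_int ((g * u * v)\<^sup>2) * (a0 * b1 * c2 * d3)\<^sup>2"
  shows "discriminant K = D"
proof (rule discriminant_eqI[OF subfield_K])
  have len: "length ws = 4" by (simp add: ws_def)
  have comb: "(\<Sum>i<length ws. of_int (cs ! i) * ws ! i) =
    elt (of_int (cs ! 0) * a0 + of_int (cs ! 1) * b0 + of_int (cs ! 2) * c0 + of_int (cs ! 3) * d0)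
        (of_int (cs ! 1) * b1 + of_int (cs ! 2) * c1 + of_int (cs ! 3) * d1)
        (of_int (cs ! 2) * c2 + of_int (cs ! 3) * d2) (of_int (cs ! 3) * d3)" for cs :: "int list"
  proof -
    have "of_int k * elt p q r s = elt (of_int k * p) (of_int k * q) (of_int k * r) (of_int k * s)" for k p q r s
      by (simp only: elt_def of_rat_mult of_rat_of_int_eq distrib_left mult.assoc)
    then show ?thesis unfolding len sum_lessThan_4 by (simp add: ws_def elt_add)
  qed
  show "integral_basis K ws"
    unfolding integral_basis_def
  proof (intro conjI ballI)
    show "set ws \<subseteq> ring_of_integers K" using int by (simp add: ws_def ring_of_integers_def)
    fix x assume "x \<in> ring_of_integers K"
    then obtain p q r s where x: "x = elt p q r s" "algebraic_int (elt p q r s)"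
      unfolding ring_of_integers_def by (auto elim!: KE)
    obtain k0 k1 k2 k3 :: int where k:
      "p = of_int k0 * a0 + of_int k1 * b0 + of_int k2 * c0 + of_int k3 * d0"
      "q = of_int k1 * b1 + of_int k2 * c1 + of_int k3 * d1"
      "r = of_int k2 * c2 + of_int k3 * d2" "s = of_int k3 * d3"
      using span[OF x(2)] by blast
    show "\<exists>!cs :: int list. length cs = length ws \<and> x = (\<Sum>i<length ws. of_int (cs ! i) * ws ! i)"
    proof (rule ex1I[of _ "[k0, k1, k2, k3]"])
      show "length [k0, k1, k2, k3] = length ws \<and> x = (\<Sum>i<length ws. of_int ([k0, k1, k2, k3] ! i) * ws ! i)"
        unfolding comb x(1) using k by (simp add: len)
      fix cs :: "int list" assume cs: "length cs = length ws \<and> x = (\<Sum>i<length ws. of_int (cs ! i) * ws ! i)"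
      have lcs: "length cs = 4" using cs len by simp
      have eq: "of_int (cs ! 0) * a0 + of_int (cs ! 1) * b0 + of_int (cs ! 2) * c0 + of_int (cs ! 3) * d0 = p"
        "of_int (cs ! 1) * b1 + of_int (cs ! 2) * c1 + of_int (cs ! 3) * d1 = q"
        "of_int (cs ! 2) * c2 + of_int (cs ! 3) * d2 = r" "of_int (cs ! 3) * d3 = s"
        using cs unfolding comb x(1) elt_eq_iff by blast+
      have 3: "cs ! 3 = k3" using eq(4) k(4) nz(4) by simp
      have 2: "cs ! 2 = k2" using eq(3) k(3) nz(3) 3 by simp
      have 1: "cs ! 1 = k1" using eq(2) k(2) nz(2) 3 2 by simp
      have 0: "cs ! 0 = k0" using eq(1) k(1) nz(1) 3 2 1 by simp
      show "cs = [k0, k1, k2, k3]"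
      proof (rule nth_equalityI)
        show "length cs = length [k0, k1, k2, k3]" using lcs by simp
        fix i assume "i < length cs"
        then have "i < 4" using lcs by simp
        from less_4_cases[OF this] show "cs ! i = [k0, k1, k2, k3] ! i" using 0 1 2 3 by (elim disjE) simp_all
      qed
    qed
  qed
  define ws0 where "ws0 = [elt 1 0 0 0, elt 0 1 0 0, elt 0 0 1 0, elt 0 0 0 1]"
  define A where "A = (\<lambda>i k. [[a0, 0, 0, 0], [b0, b1, 0, 0], [c0, c1, c2, 0], [d0, d1, d2, d3]] ! i ! k)"
  have "Determinant.det (trace_gram K ws) = (of_rat (Determinant.det (Matrix.mat 4 4 (\<lambda>(i, k). A i k))))\<^sup>2 * Determinant.det (trace_gram K ws0)"
  proof (rule det_trace_gram_change_basis[OF subfield_K])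
    show "set ws0 \<subseteq> K" "length ws0 = 4" "length ws = 4" by (simp_all add: ws0_def len)
    fix i :: nat assume i: "i < 4"
    have sc: "of_rat t * elt p q r s = elt (t * p) (t * q) (t * r) (t * s)" for t p q r s
      by (simp only: elt_def of_rat_mult distrib_left mult.assoc)
    show "ws ! i = (\<Sum>k<4. of_rat (A i k) * ws0 ! k)"
      unfolding sum_lessThan_4 using less_4_cases[OF i] by (elim disjE) (simp_all add: ws_def ws0_def A_def sc elt_add)
  qed
  also have "Determinant.det (Matrix.mat 4 4 (\<lambda>(i, k). A i k)) = a0 * (b1 * (c2 * d3))"
  proof (subst det_mat_4_lower_triangular)
    fix i j :: nat assume "i < j" "j < 4"
    from less_less_4_cases[OF this] show "(case (i, j) of (i, k) \<Rightarrow> A i k) = 0"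
      by (elim disjE conjE) (simp_all add: A_def)
  qed (simp add: A_def)
  also have "Determinant.det (trace_gram K ws0) = of_rat (256 * of_int ((g * u * v)\<^sup>2))"
    unfolding ws0_def det_trace_gram_standard by (simp add: of_rat_mult of_rat_power)
  also have "(of_rat (a0 * (b1 * (c2 * d3))))\<^sup>2 * of_rat (256 * of_int ((g * u * v)\<^sup>2)) = (of_rat (of_int D) :: complex)"
    unfolding D of_rat_power[symmetric] of_rat_mult[symmetric] of_rat_eq_iff by (simp only: mult_ac)
  finally show "Determinant.det (trace_gram K ws) = of_int D" by simp
qed

end

text \<open>The parity of \<open>a\<close> determines \<open>2 a\<close> modulo 4, and by the norm
  equation it equals the parity of \<open>b\<close>. This leaves a finite check over the parities of
  the variables.\<close>

lemma relative_norm_parity: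
  fixes P Q R S a b n k1 k2 k3 v :: int
  assumes "2 * a = P\<^sup>2 + k1 * Q\<^sup>2 - k2 * R\<^sup>2 - k3 * S\<^sup>2" "b = P * Q - R * S * v" "a\<^sup>2 - k1 * b\<^sup>2 = 4 * n"
    and k: "k1 mod 4 = 1" "k2 mod 4 = 3" "k3 mod 4 = 3"
  shows "(even P \<longleftrightarrow> even Q) \<and> (even R \<longleftrightarrow> even S)"
proof -
  have "odd k1" using k(1) by presburger
  then have ab: "even a \<longleftrightarrow> even b" using quadratic_parity_odd assms(3) by blast
  define x y z w where "x = P\<^sup>2" and "y = k1 * Q\<^sup>2" and "z = k2 * R\<^sup>2" and "w = k3 * S\<^sup>2"
  have m: "x mod 4 = (if even P then 0 else 1)" "y mod 4 = (if even Q then 0 else 1)"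
    "z mod 4 = (if even R then 0 else 3)" "w mod 4 = (if even S then 0 else 3)"
    unfolding x_def y_def z_def w_def square_mod_4 mult_square_mod_4 k by simp_all
  have a: "2 * a = x + y - z - w" using assms(1) by (simp add: x_def y_def z_def w_def)
  have "even b \<longleftrightarrow> (even (P * Q) \<longleftrightarrow> even (R * S * v))" using assms(2) by auto
  then have b: "even b \<longleftrightarrow> ((even P \<or> even Q) \<longleftrightarrow> (even R \<or> even S \<or> even v))" by simp
  have "(x mod 4 + y mod 4 - z mod 4 - w mod 4) mod 4 = (x + y - z - w) mod 4"
  proof -
    have "x = 4 * xd + xm \<Longrightarrow> y = 4 * yd + ym \<Longrightarrow> z = 4 * zd + zm \<Longrightarrow> w = 4 * wd + wm \<Longrightarrow>
        x + y - z - w = (xm + ym - zm - wm) + 4 * (xd + yd - zd - wd)" for xd xm yd ym zd zm wd wm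
      by simp
    from this[OF mult_div_mod_eq[symmetric] mult_div_mod_eq[symmetric] mult_div_mod_eq[symmetric] mult_div_mod_eq[symmetric]]
    have "x + y - z - w = (x mod 4 + y mod 4 - z mod 4 - w mod 4) + 4 * (x div 4 + y div 4 - z div 4 - w div 4)" .
    then show ?thesis by (simp only: mod_mult_self2)
  qed
  also have "\<dots> = (2 * a) mod 4" using a by simp
  also have "\<dots> = (if even a then 0 else 2)" by presburger
  finally have e: "(x mod 4 + y mod 4 - z mod 4 - w mod 4) mod 4 = (if even a then 0 else 2)" .
  show ?thesis
    using e ab b unfolding m
    by (cases "even P"; cases "even Q"; cases "even R"; cases "even S"; simp split: if_splits)
qed

lemma mult_mod_4: "a mod 4 = r \<Longrightarrow> b mod 4 = s \<Longrightarrow> (a * b) mod 4 = (r * s) mod (4 :: int)"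
  by (auto simp: mod_mult_eq)

section \<open>The two shapes of the ring of integers\<close>

context biquadratic
begin

text \<open>Allows a pair of entries with equal residues modulo 4 to be moved to the front.\<close>

lemma biquadratic_swap: "biquadratic u g v" "biquadratic v g u" "biquadratic v u g" "biquadratic u v g" "biquadratic g v u"
  using pos sqf nontriv by (unfold_locales; simp add: mult_ac)+

lemma algebraic_int_elt_of_int: "algebraic_int (elt (of_int a) (of_int b) (of_int c) (of_int d))"
  using pos by (auto simp: elt_def intro!: algebraic_int_add algebraic_int_mult)

text \<open>The integral basis is \<open>1\<close>, \<open>(1 + r1)/2\<close>,
  \<open>(1 + r2)/2\<close>, \<open>(1 + r1 + r2 + \<epsilon> r3)/4\<close>, where
  \<open>\<epsilon>\<close> is the sign congruent to \<open>g\<close> modulo 4. Up to sign its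
  diagonal product is 1/16, whose square cancels the factor 256.\<close>

lemma discriminant_congruent:
  assumes odd: "odd g" "odd u" "odd v" and cong: "g mod 4 = u mod 4" "g mod 4 = v mod 4"
  shows "discriminant K = (g * u * v)\<^sup>2"
proof -
  define \<epsilon> :: int where "\<epsilon> = (if g mod 4 = 1 then 1 else - 1)"
  have \<epsilon>: "\<epsilon> * \<epsilon> = 1" "odd \<epsilon>" by (auto simp: \<epsilon>_def)
  have "g mod 4 = 1 \<or> g mod 4 = 3" using odd(1) by presburger
  then have k: "(g * u) mod 4 = 1" "(g * v) mod 4 = 1" "(u * v) mod 4 = 1"
    using cong mult_mod_4[of g 1 u 1] mult_mod_4[of g 1 v 1] mult_mod_4[of u 1 v 1]
      mult_mod_4[of g 3 u 3] mult_mod_4[of g 3 v 3] mult_mod_4[of u 3 v 3] by auto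
  have "g mod 4 = 1 \<or> g mod 4 = 3" using odd(1) by presburger
  then have "4 dvd g - \<epsilon>" unfolding \<epsilon>_def by presburger
  then obtain t where "g - \<epsilon> = 4 * t" by (rule dvdE)
  then have "g = \<epsilon> + 4 * t" by simp
  from arg_cong[OF this, of "of_int :: int \<Rightarrow> rat"] have t: "of_int g = (of_int \<epsilon> + 4 * of_int t :: rat)" by simp
  have h: "algebraic_int ((1 + r1) / 2)" "algebraic_int ((1 + r2) / 2)"
    using k products_pos by (auto intro!: algebraic_int_half_one_plus_csq)
  have h1: "elt (1/2) (1/2) 0 0 = (1 + r1) / 2" and h2: "elt (1/2) 0 (1/2) 0 = (1 + r2) / 2"
    by (simp_all add: elt_def of_rat_divide add_divide_distrib)
  \<comment> \<open>The product of \<open>(1 + r1)/2\<close> and \<open>(1 + r2)/2\<close> is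
    \<open>(1 + r1 + r2 + g r3)/4\<close>; subtracting \<open>t r3\<close> replaces \<open>g\<close>
    by \<open>\<epsilon>\<close>.\<close>
  have w: "algebraic_int (elt (1/4) (1/4) (1/4) (of_int \<epsilon> / 4))"
  proof -
    have "algebraic_int (elt (1/2) (1/2) 0 0 * elt (1/2) 0 (1/2) 0 - elt (of_int 0) (of_int 0) (of_int 0) (of_int t))"
      using h unfolding h1 h2 by (intro algebraic_int_diff algebraic_int_mult algebraic_int_elt_of_int)
    also have "elt (1/2) (1/2) 0 0 * elt (1/2) 0 (1/2) 0 - elt (of_int 0) (of_int 0) (of_int 0) (of_int t) = elt (1/4) (1/4) (1/4) (of_int \<epsilon> / 4)"
      unfolding elt_mult elt_diff by (rule elt_cong) (simp_all add: t field_simps)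
    finally show ?thesis .
  qed
  show ?thesis
  proof (rule triangular_integral_basis[of 1 "1/2" "1/2" "1/2" 0 "1/2" "1/4" "1/4" "1/4" "of_int \<epsilon> / 4"])
    show "algebraic_int (elt 1 0 0 0)" by (simp add: elt_rs)
    show "algebraic_int (elt (1/2) (1/2) 0 0)" "algebraic_int (elt (1/2) 0 (1/2) 0)" 
      unfolding h1 h2 by (rule h)+
    show "algebraic_int (elt (1/4) (1/4) (1/4) (of_int \<epsilon> / 4))" by (rule w)
    show "of_int \<epsilon> / 4 \<noteq> (0 :: rat)" using \<epsilon> by auto
    have "(of_int \<epsilon> * of_int \<epsilon> :: rat) = 1" unfolding of_int_mult[symmetric] \<epsilon>(1) by simp
    then show "of_int ((g * u * v)\<^sup>2) = 256 * of_int ((g * u * v)\<^sup>2) * (1 * (1 / 2) * (1 / 2) * (of_int \<epsilon> / 4) :: rat)\<^sup>2"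
      by (simp add: power2_eq_square)
    fix p q r s assume ai: "algebraic_int (elt p q r s)"
    obtain P Q R S n1 n2 n3 where T: "4 * p = of_int P" "4 * q = of_int Q" "4 * r = of_int R" "4 * s = of_int S"
      and n: "P\<^sup>2 - (g * u) * Q\<^sup>2 = 4 * n1" "P\<^sup>2 - (g * v) * R\<^sup>2 = 4 * n2" "P\<^sup>2 - (u * v) * S\<^sup>2 = 4 * n3"
      by (rule integer_traces[OF ai])
    have par: "even P \<longleftrightarrow> even Q" "even P \<longleftrightarrow> even R" "even P \<longleftrightarrow> even S"
      using quadratic_parity_odd[OF _ n(1)] quadratic_parity_odd[OF _ n(2)] quadratic_parity_odd[OF _ n(3)] odd by simp_all
    \<comment> \<open>All four numerators have the same parity; subtracting \<open>o1\<close> times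
      the last basis element makes them even and reduces the denominators to 2.\<close>
    define o1 :: int where "o1 = (if even P then 0 else 1)"
    have ev: "even (P - o1)" "even (Q - o1)" "even (R - o1)" "even (S - o1 * \<epsilon>)"
      using par \<epsilon>(2) by (auto simp: o1_def)
    obtain P' where P': "P - o1 = 2 * P'" using ev(1) by (rule evenE)
    obtain Q' where Q': "Q - o1 = 2 * Q'" using ev(2) by (rule evenE)
    obtain R' where R': "R - o1 = 2 * R'" using ev(3) by (rule evenE)
    obtain S' where S': "S - o1 * \<epsilon> = 2 * S'" using ev(4) by (rule evenE)
    have co: "p = of_int P' / 2 + of_int o1 / 4" "q = of_int Q' / 2 + of_int o1 / 4" "r = of_int R' / 2 + of_int o1 / 4"
      "s = of_int S' / 2 + of_int o1 * of_int \<epsilon> / 4"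
    proof -
      have "P = 2 * P' + o1" "Q = 2 * Q' + o1" "R = 2 * R' + o1" "S = 2 * S' + o1 * \<epsilon>" using P' Q' R' S' by simp_all
      then show "p = of_int P' / 2 + of_int o1 / 4" "q = of_int Q' / 2 + of_int o1 / 4" "r = of_int R' / 2 + of_int o1 / 4"
        "s = of_int S' / 2 + of_int o1 * of_int \<epsilon> / 4" using T by simp_all
    qed
    have "algebraic_int (elt p q r s - elt (of_int o1) (of_int 0) (of_int 0) (of_int 0) * elt (1/4) (1/4) (1/4) (of_int \<epsilon> / 4))"
      using ai w by (intro algebraic_int_diff algebraic_int_mult algebraic_int_elt_of_int)
    also have "elt p q r s - elt (of_int o1) (of_int 0) (of_int 0) (of_int 0) * elt (1/4) (1/4) (1/4) (of_int \<epsilon> / 4) =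
        elt (of_int P' / 2) (of_int Q' / 2) (of_int R' / 2) (of_int S' / 2)"
      unfolding elt_mult elt_diff by (rule elt_cong) (simp_all add: co)
    finally have ai': "algebraic_int (elt (of_int P' / 2) (of_int Q' / 2) (of_int R' / 2) (of_int S' / 2))" .
    \<comment> \<open>The relative norm supplies the last condition: as \<open>g\<close>,
      \<open>u\<close>, \<open>v\<close> are odd, \<open>P' + Q' + R' + S'\<close> is even, stated
      below with the signs that the coordinate \<open>m\<close> requires.\<close>
    obtain a b n where "2 * a = P'\<^sup>2 + (g * u) * Q'\<^sup>2 - (g * v) * R'\<^sup>2 - (u * v) * S'\<^sup>2"
      by (rule relative_norm_conditions[OF ai'])
    then have "even (P'\<^sup>2 + (g * u) * Q'\<^sup>2 - (g * v) * R'\<^sup>2 - (u * v) * S'\<^sup>2)" by (rule dvdI[OF sym])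
    then have "even (P' - Q' - R' + \<epsilon> * S')" using odd \<epsilon>(2) by auto
    then obtain m where m: "P' - Q' - R' + \<epsilon> * S' = 2 * m" by (rule evenE)
    have \<epsilon>\<epsilon>: "\<epsilon> * (\<epsilon> * S') = S'" by (simp only: mult.assoc[symmetric] \<epsilon>(1) mult_1_left)
    show "\<exists>k0 k1 k2 k3 :: int.
      p = of_int k0 * 1 + of_int k1 * (1/2) + of_int k2 * (1/2) + of_int k3 * (1/4) \<and>
      q = of_int k1 * (1/2) + of_int k2 * 0 + of_int k3 * (1/4) \<and>
      r = of_int k2 * (1/2) + of_int k3 * (1/4) \<and> s = of_int k3 * (of_int \<epsilon> / 4)"
    proof (intro exI conjI)
      \<comment> \<open>Coordinates by back substitution from the last entry; division by
        \<open>\<epsilon>\<close> is multiplication by it, since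
        \<open>\<epsilon>^2 = 1\<close>.\<close>
      let ?k3 = "2 * (\<epsilon> * S') + o1"
      have mm: "of_int P' - of_int Q' - of_int R' + of_int \<epsilon> * of_int S' = (2 * of_int m :: rat)"
        using arg_cong[OF m, of "of_int :: int \<Rightarrow> rat"] by simp
      then show "p = of_int m * 1 + of_int (Q' - \<epsilon> * S') * (1/2) + of_int (R' - \<epsilon> * S') * (1/2) + of_int ?k3 * (1/4)"
        unfolding co by (simp add: field_simps)
      show "q = of_int (Q' - \<epsilon> * S') * (1/2) + of_int (R' - \<epsilon> * S') * 0 + of_int ?k3 * (1/4)"
        unfolding co by (simp add: field_simps)
      show "r = of_int (R' - \<epsilon> * S') * (1/2) + of_int ?k3 * (1/4)"
        unfolding co by (simp add: field_simps)
      have "of_int ?k3 * of_int \<epsilon> = (of_int (2 * (\<epsilon> * (\<epsilon> * S')) + o1 * \<epsilon>) :: rat)"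
        unfolding of_int_mult[symmetric] of_int_eq_iff by (simp add: algebra_simps)
      then show "s = of_int ?k3 * (of_int \<epsilon> / 4)"
        unfolding co \<epsilon>\<epsilon> by (simp only: times_divide_eq_right) (simp add: field_simps)
    qed
  qed simp_all
qed

text \<open>The integral basis is \<open>1\<close>, \<open>(1 + r1)/2\<close>, \<open>r2\<close>,
  \<open>(r2 + r3)/2\<close>, with diagonal product 1/4. The radicands \<open>g v\<close> and
  \<open>u v\<close> are 3 modulo 4, so the coordinates of an integer have denominator at most 2,
  and the relative norm gives the congruences inside the pairs \<open>P', Q'\<close> and
  \<open>R', S'\<close>.\<close>

lemma discriminant_not_congruent:
  assumes odd: "odd g" "odd u" "odd v" and cong: "g mod 4 = u mod 4" "g mod 4 \<noteq> v mod 4"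
  shows "discriminant K = 16 * (g * u * v)\<^sup>2"
proof -
  have gu: "g mod 4 = 1 \<and> u mod 4 = 1 \<and> v mod 4 = 3 \<or> g mod 4 = 3 \<and> u mod 4 = 3 \<and> v mod 4 = 1"
    using odd cong by presburger
  then have k: "(g * u) mod 4 = 1" "(g * v) mod 4 = 3" "(u * v) mod 4 = 3"
    using mult_mod_4[of g 1 u 1] mult_mod_4[of g 1 v 3] mult_mod_4[of u 1 v 3]
      mult_mod_4[of g 3 u 3] mult_mod_4[of g 3 v 1] mult_mod_4[of u 3 v 1] by auto
  have h: "algebraic_int ((1 + r1) / 2)"
    using k products_pos by (auto intro!: algebraic_int_half_one_plus_csq)
  have h1: "elt (1/2) (1/2) 0 0 = (1 + r1) / 2"
    by (simp add: elt_def of_rat_divide add_divide_distrib)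
  have "4 dvd g + u - 2" using gu by presburger
  then obtain t where "g + u - 2 = 4 * t" by (rule dvdE)
  then have t: "g + u = 4 * t + 2" by simp
  have w: "algebraic_int (elt 0 0 (1/2) (1/2))"
  proof -
    have gu': "(of_int g + of_int u :: rat) = 4 * of_int t + 2" using arg_cong[OF t, of "of_int :: int \<Rightarrow> rat"] by simp
    \<comment> \<open>Integrality through the square:
      \<open>((r2 + r3)/2)^2 = v (g + u + 2 r1)/4 = v (t + (1 + r1)/2)\<close>.\<close>
    have "elt 0 0 (1/2) (1/2) * elt 0 0 (1/2) (1/2) = elt (of_int v) (of_int 0) (of_int 0) (of_int 0) *
        (elt (of_int t) (of_int 0) (of_int 0) (of_int 0) + elt (1/2) (1/2) 0 0)"
      unfolding elt_mult elt_add
    proof (rule elt_cong)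
      have "1 / 4 * ((of_int g + of_int u) * of_int v) = (of_int v * (of_int t + 1 / 2) :: rat)"
        unfolding gu' by (simp add: field_simps)
      then show "0 * 0 + 0 * 0 * of_int (g * u) + 1 / 2 * (1 / 2) * of_int (g * v) + 1 / 2 * (1 / 2) * of_int (u * v) =
        of_int v * (of_int t + 1 / 2) + of_int 0 * (of_int 0 + 1 / 2) * of_int (g * u) + of_int 0 * (of_int 0 + 0) * of_int (g * v) +
        of_int 0 * (of_int 0 + 0) * (of_int (u * v) :: rat)"
        by (simp add: algebra_simps)
    qed simp_all
    also have "algebraic_int \<dots>"
      using h unfolding h1 by (intro algebraic_int_mult algebraic_int_add algebraic_int_elt_of_int)
    finally have "algebraic_int (poly (monom 1 2) (elt 0 0 (1/2) (1/2)))" by (simp add: poly_monom power2_eq_square)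
    from algebraic_int_root[OF this refl] show ?thesis by (simp add: degree_monom_eq)
  qed
  show ?thesis
  proof (rule triangular_integral_basis[of 1 "1/2" "1/2" 0 0 1 0 0 "1/2" "1/2"])
    show "algebraic_int (elt 1 0 0 0)" "algebraic_int (elt 0 0 1 0)" using products_pos by (simp_all add: elt_rs)
    show "algebraic_int (elt (1/2) (1/2) 0 0)" unfolding h1 by (rule h)
    show "algebraic_int (elt 0 0 (1/2) (1/2))" by (rule w)
    show "of_int (16 * (g * u * v)\<^sup>2) = 256 * of_int ((g * u * v)\<^sup>2) * (1 * (1 / 2) * 1 * (1 / 2) :: rat)\<^sup>2"
      by (simp add: power2_eq_square)
    fix p q r s assume ai: "algebraic_int (elt p q r s)"
    obtain P Q R S n1 n2 n3 where T: "4 * p = of_int P" "4 * q = of_int Q" "4 * r = of_int R" "4 * s = of_int S"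
      and n: "P\<^sup>2 - (g * u) * Q\<^sup>2 = 4 * n1" "P\<^sup>2 - (g * v) * R\<^sup>2 = 4 * n2" "P\<^sup>2 - (u * v) * S\<^sup>2 = 4 * n3"
      by (rule integer_traces[OF ai])
    have ev: "even P" "even Q" "even R" "even S"
      using quadratic_parity_odd[OF _ n(1)] quadratic_parity_3_mod_4[OF k(2) n(2)] quadratic_parity_3_mod_4[OF k(3) n(3)] odd by simp_all
    obtain P' where P': "P = 2 * P'" using ev(1) by (rule evenE)
    obtain Q' where Q': "Q = 2 * Q'" using ev(2) by (rule evenE)
    obtain R' where R': "R = 2 * R'" using ev(3) by (rule evenE)
    obtain S' where S': "S = 2 * S'" using ev(4) by (rule evenE)
    have co: "p = of_int P' / 2" "q = of_int Q' / 2" "r = of_int R' / 2" "s = of_int S' / 2"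
      using T unfolding P' Q' R' S' by simp_all
    obtain a b n' where ab: "2 * a = P'\<^sup>2 + (g * u) * Q'\<^sup>2 - (g * v) * R'\<^sup>2 - (u * v) * S'\<^sup>2" "b = P' * Q' - R' * S' * v"
        "a\<^sup>2 - (g * u) * b\<^sup>2 = 4 * n'"
      by (rule relative_norm_conditions[OF ai[unfolded co]])
    from relative_norm_parity[OF ab k] have "even (P' - Q')" "even (R' - S')" by auto
    then obtain m l where m: "P' - Q' = 2 * m" and l: "R' - S' = 2 * l" unfolding dvd_def by blast
    have ml: "of_int P' - of_int Q' = (2 * of_int m :: rat)" "of_int R' - of_int S' = (2 * of_int l :: rat)"
      using arg_cong[OF m, of "of_int :: int \<Rightarrow> rat"] arg_cong[OF l, of "of_int :: int \<Rightarrow> rat"] by simp_all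
    show "\<exists>k0 k1 k2 k3 :: int.
      p = of_int k0 * 1 + of_int k1 * (1/2) + of_int k2 * 0 + of_int k3 * 0 \<and>
      q = of_int k1 * (1/2) + of_int k2 * 0 + of_int k3 * 0 \<and>
      r = of_int k2 * 1 + of_int k3 * (1/2) \<and> s = of_int k3 * (1/2)"
      unfolding co by (rule exI[of _ m], rule exI[of _ Q'], rule exI[of _ l], rule exI[of _ S']) (use ml in \<open>simp add: field_simps\<close>)
  qed simp_all
qed

end

section \<open>Fields and triples\<close>

text \<open>The factor \<open>q\<close> is an integer because \<open>b\<close> is squarefree, and
  its square divides the squarefree \<open>a\<close>.\<close>

lemma squarefree_rat_square_eq:
  fixes a b :: int and q :: rat
  assumes "squarefree a" "squarefree b" "a > 0" "b > 0" "of_int a = q\<^sup>2 * of_int b"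
  shows "a = b"
proof -
  have "q\<^sup>2 * of_int b \<in> \<int>" unfolding assms(5)[symmetric] by simp
  then have "q \<in> \<int>" by (rule rat_in_Ints_of_square_mult_squarefree[OF assms(2)])
  then obtain n where n: "q = of_int n" by (rule Ints_cases)
  have "(of_int a :: rat) = of_int (n\<^sup>2 * b)" using assms(5) unfolding n by simp
  then have a: "a = n\<^sup>2 * b" by (simp only: of_int_eq_iff)
  then have "n\<^sup>2 dvd a" by simp
  then have "n dvd 1" by (rule squarefreeD[OF assms(1)])
  then have "\<bar>n\<bar> = 1" by simp
  then have "n\<^sup>2 = 1" by (simp add: abs_square_eq_1)
  then show ?thesis using a by simp
qed

text \<open>Adjoining all three roots makes invariance under permutations of the triple
  immediate.\<close>

definition field_of_triple :: "int \<Rightarrow> int \<Rightarrow> int \<Rightarrow> complex set" where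
  "field_of_triple g u v = rat_adjoin {csq (g * u), csq (g * v), csq (u * v)}"

lemma field_of_triple_commute:
  "field_of_triple u g v = field_of_triple g u v"
  "field_of_triple g v u = field_of_triple g u v"
  "field_of_triple v u g = field_of_triple g u v"
  unfolding field_of_triple_def by (simp_all add: mult.commute insert_commute)

context biquadratic
begin

lemma field_of_triple_eq_K: "field_of_triple g u v = K"
proof
  show "field_of_triple g u v \<subseteq> K"
    unfolding field_of_triple_def by (rule rat_adjoin_subset[OF subfield_K]) (auto simp flip: elt_rs)
  have "rat_adjoin {r1, r2} \<subseteq> field_of_triple g u v"
    unfolding field_of_triple_def rat_adjoin_def by blast
  then show "K \<subseteq> field_of_triple g u v" unfolding rat_adjoin_eq_K .
qed

text \<open>Every automorphism sends the root of \<open>k\<close> to itself or to its negative. Two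
  of them already leave at most one nonzero coordinate, so the root is a rational multiple of
  \<open>1\<close>, \<open>r1\<close>, \<open>r2\<close> or \<open>r3\<close>. The first is
  impossible, and otherwise the squarefree radicands agree.\<close>

lemma csq_in_K:
  assumes k: "squarefree k" "k > 0" "k \<noteq> 1" and "csq k \<in> K"
  shows "k \<in> {g * u, g * v, u * v}"
proof -
  obtain p q r s where x: "csq k = elt p q r s" using assms(4) by (rule KE)
  have sgn: "conj e f (csq k) = csq k \<or> conj e f (csq k) = - csq k" if "e \<in> {1, - 1}" "f \<in> {1, - 1}" for e f
  proof -
    note E = embeddingD[OF subfield_K conj_embedding[OF that]]
    have "conj e f (csq k) * conj e f (csq k) = conj e f (csq k * csq k)" using E(2)[OF assms(4,4)] by simp
    also have "\<dots> = csq k * csq k" using k(2) E(6) by (simp add: csq_mult_self)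
    finally show ?thesis by (simp add: square_eq_iff)
  qed
  have neg: "- elt p q r s = elt (- p) (- q) (- r) (- s)" by (simp add: elt_def of_rat_minus)
  have 1: "r = 0 \<and> s = 0 \<or> p = 0 \<and> q = 0"
    using sgn[of 1 "-1"] unfolding x conj_elt neg elt_eq_iff by auto
  have 2: "q = 0 \<and> s = 0 \<or> p = 0 \<and> r = 0"
    using sgn[of "-1" 1] unfolding x conj_elt neg elt_eq_iff by auto
  have not_rat: "csq k \<noteq> of_rat t" for t
  proof
    assume "csq k = of_rat t"
    then have "of_rat (- t) + of_rat 1 * csq k = 0" by (simp add: of_rat_minus)
    then show False using csq_lin_indep(2)[OF k] by fastforce
  qed
  have single: "k = m" if m: "csq k = of_rat t * csq m" "squarefree m" "m > 0" for t m
  proof -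
    have "(of_rat (of_int k) :: complex) = csq k * csq k" using k(2) by (simp add: csq_mult_self)
    also have "\<dots> = of_rat t * of_rat t * (csq m * csq m)" unfolding m(1) by (simp only: mult_ac)
    also have "\<dots> = of_rat (t\<^sup>2 * of_int m)" using m(3) by (simp add: csq_mult_self power2_eq_square of_rat_mult)
    finally have "of_int k = t\<^sup>2 * of_int m" by (simp only: of_rat_eq_iff)
    then show ?thesis by (rule squarefree_rat_square_eq[OF k(1) m(2) k(2) m(3)])
  qed
  consider "q = 0" "r = 0" "s = 0" | "p = 0" "r = 0" "s = 0" | "p = 0" "q = 0" "s = 0" | "p = 0" "q = 0" "r = 0"
    using 1 2 by blast
  then show ?thesis
  proof cases
    case 1
    then show ?thesis using x not_rat[of p] by (simp add: elt_def)
  next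
    case 2
    then have "csq k = of_rat q * r1" using x by (simp add: elt_def)
    from single[OF this squarefree_products(1) products_pos(1)] show ?thesis by simp
  next
    case 3
    then have "csq k = of_rat r * r2" using x by (simp add: elt_def)
    from single[OF this squarefree_products(2) products_pos(2)] show ?thesis by simp
  next
    case 4
    then have "csq k = of_rat s * r3" using x by (simp add: elt_def)
    from single[OF this squarefree_products(3) products_pos(3)] show ?thesis by simp
  qed
qed

text \<open>The left side depends on the field alone, which makes the triple recoverable from
  it.\<close>

lemma products_eq:
  "{k. squarefree k \<and> k > 0 \<and> k \<noteq> 1 \<and> csq k \<in> K} = {g * u, g * v, u * v}"
proof
  show "{k. squarefree k \<and> k > 0 \<and> k \<noteq> 1 \<and> csq k \<in> K} \<subseteq> {g * u, g * v, u * v}"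
    using csq_in_K by blast
  have "r1 \<in> K" "r2 \<in> K" "r3 \<in> K" by (auto simp flip: elt_rs)
  then show "{g * u, g * v, u * v} \<subseteq> {k. squarefree k \<and> k > 0 \<and> k \<noteq> 1 \<and> csq k \<in> K}"
    using squarefree_products products_pos nontriv by simp
qed

end

text \<open>Increasing entries order the products, \<open>g u < g v < u v\<close>, so equality of
  the sets of radicands becomes equality of each product; then
  \<open>g^2 = (g u) (g v) / (u v)\<close> recovers \<open>g\<close>.\<close>

lemma field_of_triple_inj:
  assumes b: "biquadratic g u v" "biquadratic g' u' v'"
    and lt: "g < u" "u < v" "g' < u'" "u' < v'"
    and eq: "field_of_triple g u v = field_of_triple g' u' v'"
  shows "g = g' \<and> u = u' \<and> v = v'"
proof -
  interpret a: biquadratic g u v by (rule b)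
  interpret c: biquadratic g' u' v' by (rule b)
  define x y z x' y' z' where "x = g * u" and "y = g * v" and "z = u * v" and "x' = g' * u'" and "y' = g' * v'" and "z' = u' * v'"
  have "a.K = c.K" using eq a.field_of_triple_eq_K c.field_of_triple_eq_K by simp
  then have "{g * u, g * v, u * v} = {g' * u', g' * v', u' * v'}"
    using a.products_eq c.products_eq by simp
  then have "{x, y, z} = {x', y', z'}" by (simp only: x_def y_def z_def x'_def y'_def z'_def)
  then have d: "x = x' \<or> x = y' \<or> x = z'" "y = x' \<or> y = y' \<or> y = z'" "z = x' \<or> z = y' \<or> z = z'" by blast+
  have o: "x < y" "y < z" "x' < y'" "y' < z'"
    using lt a.pos c.pos unfolding x_def y_def z_def x'_def y'_def z'_def
    by (simp_all add: mult_strict_left_mono mult_strict_right_mono)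
  have "x = x'" using d o by (elim disjE; linarith)
  moreover have "z = z'" using d o by (elim disjE; linarith)
  moreover have "y = y'" using d o by (elim disjE; linarith)
  ultimately have "x = x' \<and> y = y' \<and> z = z'" by blast
  then have e: "g * u = g' * u'" "g * v = g' * v'" "u * v = u' * v'"
    by (simp_all add: x_def y_def z_def x'_def y'_def z'_def)
  have "g\<^sup>2 * (u * v) = (g * u) * (g * v)" by (simp add: power2_eq_square mult_ac)
  also have "\<dots> = (g' * u') * (g' * v')" unfolding e ..
  also have "\<dots> = g'\<^sup>2 * (u * v)" unfolding e(3) by (simp add: power2_eq_square mult_ac)
  finally have "g\<^sup>2 = g'\<^sup>2" using a.pos by simp
  then have gg: "g = g'" using a.pos(1) c.pos(1) power2_eq_iff_nonneg[of g g'] by simp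
  then show ?thesis using e(1,2) a.pos(1) c.pos(1) by simp
qed

text \<open>Among three odd residues modulo 4 two coincide; a permutation moves that pair to the
  first two places, where the computations above apply.\<close>

lemma discriminant_field_of_triple:
  assumes "biquadratic g u v" "odd g" "odd u" "odd v"
  shows "discriminant (field_of_triple g u v) =
    (if g mod 4 = u mod 4 \<and> g mod 4 = v mod 4 then 1 else 16) * (g * u * v)\<^sup>2"
proof -
  have "g mod 4 = 1 \<or> g mod 4 = 3" using assms(2) by presburger
  moreover have "u mod 4 = 1 \<or> u mod 4 = 3" using assms(3) by presburger
  moreover have "v mod 4 = 1 \<or> v mod 4 = 3" using assms(4) by presburger
  ultimately have "g mod 4 = u mod 4 \<or> g mod 4 = v mod 4 \<or> v mod 4 = u mod 4" by (elim disjE) simp_all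
  then consider "g mod 4 = u mod 4" "g mod 4 = v mod 4" | "g mod 4 = u mod 4" "g mod 4 \<noteq> v mod 4"
    | "g mod 4 = v mod 4" "g mod 4 \<noteq> u mod 4" | "v mod 4 = u mod 4" "v mod 4 \<noteq> g mod 4"
    by metis
  then show ?thesis
  proof cases
    case 1
    interpret biquadratic g u v by (rule assms(1))
    show ?thesis using discriminant_congruent[OF assms(2-4) 1] 1 by (simp add: field_of_triple_eq_K)
  next
    case 2
    interpret biquadratic g u v by (rule assms(1))
    show ?thesis using discriminant_not_congruent[OF assms(2-4) 2] 2 by (simp add: field_of_triple_eq_K)
  next
    case 3
    interpret a: biquadratic g u v by (rule assms(1))
    interpret b: biquadratic g v u by (rule a.biquadratic_swap)
    show ?thesis using b.discriminant_not_congruent[OF assms(2,4,3) 3] 3 b.field_of_triple_eq_K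
      by (simp add: field_of_triple_commute(2)[of g u v] mult_ac)
  next
    case 4
    interpret a: biquadratic g u v by (rule assms(1))
    interpret b: biquadratic v u g by (rule a.biquadratic_swap)
    show ?thesis using b.discriminant_not_congruent[OF assms(4,3,2) 4] 4 b.field_of_triple_eq_K
      by (auto simp: field_of_triple_commute(3)[of v u g] mult_ac)
  qed
qed

text \<open>Rules out degenerate generators: if all of them lie in a single
  \<open>Q(sqrt m)\<close>, the degree cannot be 4. The value \<open>m = 1\<close>, where this field
  is the rationals, is included.\<close>

lemma field_degree_rat_adjoin_quadratic:
  assumes m: "squarefree m" "m > 0" and "A \<subseteq> {of_rat p + of_rat q * csq m | p q. True}"
  shows "field_degree (rat_adjoin A) \<le> 2"
proof -
  define F where "F = {of_rat p + of_rat q * csq m | p q. True}"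
  have FI: "of_rat p + of_rat q * csq m \<in> F" for p q by (auto simp: F_def)
  have mm: "csq m * csq m = of_rat (of_int m)" using m by (simp add: csq_mult_self)
  have "complex_subfield F"
    unfolding complex_subfield_def
  proof (intro conjI ballI)
    show "1 \<in> F" using FI[of 1 0] by simp
    fix x assume "x \<in> F"
    then obtain p q where x: "x = of_rat p + of_rat q * csq m" by (auto simp: F_def)
    show "inverse x \<in> F"
    proof (cases "x = 0")
      case True then show ?thesis using FI[of 0 0] by simp
    next
      case x0: False
      define N where "N = p * p - q * q * of_int m"
      have "x * (of_rat p - of_rat q * csq m) = of_rat p * of_rat p - of_rat q * csq m * (of_rat q * csq m)"
        unfolding x by (rule square_diff_square_factored[symmetric])
      also have "of_rat q * csq m * (of_rat q * csq m) = of_rat q * of_rat q * (csq m * csq m)" by (simp only: mult_ac)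
      also have "of_rat p * of_rat p - of_rat q * of_rat q * (csq m * csq m) = of_rat N"
        unfolding mm N_def by (simp only: of_rat_mult of_rat_diff)
      finally have xN: "x * (of_rat p - of_rat q * csq m) = of_rat N" .
      show ?thesis
      proof (cases "N = 0")
        case False
        have "x * (of_rat (p / N) + of_rat (- q / N) * csq m) = x * (of_rat p - of_rat q * csq m) / of_rat N"
          by (simp add: of_rat_divide of_rat_minus diff_divide_distrib right_diff_distrib)
        also have "\<dots> = 1" unfolding xN using False by simp
        finally show ?thesis using FI[of "p / N" "- q / N"] by (metis inverse_unique)
      next
        \<comment> \<open>For nonzero \<open>x\<close> the norm can vanish only if
          \<open>m = 1\<close>, and then \<open>x\<close> itself is rational.\<close>
        case True
        then have "p\<^sup>2 = q\<^sup>2 * of_int m" by (simp add: N_def power2_eq_square)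
        then have "m \<noteq> 1 \<Longrightarrow> p = 0 \<and> q = 0" using rat_square_eq_squarefree_mult_square[OF m] by blast
        moreover have "\<not> (p = 0 \<and> q = 0)" using x0 x by auto
        ultimately have "m = 1" by blast
        then have "x = of_rat (p + q)" using x by (simp add: csq_def of_rat_add)
        then have "inverse x = of_rat (inverse (p + q)) + of_rat 0 * csq m" by (simp add: of_rat_inverse)
        then show ?thesis using FI by metis
      qed
    qed
  next
    fix x y assume "x \<in> F" "y \<in> F"
    then obtain p q p' q' where xy: "x = of_rat p + of_rat q * csq m" "y = of_rat p' + of_rat q' * csq m" by (auto simp: F_def)
    have "x - y = of_rat (p - p') + of_rat (q - q') * csq m" unfolding xy by (simp add: of_rat_diff left_diff_distrib)
    then show "x - y \<in> F" using FI by metis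
    have "x * y = of_rat p * of_rat p' + of_rat q * of_rat q' * (csq m * csq m) + (of_rat p * of_rat q' + of_rat q * of_rat p') * csq m"
      unfolding xy by (simp only: distrib_left distrib_right mult_ac add_ac)
    then have "x * y = of_rat (p * p' + q * q' * of_int m) + of_rat (p * q' + q * p') * csq m"
      unfolding mm by (simp only: of_rat_mult of_rat_add)
    then show "x * y \<in> F" using FI by metis
  qed
  then have "rat_adjoin A \<subseteq> F" using assms(3) by (intro rat_adjoin_subset) (simp_all add: F_def)
  also have "F \<subseteq> ratc.span {1, csq m}"
  proof
    fix x assume "x \<in> F"
    then obtain p q where "x = of_rat p + of_rat q * csq m" by (auto simp: F_def)
    then have x: "x = of_rat p * 1 + of_rat q * csq m" by simp
    show "x \<in> ratc.span {1, csq m}" unfolding x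
      by (intro ratc.span_add ratc.span_scale ratc.span_base) auto
  qed
  finally have "ratc.dim (rat_adjoin A) \<le> card {1, csq m}" by (intro ratc.dim_le_card) simp_all
  also have "\<dots> \<le> 2" by (simp add: card_insert_if)
  finally show ?thesis by (simp add: field_degree_eq_dim)
qed

text \<open>Given generators \<open>a\<close> and \<open>b\<close>, the triple is
  \<open>g = gcd a b\<close> with the two cofactors; degree 4 excludes \<open>a = 1\<close>,
  \<open>b = 1\<close> and \<open>a = b\<close>, which are exactly the degenerate products.\<close>

lemma biquadratic_family_eq:
  "biquadratic_family = {field_of_triple g u v | g u v. biquadratic g u v \<and> odd g \<and> odd u \<and> odd v}"
proof (intro equalityI subsetI)
  fix L assume "L \<in> {field_of_triple g u v | g u v. biquadratic g u v \<and> odd g \<and> odd u \<and> odd v}"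
  then obtain g u v where L: "L = field_of_triple g u v" "biquadratic g u v" "odd g" "odd u" "odd v" by blast
  interpret biquadratic g u v by (rule L(2))
  have "L = rat_adjoin {csqrt (of_int (g * u)), csqrt (of_int (g * v))}"
    unfolding L(1) field_of_triple_eq_K rat_adjoin_eq_K[symmetric]
      csqrt_of_int[OF less_imp_le[OF products_pos(1)]] csqrt_of_int[OF less_imp_le[OF products_pos(2)]] ..
  then show "L \<in> biquadratic_family"
    unfolding biquadratic_family_def
  proof (intro CollectI exI conjI)
    show "field_degree L = 4" unfolding L(1) field_of_triple_eq_K by (rule field_degree_K)
    show "0 < g * u" "0 < g * v" by (rule products_pos)+
    show "odd (g * u)" "odd (g * v)" using L(3-5) by simp_all
    show "squarefree (g * u)" "squarefree (g * v)" by (rule squarefree_products)+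
  qed
next
  fix L assume "L \<in> biquadratic_family"
  then obtain a b :: int where ab: "0 < a" "0 < b" "odd a" "odd b" "squarefree a" "squarefree b"
    and L: "L = rat_adjoin {csqrt (of_int a), csqrt (of_int b)}" "field_degree L = 4"
    unfolding biquadratic_family_def by blast
  have L': "L = rat_adjoin {csq a, csq b}"
    unfolding L(1) csqrt_of_int[OF less_imp_le[OF ab(1)]] csqrt_of_int[OF less_imp_le[OF ab(2)]] ..
  have memb1: "csq m \<in> {of_rat p + of_rat q * csq m | p q. True}" for m
    by (intro CollectI exI[of _ 0] exI[of _ 1]) simp
  have memb2: "1 \<in> {of_rat p + of_rat q * csq m | p q. True}" for m
    by (rule CollectI, rule exI[of _ 1], rule exI[of _ 0]) simp
  have one: "csq 1 = 1" by (simp add: csq_def)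
  have deg: "\<not> {csq a, csq b} \<subseteq> {of_rat p + of_rat q * csq m | p q. True}" if "squarefree m" "m > 0" for m
    using field_degree_rat_adjoin_quadratic[OF that, of "{csq a, csq b}"] L(2) unfolding L' by auto
  have a1: "a \<noteq> 1"
  proof
    assume "a = 1"
    then have "csq a = 1" using one by simp
    then have "{csq a, csq b} \<subseteq> {of_rat p + of_rat q * csq b | p q. True}"
      by (simp only:) (intro insert_subsetI memb1 memb2 empty_subsetI)
    then show False using deg[OF ab(6,2)] by contradiction
  qed
  have b1: "b \<noteq> 1"
  proof
    assume "b = 1"
    then have "csq b = 1" using one by simp
    then have "{csq a, csq b} \<subseteq> {of_rat p + of_rat q * csq a | p q. True}"
      by (simp only:) (intro insert_subsetI memb1 memb2 empty_subsetI)
    then show False using deg[OF ab(5,1)] by contradiction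
  qed
  have "a \<noteq> b" using deg[OF ab(5,1)] memb1[of a] by auto
  define g where "g = gcd a b"
  have "gcd a b \<noteq> 0" using ab(1) by simp
  then obtain u v where uv': "a = u * g" "b = v * g" "coprime u v"
    using gcd_coprime_exists[of a b] unfolding g_def by blast
  have uv: "a = g * u" "b = g * v" "coprime u v"
    using uv'(3) by (simp_all only: uv'(1,2)) (rule mult.commute)+
  have pos: "g > 0" "u > 0" "v > 0"
  proof -
    show "g > 0" using ab(1) by (simp add: g_def)
    then show "u > 0" "v > 0" using ab(1,2) unfolding uv(1,2) by (simp_all add: zero_less_mult_iff)
  qed
  have cop: "coprime g v"
  proof (rule coprimeI)
    fix d assume "d dvd g" "d dvd v"
    then have "d\<^sup>2 dvd b" unfolding uv(2) power2_eq_square by (rule mult_dvd_mono)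
    then show "d dvd 1" by (rule squarefreeD[OF ab(6)])
  qed
  have "squarefree v" using ab(6) uv(2) by (metis dvd_triv_right squarefree_mono)
  moreover have "coprime (g * u) v" using cop uv(3) by simp
  ultimately have "squarefree (g * u * v)"
    using ab(5) squarefree_mult_coprime[of "g * u" v] unfolding uv(1) by blast
  moreover have "u * v \<noteq> 1"
  proof
    assume "u * v = 1"
    then have "u = 1" "v = 1" using pos by (auto simp: pos_zmult_eq_1_iff)
    then show False using \<open>a \<noteq> b\<close> uv by simp
  qed
  ultimately have bi: "biquadratic g u v" using pos a1 b1 unfolding uv(1,2) by unfold_locales auto
  interpret biquadratic g u v by (rule bi)
  have "L = field_of_triple g u v" unfolding L' uv field_of_triple_eq_K by (rule rat_adjoin_eq_K)
  moreover have "odd g" "odd u" "odd v" using ab uv by auto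
  ultimately show "L \<in> {field_of_triple g u v | g u v. biquadratic g u v \<and> odd g \<and> odd u \<and> odd v}"
    using bi by blast
qed

section \<open>Counting triples\<close>

text \<open>The six orderings of three distinct numbers partition \<open>S\<close>, and a
  permutation of coordinates matches each class with the increasing one.\<close>

lemma card_symmetric_triples:
  fixes S :: "(nat \<times> nat \<times> nat) set"
  assumes fin: "finite S" and sym: "\<And>a b c. (a, b, c) \<in> S \<Longrightarrow> (b, a, c) \<in> S" "\<And>a b c. (a, b, c) \<in> S \<Longrightarrow> (a, c, b) \<in> S"
    and dist: "\<And>a b c. (a, b, c) \<in> S \<Longrightarrow> a \<noteq> b \<and> a \<noteq> c \<and> b \<noteq> c"
  shows "card S = 6 * card {(a, b, c) \<in> S. a < b \<and> b < c}"
proof -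
  define C where "C = (\<lambda>P :: nat \<Rightarrow> nat \<Rightarrow> nat \<Rightarrow> bool. {(a, b, c) \<in> S. P a b c})"
  let ?O = "C (\<lambda>a b c. a < b \<and> b < c)"
  have finC: "finite (C P)" for P unfolding C_def by (rule finite_subset[OF _ fin]) auto
  have cP: "card (C P) = (\<Sum>t\<in>S. case t of (a, b, c) \<Rightarrow> if P a b c then 1 else 0)" for P
  proof -
    have "(\<Sum>t\<in>S. case t of (a, b, c) \<Rightarrow> if P a b c then 1 else 0) = (\<Sum>t\<in>C P. 1 :: nat)"
      by (rule sum.mono_neutral_cong_right[OF fin]) (auto simp: C_def split: if_splits)
    then show ?thesis by simp
  qed
  have bij: "card (C P) = card ?O"
    if f: "\<And>a b c. (a, b, c) \<in> S \<Longrightarrow> P a b c \<Longrightarrow> f (a, b, c) \<in> ?O"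
      and f': "\<And>a b c. (a, b, c) \<in> S \<Longrightarrow> a < b \<Longrightarrow> b < c \<Longrightarrow> f' (a, b, c) \<in> C P"
      and inv: "\<And>a b c. f' (f (a, b, c)) = (a, b, c)" "\<And>a b c. f (f' (a, b, c)) = (a, b, c)" for P f f'
  proof (rule bij_betw_same_card[of f], rule bij_betw_byWitness[where f' = f'])
    have "f' (f t) = t \<and> f (f' t) = t" for t by (cases t rule: prod_cases3) (simp add: inv)
    then show "\<forall>t\<in>C P. f' (f t) = t" "\<forall>t\<in>?O. f (f' t) = t" by blast+
    show "f ` C P \<subseteq> ?O"
    proof
      fix x assume "x \<in> f ` C P"
      then obtain a b c where "x = f (a, b, c)" "(a, b, c) \<in> S" "P a b c" unfolding C_def by auto
      then show "x \<in> ?O" using f[of a b c] by simp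
    qed
    show "f' ` ?O \<subseteq> C P"
    proof
      fix x assume "x \<in> f' ` ?O"
      then obtain a b c where "x = f' (a, b, c)" "(a, b, c) \<in> S" "a < b" "b < c" unfolding C_def by auto
      then show "x \<in> C P" using f'[of a b c] by simp
    qed
  qed
  have CI: "(a, b, c) \<in> C P" if "(a, b, c) \<in> S" "P a b c" for a b c P using that by (simp add: C_def)
  have s3: "(c, b, a) \<in> S" if "(a, b, c) \<in> S" for a b c by (rule sym(1)[OF sym(2)[OF sym(1)[OF that]]])
  have s4: "(b, c, a) \<in> S" if "(a, b, c) \<in> S" for a b c by (rule sym(2)[OF sym(1)[OF that]])
  have s5: "(c, a, b) \<in> S" if "(a, b, c) \<in> S" for a b c by (rule sym(1)[OF sym(2)[OF that]])
  have b1: "card (C (\<lambda>a b c. b < a \<and> a < c)) = card ?O"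
  proof (rule bij[of _ "\<lambda>(a, b, c). (b, a, c)" "\<lambda>(a, b, c). (b, a, c)"], goal_cases)
    case (1 a b c)
    show ?case unfolding prod.case by (rule CI[OF sym(1)[OF 1(1)]]) (use 1(2) in simp)
  next
    case (2 a b c)
    show ?case unfolding prod.case by (rule CI[OF sym(1)[OF 2(1)]]) (use 2(2,3) in simp)
  qed simp_all
  have b2: "card (C (\<lambda>a b c. a < c \<and> c < b)) = card ?O"
  proof (rule bij[of _ "\<lambda>(a, b, c). (a, c, b)" "\<lambda>(a, b, c). (a, c, b)"], goal_cases)
    case (1 a b c)
    show ?case unfolding prod.case by (rule CI[OF sym(2)[OF 1(1)]]) (use 1(2) in simp)
  next
    case (2 a b c)
    show ?case unfolding prod.case by (rule CI[OF sym(2)[OF 2(1)]]) (use 2(2,3) in simp)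
  qed simp_all
  have b3: "card (C (\<lambda>a b c. c < b \<and> b < a)) = card ?O"
  proof (rule bij[of _ "\<lambda>(a, b, c). (c, b, a)" "\<lambda>(a, b, c). (c, b, a)"], goal_cases)
    case (1 a b c)
    show ?case unfolding prod.case by (rule CI[OF s3[OF 1(1)]]) (use 1(2) in simp)
  next
    case (2 a b c)
    show ?case unfolding prod.case by (rule CI[OF s3[OF 2(1)]]) (use 2(2,3) in simp)
  qed simp_all
  \<comment> \<open>The two 3-cycles are inverse to each other, so here and in \<open>b5\<close> the
    map and its inverse differ.\<close>
  have b4: "card (C (\<lambda>a b c. b < c \<and> c < a)) = card ?O"
  proof (rule bij[of _ "\<lambda>(a, b, c). (b, c, a)" "\<lambda>(a, b, c). (c, a, b)"], goal_cases)
    case (1 a b c)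
    show ?case unfolding prod.case by (rule CI[OF s4[OF 1(1)]]) (use 1(2) in simp)
  next
    case (2 a b c)
    show ?case unfolding prod.case by (rule CI[OF s5[OF 2(1)]]) (use 2(2,3) in simp)
  qed simp_all
  have b5: "card (C (\<lambda>a b c. c < a \<and> a < b)) = card ?O"
  proof (rule bij[of _ "\<lambda>(a, b, c). (c, a, b)" "\<lambda>(a, b, c). (b, c, a)"], goal_cases)
    case (1 a b c)
    show ?case unfolding prod.case by (rule CI[OF s5[OF 1(1)]]) (use 1(2) in simp)
  next
    case (2 a b c)
    show ?case unfolding prod.case by (rule CI[OF s4[OF 2(1)]]) (use 2(2,3) in simp)
  qed simp_all
  have "card S = (\<Sum>t\<in>S. (case t of (a, b, c) \<Rightarrow> if a < b \<and> b < c then 1 else 0)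
      + (case t of (a, b, c) \<Rightarrow> if b < a \<and> a < c then 1 else 0) + (case t of (a, b, c) \<Rightarrow> if a < c \<and> c < b then 1 else 0)
      + (case t of (a, b, c) \<Rightarrow> if c < b \<and> b < a then 1 else 0) + (case t of (a, b, c) \<Rightarrow> if b < c \<and> c < a then 1 else 0)
      + (case t of (a, b, c) \<Rightarrow> if c < a \<and> a < b then 1 else 0))"
    unfolding card_eq_sum
  proof (rule sum.cong[OF refl])
    fix t assume t: "t \<in> S"
    obtain a b c where abc: "t = (a, b, c)" by (cases t) auto
    have "a \<noteq> b" "a \<noteq> c" "b \<noteq> c" using dist t abc by blast+
    then consider "a < b" "b < c" | "b < a" "a < c" | "a < c" "c < b" | "c < b" "b < a" | "b < c" "c < a" | "c < a" "a < b"
      by linarith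
    then show "1 = (case t of (a, b, c) \<Rightarrow> if a < b \<and> b < c then 1 else 0)
      + (case t of (a, b, c) \<Rightarrow> if b < a \<and> a < c then 1 else 0) + (case t of (a, b, c) \<Rightarrow> if a < c \<and> c < b then 1 else 0)
      + (case t of (a, b, c) \<Rightarrow> if c < b \<and> b < a then 1 else 0) + (case t of (a, b, c) \<Rightarrow> if b < c \<and> c < a then 1 else 0)
      + (case t of (a, b, c) \<Rightarrow> if c < a \<and> a < b then 1 else (0::nat))"
      unfolding abc by cases simp_all
  qed
  also have "\<dots> = 6 * card ?O"
    unfolding sum.distrib cP[symmetric] b1 b2 b3 b4 b5 by simp
  finally show ?thesis unfolding C_def .
qed

definition proper_triples :: "(nat \<times> nat \<times> nat) set" where
  "proper_triples = {(g, u, v). odd (g * u * v) \<and> squarefree (g * u * v) \<and> g * u \<noteq> 1 \<and> g * v \<noteq> 1 \<and> u * v \<noteq> 1}"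

definition triple_congruent :: "nat \<times> nat \<times> nat \<Rightarrow> bool" where
  "triple_congruent = (\<lambda>(g, u, v). g mod 4 = u mod 4 \<and> g mod 4 = v mod 4)"

definition triple_disc :: "nat \<times> nat \<times> nat \<Rightarrow> real" where
  "triple_disc t = (if triple_congruent t then 1 else 16) * (case t of (g, u, v) \<Rightarrow> real (g * u * v))\<^sup>2"

lemma squarefree_int_iff: "squarefree (int n) \<longleftrightarrow> squarefree n"
proof
  assume "squarefree (int n)"
  show "squarefree n"
  proof (rule squarefreeI)
    fix x assume "x\<^sup>2 dvd n"
    then have "(int x)\<^sup>2 dvd int n" by (metis int_dvd_int_iff of_nat_power)
    then have "int x dvd 1" by (rule squarefreeD[OF \<open>squarefree (int n)\<close>])
    then show "x dvd 1" by simp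
  qed
next
  assume "squarefree n"
  show "squarefree (int n)"
  proof (rule squarefreeI)
    fix x assume "x\<^sup>2 dvd int n"
    then have "int ((nat \<bar>x\<bar>)\<^sup>2) dvd int n" by simp
    then have "(nat \<bar>x\<bar>)\<^sup>2 dvd n" by (simp only: int_dvd_int_iff)
    then have "nat \<bar>x\<bar> dvd 1" by (rule squarefreeD[OF \<open>squarefree n\<close>])
    then show "x dvd 1" by simp
  qed
qed

lemma proper_triples_iff:
  "(g, u, v) \<in> proper_triples \<longleftrightarrow> biquadratic (int g) (int u) (int v) \<and> odd g \<and> odd u \<and> odd v"
proof -
  have e: "int g * int u = 1 \<longleftrightarrow> g * u = 1" "int g * int v = 1 \<longleftrightarrow> g * v = 1" "int u * int v = 1 \<longleftrightarrow> u * v = 1"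
    unfolding of_nat_mult[symmetric] of_nat_eq_1_iff by (rule refl)+
  have sq: "squarefree (int g * int u * int v) \<longleftrightarrow> squarefree (g * u * v)"
    using squarefree_int_iff[of "g * u * v"] by simp
  have "odd g \<Longrightarrow> g > 0" "odd u \<Longrightarrow> u > 0" "odd v \<Longrightarrow> v > 0" by (auto intro!: Nat.gr0I)
  then show ?thesis
    unfolding proper_triples_def biquadratic_def e sq by auto
qed

lemma triple_disc_eq:
  assumes "(g, u, v) \<in> proper_triples"
  shows "real_of_int \<bar>discriminant (field_of_triple (int g) (int u) (int v))\<bar> = triple_disc (g, u, v)"
proof -
  have b: "biquadratic (int g) (int u) (int v)" "odd (int g)" "odd (int u)" "odd (int v)"
    using assms by (simp_all add: proper_triples_iff)
  have m0: "int a mod 4 = int (a mod 4)" for a by (simp add: of_nat_mod)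
  have m: "int a mod 4 = int b mod 4 \<longleftrightarrow> a mod 4 = b mod 4" for a b by (simp only: m0 of_nat_eq_iff)
  show ?thesis
    unfolding discriminant_field_of_triple[OF b] m
    by (simp add: triple_disc_def triple_congruent_def abs_mult)
qed

text \<open>Two equal entries would put a square into the squarefree product, so both would be 1,
  against the condition that no product of two entries is 1.\<close>

lemma proper_triples_distinct:
  assumes "(a, b, c) \<in> proper_triples"
  shows "a \<noteq> b \<and> a \<noteq> c \<and> b \<noteq> c"
proof -
  have sf: "squarefree (a * b * c)" and n: "a * b \<noteq> 1" "a * c \<noteq> 1" "b * c \<noteq> 1"
    using assms by (auto simp: proper_triples_def)
  have key: "x = 1" if "x\<^sup>2 dvd a * b * c" for x :: nat using squarefreeD[OF sf that] by simp
  have "a \<noteq> b"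
  proof
    assume e: "a = b"
    then have "a * b * c = a\<^sup>2 * c" by (simp add: power2_eq_square mult_ac)
    then have "a\<^sup>2 dvd a * b * c" by (rule dvdI)
    then have "a = 1" by (rule key)
    then show False using e n(1) by simp
  qed
  moreover have "a \<noteq> c"
  proof
    assume e: "a = c"
    then have "a * b * c = a\<^sup>2 * b" by (simp add: power2_eq_square mult_ac)
    then have "a\<^sup>2 dvd a * b * c" by (rule dvdI)
    then have "a = 1" by (rule key)
    then show False using e n(2) by simp
  qed
  moreover have "b \<noteq> c"
  proof
    assume e: "b = c"
    then have "a * b * c = b\<^sup>2 * a" by (simp add: power2_eq_square mult_ac)
    then have "b\<^sup>2 dvd a * b * c" by (rule dvdI)
    then have "b = 1" by (rule key)
    then show False using e n(3) by simp
  qed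
  ultimately show ?thesis by blast
qed

lemma proper_triples_sym:
  "(a, b, c) \<in> proper_triples \<Longrightarrow> (b, a, c) \<in> proper_triples"
  "(a, b, c) \<in> proper_triples \<Longrightarrow> (a, c, b) \<in> proper_triples"
  by (auto simp: proper_triples_def mult_ac)

text \<open>Increasing triples form a system of representatives: \<open>field_of_triple_inj\<close>
  separates them, and sorting reaches every field.\<close>

lemma biquadratic_count_eq:
  "biquadratic_count X = card {(g, u, v) \<in> proper_triples. g < u \<and> u < v \<and> triple_disc (g, u, v) \<le> X}"
proof -
  let ?O = "{(g, u, v) \<in> proper_triples. g < u \<and> u < v \<and> triple_disc (g, u, v) \<le> X}"
  let ?f = "\<lambda>(g, u, v). field_of_triple (int g) (int u) (int v)"
  have inj: "inj_on ?f ?O"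
  proof (rule inj_onI)
    fix s t assume st: "s \<in> ?O" "t \<in> ?O" "?f s = ?f t"
    obtain g u v g' u' v' where e: "s = (g, u, v)" "t = (g', u', v')" by (cases s rule: prod_cases3, cases t rule: prod_cases3) blast
    have h: "(g, u, v) \<in> proper_triples" "(g', u', v') \<in> proper_triples" "g < u" "u < v" "g' < u'" "u' < v'"
      "field_of_triple (int g) (int u) (int v) = field_of_triple (int g') (int u') (int v')"
      using st unfolding e by simp_all
    have "int g = int g' \<and> int u = int u' \<and> int v = int v'"
      by (rule field_of_triple_inj[OF _ _ _ _ _ _ h(7)]) (use h in \<open>simp_all add: proper_triples_iff\<close>)
    then show "s = t" unfolding e by simp
  qed
  have img: "?f ` ?O = {K \<in> biquadratic_family. real_of_int \<bar>discriminant K\<bar> \<le> X}"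
  proof (intro equalityI subsetI)
    fix L assume "L \<in> ?f ` ?O"
    then obtain g u v where t: "L = field_of_triple (int g) (int u) (int v)" "(g, u, v) \<in> proper_triples" "triple_disc (g, u, v) \<le> X"
      by auto
    have "L \<in> biquadratic_family"
      unfolding biquadratic_family_eq t(1) using t(2)[unfolded proper_triples_iff]
      by (intro CollectI exI[of _ "int g"] exI[of _ "int u"] exI[of _ "int v"]) simp
    then show "L \<in> {K \<in> biquadratic_family. real_of_int \<bar>discriminant K\<bar> \<le> X}"
      using triple_disc_eq[OF t(2)] t(1,3) by simp
  next
    fix L assume "L \<in> {K \<in> biquadratic_family. real_of_int \<bar>discriminant K\<bar> \<le> X}"
    then have L: "L \<in> biquadratic_family" "real_of_int \<bar>discriminant L\<bar> \<le> X" by auto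
    from L(1) obtain g0 u0 v0 where b: "L = field_of_triple g0 u0 v0" "biquadratic g0 u0 v0" "odd g0" "odd u0" "odd v0"
      unfolding biquadratic_family_eq by blast
    \<comment> \<open>The invariant of the sorting: both adjacent swaps preserve it, and it forces
      distinct entries.\<close>
    define Q where "Q = (\<lambda>g u v. L = field_of_triple (int g) (int u) (int v) \<and> (g, u, v) \<in> proper_triples)"
    have p0: "int (nat g0) = g0" "int (nat u0) = u0" "int (nat v0) = v0"
      using biquadratic.pos[OF b(2)] by simp_all
    have "odd (int (nat g0))" "odd (int (nat u0))" "odd (int (nat v0))" unfolding p0 by (rule b)+
    then have "odd (nat g0)" "odd (nat u0)" "odd (nat v0)" by (simp_all only: even_of_nat not_False_eq_True)
    then have Q0: "Q (nat g0) (nat u0) (nat v0)" using b(1,2) unfolding Q_def proper_triples_iff p0 by simp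
    have swap1: "Q u g v" if "Q g u v" for g u v
      using that proper_triples_sym(1)[of g u v] unfolding Q_def field_of_triple_commute(1)[of "int g" "int u" "int v"] by blast
    have swap2: "Q g v u" if "Q g u v" for g u v
      using that proper_triples_sym(2)[of g u v] unfolding Q_def field_of_triple_commute(2)[of "int g" "int u" "int v"] by blast
    have ne: "g \<noteq> u \<and> g \<noteq> v \<and> u \<noteq> v" if "Q g u v" for g u v
      using that proper_triples_distinct[of g u v] unfolding Q_def by blast
    obtain g u v where q: "Q g u v" "g < u"
    proof (cases "nat g0 < nat u0")
      case True then show ?thesis using that[OF Q0] by blast
    next
      case False
      then have "nat u0 < nat g0" using ne[OF Q0] by linarith
      then show ?thesis using that[OF swap1[OF Q0]] by blast
    qed
    have "\<exists>g u v. Q g u v \<and> g < u \<and> u < v"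
    proof -
      consider "u < v" | "v < u" "g < v" | "v < g" using ne[OF q(1)] by linarith
      then show ?thesis
      proof cases
        case 1 then show ?thesis using q by blast
      next
        case 2 then show ?thesis using swap2[OF q(1)] by blast
      next
        case 3 then show ?thesis using swap1[OF swap2[OF q(1)]] q(2) by blast
      qed
    qed
    then obtain g u v where q': "Q g u v" "g < u" "u < v" by blast
    have t: "L = ?f (g, u, v)" "(g, u, v) \<in> proper_triples" using q'(1) by (simp_all add: Q_def)
    have "triple_disc (g, u, v) \<le> X" using triple_disc_eq[OF t(2)] L(2) t(1) by simp
    then have "(g, u, v) \<in> ?O" using t(2) q'(2,3) by simp
    then show "L \<in> ?f ` ?O" unfolding t(1) by (rule imageI)
  qed
  show ?thesis
    unfolding biquadratic_count_def img[symmetric] by (rule card_image[OF inj])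
qed

section \<open>Separating congruent from noncongruent triples\<close>

lemma finite_odd_squarefree_triples: "finite (odd_squarefree_triples x)"
proof -
  have "odd_squarefree_triples x \<subseteq> {..nat \<lceil>x\<rceil>} \<times> {..nat \<lceil>x\<rceil>} \<times> {..nat \<lceil>x\<rceil>}"
  proof
    fix t assume t: "t \<in> odd_squarefree_triples x"
    obtain g u v where e: "t = (g, u, v)" by (rule prod_cases3)
    have h: "odd g" "odd u" "odd v" "real (g * u * v) \<le> x"
      using t unfolding e odd_squarefree_triples_def by simp_all
    have "real (g * u * v) \<le> of_int \<lceil>x\<rceil>" using h(4) le_of_int_ceiling order_trans by blast
    then have "int (g * u * v) \<le> \<lceil>x\<rceil>" by (metis of_int_le_iff of_int_of_nat_eq)
    then have n: "g * u * v \<le> nat \<lceil>x\<rceil>" by (simp only: le_nat_iff)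
    have p: "g > 0" "u > 0" "v > 0" using h by (auto intro!: Nat.gr0I)
    have d: "g dvd g * u * v" "u dvd g * u * v" "v dvd g * u * v" by simp_all
    have "g * u * v > 0" using p by simp
    from d[THEN dvd_imp_le, OF this] have "g \<le> nat \<lceil>x\<rceil>" "u \<le> nat \<lceil>x\<rceil>" "v \<le> nat \<lceil>x\<rceil>"
      using n by (blast intro: order_trans)+
    then show "t \<in> {..nat \<lceil>x\<rceil>} \<times> {..nat \<lceil>x\<rceil>} \<times> {..nat \<lceil>x\<rceil>}" unfolding e by simp
  qed
  then show ?thesis by (rule finite_subset) auto
qed

text \<open>The factor 16 in the discriminant is the square of 4, hence the second cutoff
  \<open>sqrt X / 4\<close>.\<close>

lemma triple_disc_le_iff:
  assumes "X \<ge> 0"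
  shows "triple_disc (g, u, v) \<le> X \<longleftrightarrow>
    (if triple_congruent (g, u, v) then real (g * u * v) \<le> sqrt X else real (g * u * v) \<le> sqrt X / 4)"
proof -
  have "n\<^sup>2 \<le> X \<longleftrightarrow> n \<le> sqrt X" if "n \<ge> 0" for n :: real
    using real_sqrt_le_iff[of "n\<^sup>2" X] that by simp
  from this[of "real (g * u * v)"] this[of "4 * real (g * u * v)"] show ?thesis
    by (auto simp: triple_disc_def power_mult_distrib simp del: of_nat_mult)
qed

text \<open>Values of \<open>chi4\<close> at odd numbers are signs; the three pairwise products add
  up to 3 if all signs agree and to -1 otherwise.\<close>

lemma congruent_indicator:
  assumes "odd g" "odd u" "odd v"
  shows "(if triple_congruent (g, u, v) then 1 else 0) = (1 + chi4 g * chi4 u + chi4 g * chi4 v + chi4 u * chi4 v) / 4"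
proof -
  have o: "n mod 4 = 1 \<or> n mod 4 = 3" if "odd n" for n :: nat using that by presburger
  show ?thesis
    using o[OF assms(1)] o[OF assms(2)] o[OF assms(3)] assms unfolding triple_congruent_def chi4_def
    by (elim disjE) simp_all
qed

text \<open>By the symmetry of the set of triples this one sum stands for all three pairs of
  places.\<close>

definition chi4_triple_sum :: "real \<Rightarrow> real" where
  "chi4_triple_sum x = (\<Sum>(g, u, v)\<in>odd_squarefree_triples x. chi4 u * chi4 v)"

lemma odd_squarefree_triples_sym:
  "(g, u, v) \<in> odd_squarefree_triples x \<Longrightarrow> (v, u, g) \<in> odd_squarefree_triples x"
  "(g, u, v) \<in> odd_squarefree_triples x \<Longrightarrow> (u, g, v) \<in> odd_squarefree_triples x"
  by (simp_all add: odd_squarefree_triples_def mult_ac)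

lemma card_congruent:
  "real (card {t \<in> odd_squarefree_triples x. triple_congruent t}) =
     (real (card (odd_squarefree_triples x)) + 3 * chi4_triple_sum x) / 4"
proof -
  let ?S = "odd_squarefree_triples x"
  have s1: "(\<Sum>(g, u, v)\<in>?S. chi4 g * chi4 u) = chi4_triple_sum x"
    unfolding chi4_triple_sum_def
    by (rule sum.reindex_bij_witness[of _ "\<lambda>(g, u, v). (v, u, g)" "\<lambda>(g, u, v). (v, u, g)"])
       (auto intro: odd_squarefree_triples_sym(1))
  have s2: "(\<Sum>(g, u, v)\<in>?S. chi4 g * chi4 v) = chi4_triple_sum x"
    unfolding chi4_triple_sum_def
    by (rule sum.reindex_bij_witness[of _ "\<lambda>(g, u, v). (u, g, v)" "\<lambda>(g, u, v). (u, g, v)"])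
       (auto intro: odd_squarefree_triples_sym(2))
  have "real (card {t \<in> ?S. triple_congruent t}) = (\<Sum>t\<in>?S. if triple_congruent t then 1 else 0)"
    using finite_odd_squarefree_triples by (simp add: sum.If_cases Int_def)
  also have "\<dots> = (\<Sum>(g, u, v)\<in>?S. (1 + chi4 g * chi4 u + chi4 g * chi4 v + chi4 u * chi4 v) / 4)"
  proof (rule sum.cong[OF refl])
    fix t assume t: "t \<in> ?S"
    obtain g u v where e: "t = (g, u, v)" by (cases t) auto
    have "odd g" "odd u" "odd v" using t unfolding e odd_squarefree_triples_def by auto
    then show "(if triple_congruent t then 1 else 0) =
      (case t of (g, u, v) \<Rightarrow> (1 + chi4 g * chi4 u + chi4 g * chi4 v + chi4 u * chi4 v) / 4)"
      unfolding e prod.case by (rule congruent_indicator)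
  qed
  also have "\<dots> = ((\<Sum>t\<in>?S. 1) + (\<Sum>(g, u, v)\<in>?S. chi4 g * chi4 u) + (\<Sum>(g, u, v)\<in>?S. chi4 g * chi4 v)
      + (\<Sum>(g, u, v)\<in>?S. chi4 u * chi4 v)) / 4"
    by (simp only: case_prod_unfold sum_divide_distrib[symmetric] sum.distrib)
  also have "\<dots> = (real (card ?S) + 3 * chi4_triple_sum x) / 4"
    unfolding s1 s2 chi4_triple_sum_def[symmetric] by simp
  finally show ?thesis .
qed

lemma card_not_congruent:
  "real (card {t \<in> odd_squarefree_triples x. \<not> triple_congruent t}) =
     3 * (real (card (odd_squarefree_triples x)) - chi4_triple_sum x) / 4"
proof -
  let ?S = "odd_squarefree_triples x"
  have "card ?S = card {t \<in> ?S. triple_congruent t} + card {t \<in> ?S. \<not> triple_congruent t}"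
    using finite_odd_squarefree_triples[of x]
    by (subst card_Un_disjoint[symmetric]) (auto intro!: arg_cong[where f = card])
  then have "real (card ?S) = real (card {t \<in> ?S. triple_congruent t}) + real (card {t \<in> ?S. \<not> triple_congruent t})"
    by simp
  then show ?thesis unfolding card_congruent by (simp add: field_simps)
qed

text \<open>If a product of two entries is 1, both are 1, and a single entry up to \<open>x\<close>
  remains in one of three places.\<close>

lemma card_improper_le:
  assumes "x \<ge> 0"
  shows "real (card (odd_squarefree_triples x - proper_triples)) \<le> 3 * x"
proof -
  let ?N = "{n. n > 0 \<and> real n \<le> x}"
  let ?A = "(\<lambda>n. (1 :: nat, 1 :: nat, n)) ` ?N" and ?B = "(\<lambda>n. (1 :: nat, n, 1 :: nat)) ` ?N" and ?C = "(\<lambda>n. (n, 1 :: nat, 1 :: nat)) ` ?N"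
  have "odd_squarefree_triples x - proper_triples \<subseteq> ?A \<union> ?B \<union> ?C"
  proof
    fix t assume t: "t \<in> odd_squarefree_triples x - proper_triples"
    obtain g u v where e: "t = (g, u, v)" by (cases t) auto
    have o: "odd (g * u * v)" "real (g * u * v) \<le> x" "g * u = 1 \<or> g * v = 1 \<or> u * v = 1"
      using t unfolding e odd_squarefree_triples_def proper_triples_def by auto
    have "g > 0" "u > 0" "v > 0" using o(1) by (auto intro!: Nat.gr0I)
    with o(2,3) show "t \<in> ?A \<union> ?B \<union> ?C" unfolding e by auto
  qed
  then have "card (odd_squarefree_triples x - proper_triples) \<le> card (?A \<union> ?B \<union> ?C)"
    by (intro card_mono) auto
  also have "\<dots> \<le> card ?A + card ?B + card ?C"
    using card_Un_le[of "?A \<union> ?B" ?C] card_Un_le[of ?A ?B] by linarith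
  also have "\<dots> \<le> card ?N + card ?N + card ?N" by (intro add_mono card_image_le) auto
  finally have "real (card (odd_squarefree_triples x - proper_triples)) \<le> 3 * real (card ?N)" by linarith
  also have "real (card ?N) = summatory (\<lambda>_. 1) x" by (simp add: summatory_def)
  also have "\<dots> \<le> x" by (rule summatory_one_bounds(1)[OF assms])
  finally show ?thesis by simp
qed

lemma card_proper_bounds:
  assumes "x \<ge> 0"
  shows "\<bar>real (card {t \<in> odd_squarefree_triples x \<inter> proper_triples. P t}) - real (card {t \<in> odd_squarefree_triples x. P t})\<bar> \<le> 3 * x"
proof -
  let ?S = "odd_squarefree_triples x"
  have f: "finite ?S" by (rule finite_odd_squarefree_triples)
  have "card {t \<in> ?S. P t} \<le> card ({t \<in> ?S \<inter> proper_triples. P t} \<union> (?S - proper_triples))"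
    using f by (intro card_mono) auto
  also have "\<dots> \<le> card {t \<in> ?S \<inter> proper_triples. P t} + card (?S - proper_triples)" by (rule card_Un_le)
  finally have "real (card {t \<in> ?S. P t}) \<le> real (card {t \<in> ?S \<inter> proper_triples. P t}) + 3 * x"
    using card_improper_le[OF assms] by linarith
  moreover have "card {t \<in> ?S \<inter> proper_triples. P t} \<le> card {t \<in> ?S. P t}"
    using f by (intro card_mono) auto
  ultimately show ?thesis by linarith
qed

text \<open>Each field yields six ordered triples, and the congruent and noncongruent ones have
  their own cutoffs \<open>Y\<close> and \<open>Y / 4\<close>. Degenerate triples cost
  \<open>3 Y + 3 Y / 4\<close>, which is at most \<open>4 Y\<close>.\<close>

lemma biquadratic_count_bounds:
  assumes "X \<ge> 0"
  defines "Y \<equiv> sqrt X"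
  shows "\<bar>6 * real (biquadratic_count X)
    - ((real (card (odd_squarefree_triples Y)) + 3 * chi4_triple_sum Y) / 4
       + 3 * (real (card (odd_squarefree_triples (Y / 4))) - chi4_triple_sum (Y / 4)) / 4)\<bar> \<le> 4 * Y"
proof -
  define Z where "Z = Y / 4"
  have Y: "Y \<ge> 0" "Z \<ge> 0" using assms by (simp_all add: Z_def)
  let ?S = "{t \<in> proper_triples. triple_disc t \<le> X}"
  let ?A = "{t \<in> odd_squarefree_triples Y \<inter> proper_triples. triple_congruent t}"
  let ?B = "{t \<in> odd_squarefree_triples Z \<inter> proper_triples. \<not> triple_congruent t}"
  have "t \<in> ?S \<longleftrightarrow> t \<in> ?A \<union> ?B" for t
  proof -
    obtain g u v where e: "t = (g, u, v)" by (rule prod_cases3)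
    show ?thesis
      unfolding e using triple_disc_le_iff[OF assms(1), of g u v]
      by (cases "triple_congruent (g, u, v)")
         (auto simp: odd_squarefree_triples_def proper_triples_def Y_def Z_def simp del: of_nat_mult)
  qed
  then have S: "?S = ?A \<union> ?B" unfolding set_eq_iff by (rule allI)
  have fin: "finite ?A" "finite ?B" using finite_odd_squarefree_triples[of Y] finite_odd_squarefree_triples[of Z] by auto
  have c: "card ?S = card ?A + card ?B" unfolding S by (rule card_Un_disjoint[OF fin]) auto
  have disc_sym: "triple_disc (b, a, c) = triple_disc (a, b, c)" "triple_disc (a, c, b) = triple_disc (a, b, c)" for a b c
    by (auto simp: triple_disc_def triple_congruent_def mult_ac)
  have "card ?S = 6 * card {(a, b, c) \<in> ?S. a < b \<and> b < c}"
  proof (rule card_symmetric_triples)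
    show "finite ?S" unfolding S using fin by simp
    show "(b, a, c) \<in> ?S" if "(a, b, c) \<in> ?S" for a b c
      using that proper_triples_sym(1)[of a b c] by (simp add: disc_sym(1)[where a = a and b = b and c = c])
    show "(a, c, b) \<in> ?S" if "(a, b, c) \<in> ?S" for a b c
      using that proper_triples_sym(2)[of a b c] by (simp add: disc_sym(2)[where a = a and b = b and c = c])
    show "a \<noteq> b \<and> a \<noteq> c \<and> b \<noteq> c" if "(a, b, c) \<in> ?S" for a b c
      using that proper_triples_distinct[of a b c] by blast
  qed
  also have "{(a, b, c) \<in> ?S. a < b \<and> b < c} = {(g, u, v) \<in> proper_triples. g < u \<and> u < v \<and> triple_disc (g, u, v) \<le> X}"
    by auto
  finally have "6 * real (biquadratic_count X) = real (card ?A) + real (card ?B)"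
    using c unfolding biquadratic_count_eq[symmetric] by linarith
  moreover have "\<bar>real (card ?A) - (real (card (odd_squarefree_triples Y)) + 3 * chi4_triple_sum Y) / 4\<bar> \<le> 3 * Y"
    using card_proper_bounds[OF Y(1), of triple_congruent] unfolding card_congruent .
  moreover have "\<bar>real (card ?B) - 3 * (real (card (odd_squarefree_triples Z)) - chi4_triple_sum Z) / 4\<bar> \<le> 3 * Z"
    using card_proper_bounds[OF Y(2), of "\<lambda>t. \<not> triple_congruent t"] unfolding card_not_congruent .
  moreover have "3 * Y + 3 * Z \<le> 4 * Y" using Y by (simp add: Z_def)
  ultimately show ?thesis unfolding Z_def[symmetric] by linarith
qed

section \<open>Asymptotics of the counts\<close>

text \<open>The case of trivial characters, \<open>\<kappa> = 1\<close>: the constant is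
  \<open>1/2 * 2/5\<close> times the Euler product.\<close>

lemma card_odd_squarefree_triples_asymptotics:
  "\<exists>K. \<forall>x\<ge>1. \<bar>real (card (odd_squarefree_triples x)) - biquadratic_product / 5 * x * (ln x)\<^sup>2\<bar> \<le> K * (x * (1 + ln x))"
proof -
  interpret character_triple "\<lambda>_. 1" "\<lambda>_. 1" "\<lambda>_. 1" by (rule character_triple_one)
  have "\<exists>K. \<forall>x\<ge>1. \<bar>summatory (\<lambda>n. if odd n \<and> squarefree n then dirichlet_conv (\<lambda>_. 1) (dirichlet_conv (\<lambda>_. 1) (\<lambda>_. 1)) n else 0) x
     - 1 * ((\<Sum>n. sieve_fun (\<lambda>_. 1) (\<lambda>_. 1) (\<lambda>_. 1) n / real n) / 2 * x * (ln x)\<^sup>2)\<bar> \<le> K * (x * (1 + ln x))"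
    by (rule summatory_odd_squarefree_bound[of 1 5]) (use summatory_triple_bound in simp)
  moreover have "(\<Sum>(g, u, v)\<in>odd_squarefree_triples x. 1 * 1 * 1) = real (card (odd_squarefree_triples x))" for x
    by (simp add: case_prod_unfold)
  ultimately show ?thesis
    unfolding summatory_eq_sum_triples sieve_fun_sum_eq_biquadratic_product by simp
qed

text \<open>The case \<open>\<kappa> = 0\<close>: the bound for the character sums leaves no main
  term.\<close>

lemma chi4_triple_sum_bound:
  "\<exists>K. \<forall>x\<ge>1. \<bar>chi4_triple_sum x\<bar> \<le> K * (x * (1 + ln x))"
proof -
  interpret character_triple "\<lambda>_. 1" chi4 chi4 by (rule character_triple_chi4)
  have "\<exists>K. \<forall>x\<ge>1. \<bar>summatory (\<lambda>n. if odd n \<and> squarefree n then dirichlet_conv (\<lambda>_. 1) (dirichlet_conv chi4 chi4) n else 0) x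
     - 0 * ((\<Sum>n. sieve_fun (\<lambda>_. 1) chi4 chi4 n / real n) / 2 * x * (ln x)\<^sup>2)\<bar> \<le> K * (x * (1 + ln x))"
    by (rule summatory_odd_squarefree_bound[of 0 1]) (use abs_summatory_triple_chi4_le in simp)
  then show ?thesis unfolding summatory_eq_sum_triples chi4_triple_sum_def by simp
qed

theorem theorem6p2:
  shows "(\<lambda>X::real. real (biquadratic_count X) -
           7 / 1920 * sqrt X * (ln X)\<^sup>2 *
             (\<Prod>p::nat. if prime p then (1 - 1 / real p) ^ 3 * (1 + 3 / real p) else 1))
         \<in> O[at_top](\<lambda>X. sqrt X * ln X)"
proof -
  define P where "P = biquadratic_product"
  obtain K1 where K1: "\<And>x. x \<ge> 1 \<Longrightarrow> \<bar>real (card (odd_squarefree_triples x)) - P / 5 * x * (ln x)\<^sup>2\<bar> \<le> K1 * (x * (1 + ln x))"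
    using card_odd_squarefree_triples_asymptotics unfolding P_def by blast
  obtain K2 where K2: "\<And>x. x \<ge> 1 \<Longrightarrow> \<bar>chi4_triple_sum x\<bar> \<le> K2 * (x * (1 + ln x))"
    using chi4_triple_sum_bound by blast
  \<comment> \<open>The condition \<open>X >= 16\<close> makes \<open>Y / 4 >= 1\<close>, so the
    bounds are available at both cutoffs, and \<open>ln X >= 1\<close>, so that \<open>Y\<close> is
    absorbed by \<open>Y ln X\<close>.\<close>
  have "\<bar>real (biquadratic_count X) - 7 / 1920 * sqrt X * (ln X)\<^sup>2 * P\<bar> \<le> (\<bar>K1\<bar> + \<bar>K2\<bar> + \<bar>P\<bar> + 1) * (sqrt X * ln X)"
    if X: "X \<ge> 16" for X
  proof -
    define Y L l4 where "Y = sqrt X" and "L = ln X" and "l4 = ln (4 :: real)"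
    define W where "W = Y * L"
    have "sqrt 16 \<le> Y" unfolding Y_def using X by (intro real_sqrt_le_mono)
    then have Y4: "Y \<ge> 4" by simp
    have l4: "0 \<le> l4" "l4 \<le> 2"
      using ln_2_less_1 ln_mult[of 2 "2::real"] by (simp_all add: l4_def)
    have "exp 1 \<le> (16::real)" using exp_le by linarith
    then have L1: "L \<ge> 1" using X unfolding L_def by (subst ln_ge_iff) linarith+
    have lnY: "ln Y = L / 2" unfolding Y_def L_def using X by (simp add: ln_sqrt)
    have lnZ: "ln (Y / 4) = L / 2 - l4" using Y4 lnY by (simp add: ln_div l4_def)
    have W: "Y \<le> W" "0 \<le> W" using L1 Y4 by (simp_all add: W_def)
    have b1: "K * (Y * (1 + ln Y)) \<le> 2 * \<bar>K\<bar> * W" for K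
    proof -
      have "K * (Y * (1 + ln Y)) \<le> \<bar>K\<bar> * (Y * (1 + ln Y))" using L1 Y4 lnY by (intro mult_right_mono) auto
      also have "\<dots> \<le> \<bar>K\<bar> * (Y * (2 * L))" using L1 Y4 lnY by (intro mult_left_mono) auto
      finally show ?thesis by (simp add: W_def mult_ac)
    qed
    have b2: "K * (Y / 4 * (1 + ln (Y / 4))) \<le> \<bar>K\<bar> * W" for K
    proof -
      have nn: "0 \<le> ln (Y / 4)" using Y4 by simp
      have "K * (Y / 4 * (1 + ln (Y / 4))) \<le> \<bar>K\<bar> * (Y / 4 * (1 + ln (Y / 4)))" using nn Y4 by (intro mult_right_mono) auto
      also have "\<dots> \<le> \<bar>K\<bar> * (Y / 2 * (2 * L))"
        using nn L1 Y4 lnZ l4 by (intro mult_left_mono mult_mono) auto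
      finally show ?thesis by (simp add: W_def)
    qed
    define T T' E E' where "T = real (card (odd_squarefree_triples Y))" and "T' = real (card (odd_squarefree_triples (Y / 4)))"
      and "E = chi4_triple_sum Y" and "E' = chi4_triple_sum (Y / 4)"
    have t1: "\<bar>T - P / 5 * Y * (ln Y)\<^sup>2\<bar> \<le> 2 * \<bar>K1\<bar> * W"
      using K1[of Y] b1[of K1] Y4 unfolding T_def by linarith
    have t2: "\<bar>T' - P / 5 * (Y / 4) * (ln (Y / 4))\<^sup>2\<bar> \<le> \<bar>K1\<bar> * W"
      using K1[of "Y / 4"] b2[of K1] Y4 unfolding T'_def by linarith
    have t3: "\<bar>E\<bar> \<le> 2 * \<bar>K2\<bar> * W" using K2[of Y] b1[of K2] Y4 unfolding E_def by linarith
    have t4: "\<bar>E'\<bar> \<le> \<bar>K2\<bar> * W" using K2[of "Y / 4"] b2[of K2] Y4 unfolding E'_def by linarith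
    have t5: "\<bar>6 * real (biquadratic_count X) - ((T + 3 * E) / 4 + 3 * (T' - E') / 4)\<bar> \<le> 4 * Y"
      using biquadratic_count_bounds[of X] X unfolding T_def T'_def E_def E'_def Y_def by simp
    define M where "M = P * (Y * L\<^sup>2)"
    \<comment> \<open>From \<open>(ln (Y / 4))^2 = (L / 2 - l4)^2\<close>: the part
      \<open>L^2 / 4\<close> belongs to the main term, and \<open>l4^2 - L l4\<close> is of lower
      order.\<close>
    define D where "D = P * (Y * (l4\<^sup>2 - L * l4))"
    have m1: "P / 5 * Y * (ln Y)\<^sup>2 = M / 20" unfolding lnY M_def by (simp add: power2_eq_square)
    have m2: "P / 5 * (Y / 4) * (ln (Y / 4))\<^sup>2 = M / 80 + D / 20"
      unfolding lnZ M_def D_def by (simp add: power2_eq_square field_simps)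
    have D: "\<bar>D\<bar> \<le> 6 * (\<bar>P\<bar> * W)"
    proof -
      have "l4\<^sup>2 \<le> 2\<^sup>2" using l4 by (intro power_mono) auto
      then have "l4\<^sup>2 \<le> 4 * L" using L1 by simp
      moreover have "0 \<le> L * l4" "L * l4 \<le> L * 2" using l4 L1 by (auto intro!: mult_left_mono)
      ultimately have "\<bar>l4\<^sup>2 - L * l4\<bar> \<le> 6 * L" using zero_le_power2[of l4] L1 by linarith
      then have "\<bar>P\<bar> * (Y * \<bar>l4\<^sup>2 - L * l4\<bar>) \<le> \<bar>P\<bar> * (Y * (6 * L))" using Y4 by (intro mult_left_mono) auto
      then show ?thesis using Y4 by (simp add: D_def W_def abs_mult mult_ac)
    qed
    have goal: "7 / 1920 * sqrt X * (ln X)\<^sup>2 * P = 7 / 1920 * M" unfolding M_def Y_def L_def by simp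
    have expand: "(\<bar>K1\<bar> + \<bar>K2\<bar> + \<bar>P\<bar> + 1) * (sqrt X * ln X) = \<bar>K1\<bar> * W + \<bar>K2\<bar> * W + \<bar>P\<bar> * W + W"
      unfolding W_def Y_def L_def by (simp add: distrib_right)
    define k1 k2 k3 where "k1 = \<bar>K1\<bar> * W" and "k2 = \<bar>K2\<bar> * W" and "k3 = \<bar>P\<bar> * W"
    have k: "0 \<le> k1" "0 \<le> k2" "0 \<le> k3" using W(2) by (simp_all add: k1_def k2_def k3_def)
    define c where "c = real (biquadratic_count X)"
    have "\<bar>T - M / 20\<bar> \<le> 2 * k1" using t1 unfolding m1 k1_def by simp
    then have u1: "T - M / 20 \<le> 2 * k1" "M / 20 - T \<le> 2 * k1" by linarith+
    have "\<bar>T' - (M / 80 + D / 20)\<bar> \<le> k1" using t2 unfolding m2 k1_def by simp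
    then have u2: "T' - (M / 80 + D / 20) \<le> k1" "(M / 80 + D / 20) - T' \<le> k1" by linarith+
    have "\<bar>E\<bar> \<le> 2 * k2" using t3 unfolding k2_def by simp
    then have u3: "E \<le> 2 * k2" "- E \<le> 2 * k2" by linarith+
    have "\<bar>E'\<bar> \<le> k2" using t4 unfolding k2_def by simp
    then have u4: "E' \<le> k2" "- E' \<le> k2" by linarith+
    have "\<bar>D\<bar> \<le> 6 * k3" using D unfolding k3_def by simp
    then have u6: "D \<le> 6 * k3" "- D \<le> 6 * k3" by linarith+
    have u5: "6 * c - ((T + 3 * E) / 4 + 3 * (T' - E') / 4) \<le> 4 * Y" "((T + 3 * E) / 4 + 3 * (T' - E') / 4) - 6 * c \<le> 4 * Y"
      using t5 unfolding abs_le_iff c_def by simp_all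
    have a1: "(T + 3 * E) / 4 \<le> M / 80 + k1 / 2 + 3 * k2 / 2" using u1(1) u3(1) unfolding add_divide_distrib by linarith
    have a2: "3 * (T' - E') / 4 \<le> 3 * M / 320 + k3 + 3 * k1 / 4 + 3 * k2 / 4" using u2(1) u4(2) u6(1) k(3)
      unfolding right_diff_distrib diff_divide_distrib by linarith
    \<comment> \<open>Main term: \<open>1/80 + 3/320 = 7/320\<close>, which becomes
      \<open>7/1920\<close> after division by 6.\<close>
    have a3: "6 * c \<le> 7 * M / 320 + 5 * k1 / 4 + 9 * k2 / 4 + k3 + 4 * W" using u5(1) a1 a2 W(1) by linarith
    have b1: "M / 80 - k1 / 2 - 3 * k2 / 2 \<le> (T + 3 * E) / 4" using u1(2) u3(2) unfolding add_divide_distrib by linarith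
    have b2: "3 * M / 320 - k3 - 3 * k1 / 4 - 3 * k2 / 4 \<le> 3 * (T' - E') / 4" using u2(2) u4(1) u6(2) k(3)
      unfolding right_diff_distrib diff_divide_distrib by linarith
    have b3: "7 * M / 320 - 5 * k1 / 4 - 9 * k2 / 4 - k3 - 4 * W \<le> 6 * c" using u5(2) b1 b2 W(1) by linarith
    have "c - 7 / 1920 * M \<le> k1 + k2 + k3 + W" using a3 k W(2) by linarith
    moreover have "7 / 1920 * M - c \<le> k1 + k2 + k3 + W" using b3 k W(2) by linarith
    ultimately show ?thesis
      unfolding goal expand k1_def[symmetric] k2_def[symmetric] k3_def[symmetric] c_def[symmetric] by linarith
  qed
  then have "eventually (\<lambda>X. norm (real (biquadratic_count X) - 7 / 1920 * sqrt X * (ln X)\<^sup>2 * P)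
      \<le> (\<bar>K1\<bar> + \<bar>K2\<bar> + \<bar>P\<bar> + 1) * norm (sqrt X * ln X)) at_top"
    by (intro eventually_at_top_linorderI[of 16]) simp
  then have "(\<lambda>X. real (biquadratic_count X) - 7 / 1920 * sqrt X * (ln X)\<^sup>2 * P) \<in> O[at_top](\<lambda>X. sqrt X * ln X)"
    by (rule bigoI)
  then show ?thesis unfolding P_def biquadratic_product_def .
qed

end
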